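(* Let $\widetilde{\mathsf{A}}(t')$ be an $N\times N$ time-dependent matrix, $t'\in I$, let $\mathsf{A}(t',t):=\widetilde{\mathsf{A}}(t')\Theta(t'-t)$, and let $\mathsf{U}(t',t)$ be the time-ordered exponential of $\widetilde{\mathsf{A}}$. Let $\boldsymbol{w}$ and $\boldsymbol{v}$ be time-independent $N\times 1$ vectors with $\boldsymbol{w}^H\boldsymbol{v}=1$. Assume that for every $t'\in I$ the usual non-Hermitian Lanczos algorithm with inputs $\widetilde{\mathsf{A}}(t'),\boldsymbol{w},\boldsymbol{v}$ has no (true) breakdown in the $k$th iteration, for $k=1,\dots,N-1$. If all the entries of $\widetilde{\mathsf{A}}(t')$ are smooth functions of $t'$, then there are smooth functions $\widetilde{\alpha}_j(t',t)$ for $0\le j\le N-1$ and $\widetilde{\beta}_i(t',t)$ for $1\le i\le N-1$, and distributions $$\alpha_j(t',t):=\widetilde{\alpha}_j(t',t)\Theta(t'-t),\qquad \beta_i(t',t):=\widetilde{\beta}_i(t',t)\Theta(t'-t),$$ such that, for all $1\le i\le N-1$, $\beta_i(t,t)\equiv 0$, $\widetilde{\beta}_i^{(1,0)}(t,t)\not\equiv 0$, $\widetilde{\beta}_i^{(0,1)}(t,t)\not\equiv 0$, and the tridiagonal matrix $$\mathsf{T}:=\begin{bmatrix}\alpha_0&\delta&&\\ \beta_1&\alpha_1&\ddots&\\ &\ddots&\ddots&\delta\\ &&\beta_{N-1}&\alpha_{N-1}\end{bmatrix}$$ obeys $$\boldsymbol{w}^H\mathsf{A}^{\ast n}\boldsymbol{v}=\big(\mathsf{T}^{\ast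 n}\big)_{1,1}\quad\text{for all } n\ge 0,$$ $$\boldsymbol{w}^H\mathsf{U}(t',t)\boldsymbol{v}=\Theta(t'-t)\ast \mathsf{R}_\ast(\mathsf{T})_{1,1}(t',t).$$ Furthermore, the $\ast$-inverses $\beta_i^{\ast-1}$, $1\le i\le N-1$, exist and are of the form $\beta_i^{\ast-1}=\delta^{(3)}\ast b$ with $b\in \mathrm{Sm}_\Theta$ (where $b$ may depend on $i$).
   Context: Time variables $t,t'$ range over an interval $I\subseteq\mathbb{R}$; matrices and vectors are complex; $\boldsymbol{w}^H$ is the Hermitian transpose. $\Theta$ is the Heaviside function with $\Theta(0)=1$; $\delta^{(i)}$ is the $i$th derivative of the Dirac delta distribution $\delta=\delta^{(0)}$; $\delta$ and $\delta^{(i)}$ without argument mean $\delta(t'-t)$ and $\delta^{(i)}(t'-t)$. Class $\mathrm{D}$: distributions of the form $d(t',t)=\widetilde d(t',t)\Theta(t'-t)+\sum_{i=0}^{M}\widetilde d_i(t',t)\delta^{(i)}(t'-t)$ with $M$ finite and $\widetilde d,\widetilde d_i$ ordinary functions smooth in both variables. Subclass $\mathrm{Sm}_\Theta$: those of the form $f(t',t)=\widetilde f(t',t)\Theta(t'-t)$ with $\widetilde f$ smooth in both variables; the tilde denotes the smooth part. $\ast$-product: $(f_2\ast f_1)(t',t):=\int_{-\infty}^{\infty}f_2(t',\tau)f_1(\tau,t)\,d\tau$ for $f_1,f_2\in\mathrm{D}$ (in the sense of distributions). It is associative with unit $1_\ast=\delta(t'-t)$. For $f_1,f_2\in\mathrm{Sm}_\Theta$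 it equals $\Theta(t'-t)\int_t^{t'}\widetilde f_2(t',\tau)\widetilde f_1(\tau,t)\,d\tau$; moreover $\delta^{(j)}\ast f$ is the $j$th distributional $t'$-derivative of $f$ and $f\ast\delta^{(j)}$ is $(-1)^j$ times the $j$th distributional $t$-derivative of $f$. A function of one variable, e.g. $\widetilde{\mathsf{A}}(t')$, is treated as a function of $(t',t)$ depending only on the left variable. The $\ast$-product extends to matrices by using the ordinary matrix product between the integrands. $\mathsf{M}^{\ast k}$ is the $k$th $\ast$-power, with $\mathsf{M}^{\ast 0}=\mathsf{Id}\,1_\ast$. The $\ast$-inverse $f^{\ast-1}$ of $f$ satisfies $f^{\ast-1}\ast f=f\ast f^{\ast-1}=1_\ast$. The $\ast$-resolvent of a matrix $\mathsf{M}$ is $\mathsf{R}_\ast(\mathsf{M}):=(\mathsf{Id}\,1_\ast-\mathsf{M})^{\ast-1}=\mathsf{Id}\,1_\ast+\sum_{k\ge1}\mathsf{M}^{\ast k}$. $\widetilde f^{(j,k)}(\tau,\rho)$ denotes the $j$th $t'$-derivative and $k$th $t$-derivative of $\widetilde f(t',t)$ evaluated at $t'=\tau$, $t=\rho$. "$\equiv0$" and "$\not\equiv0$" mean identically null, respectively not identically null, as a function of $t\in I$. Time-ordered exponential: $\mathsf{U}(t',t)$ is the unique solution, for $t\le t'$ in $I$, of $\frac{d}{dt'}\mathsf{U}(t',t)=\widetilde{\mathsf{A}}(t')\mathsf{U}(t',t)$, $\mathsf{U}(t,t)=\mathsf{Id}$ for all $t\in I$ (and it is taken to be $0$ for $t'<t$).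 Usual non-Hermitian Lanczos algorithm with inputs a constant matrix $\mathsf{M}$ and vectors $\boldsymbol{w},\boldsymbol{v}$ with $\boldsymbol{w}^H\boldsymbol{v}=1$: set $\boldsymbol{v}_{-1}=\boldsymbol{w}_{-1}=0$, $\boldsymbol{v}_0=\boldsymbol{v}$, $\boldsymbol{w}_0=\boldsymbol{w}$, and for $k=1,2,\dots$ (with the $\boldsymbol{w}_{-1}$ term absent for $k=1$) compute $a_{k-1}=\boldsymbol{w}_{k-1}^H\mathsf{M}\boldsymbol{v}_{k-1}$, $\boldsymbol{w}_k^H=\boldsymbol{w}_{k-1}^H\mathsf{M}-a_{k-1}\boldsymbol{w}_{k-1}^H-b_{k-1}\boldsymbol{w}_{k-2}^H$, $\widehat{\boldsymbol{v}}_k=\mathsf{M}\boldsymbol{v}_{k-1}-a_{k-1}\boldsymbol{v}_{k-1}-\boldsymbol{v}_{k-2}$, $b_k=\boldsymbol{w}_k^H\mathsf{M}\boldsymbol{v}_{k-1}$, and, if $b_k\neq0$, $\boldsymbol{v}_k=\widehat{\boldsymbol{v}}_k/b_k$. There is no (true) breakdown in the first $n-1$ iterations exactly when $b_1,\dots,b_{n-1}$ are all nonzero, i.e. when the algorithm generates an $n\times n$ tridiagonal matrix with nonzero off-diagonal elements. *)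

theory Defs
  imports "HOL-Analysis.Analysis"
begin

section \<open>Smooth functions on an interval\<close>

text \<open>Derivatives are taken within the interval \<open>I\<close>, hence are one-sided at those end points that
  belong to \<open>I\<close>. Values of functions outside \<open>I\<close> never matter.\<close>

definition iter_deriv :: "real set \<Rightarrow> nat \<Rightarrow> (real \<Rightarrow> complex) \<Rightarrow> real \<Rightarrow> complex" where
  "iter_deriv I k f = ((\<lambda>g t. vector_derivative g (at t within I)) ^^ k) f"

definition smooth_on :: "real set \<Rightarrow> (real \<Rightarrow> complex) \<Rightarrow> bool" where
  "smooth_on I f \<longleftrightarrow> (\<forall>k. \<forall>t\<in>I. iter_deriv I k f differentiable (at t within I))"

text \<open>\<open>partial_deriv I j k f \<tau> \<rho>\<close> is the \<open>j\<close>th derivative in the left variable \<open>t'\<close> and the \<open>k\<close>th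
  derivative in the right variable \<open>t\<close> of \<open>f\<close>, at \<open>t' = \<tau>\<close> and \<open>t = \<rho>\<close>.\<close>

definition partial_deriv ::
  "real set \<Rightarrow> nat \<Rightarrow> nat \<Rightarrow> (real \<Rightarrow> real \<Rightarrow> complex) \<Rightarrow> real \<Rightarrow> real \<Rightarrow> complex" where
  "partial_deriv I j k f \<tau> \<rho> = iter_deriv I j (\<lambda>t'. iter_deriv I k (f t') \<rho>) \<tau>"

definition smooth2_on :: "real set \<Rightarrow> (real \<Rightarrow> real \<Rightarrow> complex) \<Rightarrow> bool" where
  "smooth2_on I f \<longleftrightarrow>
     (\<forall>j k. continuous_on (I \<times> I) (\<lambda>(t', t). partial_deriv I j k f t' t) \<and>
       (\<forall>t'\<in>I. \<forall>t\<in>I.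
          (\<lambda>s. partial_deriv I j k f s t) differentiable (at t' within I) \<and>
          (\<lambda>s. partial_deriv I j k f t' s) differentiable (at t within I)))"


section \<open>Distributional kernels\<close>

text \<open>
  A distribution \<open>d(t', t)\<close> is represented by its pairing in the right variable,
    \<open>d t' \<phi> = \<integral> d(t', \<tau>) \<phi>(\<tau>) d\<tau>\<close>,
  for every \<open>t' \<in> I\<close> and every smooth test function \<open>\<phi>\<close> on \<open>I\<close> that vanishes near the left end of
  \<open>I\<close>. No support condition is needed at the right end, since all kernels considered are
  supported in \<open>t \<le> t'\<close>; and with this choice \<open>\<tau> \<mapsto> d \<tau> \<phi>\<close> is again a test function
  for \<open>d\<close> of class \<open>D\<close>, so that kernels can be composed.
\<close>

type_synonym kernel = "real \<Rightarrow> (real \<Rightarrow> complex) \<Rightarrow> complex"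

definition test_fun :: "real set \<Rightarrow> (real \<Rightarrow> complex) \<Rightarrow> bool" where
  "test_fun I \<phi> \<longleftrightarrow> smooth_on I \<phi> \<and> (\<exists>a\<in>interior I. \<forall>t\<in>I. t \<le> a \<longrightarrow> \<phi> t = 0)"

text \<open>Equality of distributions.\<close>

definition keq :: "real set \<Rightarrow> kernel \<Rightarrow> kernel \<Rightarrow> bool" where
  "keq I d e \<longleftrightarrow> (\<forall>t'\<in>I. \<forall>\<phi>. test_fun I \<phi> \<longrightarrow> d t' \<phi> = e t' \<phi>)"

definition heaviside :: "real \<Rightarrow> complex" where
  "heaviside x = (if 0 \<le> x then 1 else 0)"

definition times_theta :: "(real \<Rightarrow> real \<Rightarrow> complex) \<Rightarrow> real \<Rightarrow> real \<Rightarrow> complex" where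
  "times_theta f t' t = f t' t * heaviside (t' - t)"

text \<open>The distribution given by an ordinary function of \<open>(t', t)\<close>.\<close>

definition fun_kernel :: "real set \<Rightarrow> (real \<Rightarrow> real \<Rightarrow> complex) \<Rightarrow> kernel" where
  "fun_kernel I F t' \<phi> = integral I (\<lambda>\<tau>. F t' \<tau> * \<phi> \<tau>)"

text \<open>The distribution \<open>g(t', t) \<delta>\<^sup>(\<^sup>i\<^sup>)(t' - t)\<close>. There is no sign, because
  \<open>\<delta>\<^sup>(\<^sup>i\<^sup>)(t' - \<tau>)\<close> is \<open>(-1)\<^sup>i\<close> times the \<open>i\<close>th \<open>\<tau>\<close>-derivative of \<open>\<delta>(t' - \<tau>)\<close>, and integrating
  by parts produces a second factor \<open>(-1)\<^sup>i\<close>.\<close>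

definition delta_kernel :: "real set \<Rightarrow> nat \<Rightarrow> (real \<Rightarrow> real \<Rightarrow> complex) \<Rightarrow> kernel" where
  "delta_kernel I i g t' \<phi> = iter_deriv I i (\<lambda>\<tau>. g t' \<tau> * \<phi> \<tau>) t'"

abbreviation delta :: "real set \<Rightarrow> nat \<Rightarrow> kernel" where
  "delta I i \<equiv> delta_kernel I i (\<lambda>_ _. 1)"

abbreviation star_one :: "real set \<Rightarrow> kernel" where
  "star_one I \<equiv> delta I 0"

definition class_D :: "real set \<Rightarrow> kernel \<Rightarrow> bool" where
  "class_D I d \<longleftrightarrow>
     (\<exists>f M g. smooth2_on I f \<and> (\<forall>i\<le>M. smooth2_on I (g i)) \<and>
       keq I d (\<lambda>t' \<phi>. fun_kernel I (times_theta f) t' \<phi> + (\<Sum>i\<le>M. delta_kernel I i (g i) t' \<phi>)))"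

definition class_Sm_theta :: "real set \<Rightarrow> kernel \<Rightarrow> bool" where
  "class_Sm_theta I d \<longleftrightarrow> (\<exists>f. smooth2_on I f \<and> keq I d (fun_kernel I (times_theta f)))"


section \<open>The \<open>*\<close>-product\<close>

text \<open>Pairing \<open>\<integral> f2(t', \<tau>) f1(\<tau>, t) d\<tau>\<close> with \<open>\<phi>(t)\<close> gives
  \<open>\<integral> f2(t', \<tau>) (\<integral> f1(\<tau>, t) \<phi>(t) dt) d\<tau>\<close>.\<close>

definition star :: "kernel \<Rightarrow> kernel \<Rightarrow> kernel" where
  "star f2 f1 t' \<phi> = f2 t' (\<lambda>\<tau>. f1 \<tau> \<phi>)"

lemma star_assoc: "star (star h g) f = star h (star g f)"
  by (simp add: fun_eq_iff star_def)

lemma star_delta_left: "star (delta I j) f t' \<phi> = iter_deriv I j (\<lambda>\<tau>. f \<tau> \<phi>) t'"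
  by (simp add: star_def delta_kernel_def)

lemma star_one_left: "star (star_one I) f = f"
  by (simp add: fun_eq_iff star_delta_left iter_deriv_def)

lemma star_one_right: "star f (star_one I) = f"
  by (simp add: fun_eq_iff star_def delta_kernel_def iter_deriv_def)

definition is_star_inverse :: "real set \<Rightarrow> kernel \<Rightarrow> kernel \<Rightarrow> bool" where
  "is_star_inverse I f g \<longleftrightarrow>
     class_D I g \<and> keq I (star g f) (star_one I) \<and> keq I (star f g) (star_one I)"


section \<open>Matrices of distributions\<close>

text \<open>\<open>S\<close> is the finite set of row and column indices.\<close>

type_synonym 'i kmat = "'i \<Rightarrow> 'i \<Rightarrow> kernel"

definition kmat_one :: "real set \<Rightarrow> 'i kmat" where
  "kmat_one I i j = (if i = j then star_one I else (\<lambda>_ _. 0))"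

definition kmat_minus :: "'i kmat \<Rightarrow> 'i kmat \<Rightarrow> 'i kmat" where
  "kmat_minus P Q i j t' \<phi> = P i j t' \<phi> - Q i j t' \<phi>"

definition kmat_star :: "'i set \<Rightarrow> 'i kmat \<Rightarrow> 'i kmat \<Rightarrow> 'i kmat" where
  "kmat_star S P Q i j t' \<phi> = (\<Sum>k\<in>S. star (P i k) (Q k j) t' \<phi>)"

primrec kmat_power :: "real set \<Rightarrow> 'i set \<Rightarrow> 'i kmat \<Rightarrow> nat \<Rightarrow> 'i kmat" where
  "kmat_power I S P 0 = kmat_one I"
| "kmat_power I S P (Suc n) = kmat_star S P (kmat_power I S P n)"

definition kmat_eq :: "real set \<Rightarrow> 'i set \<Rightarrow> 'i kmat \<Rightarrow> 'i kmat \<Rightarrow> bool" where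
  "kmat_eq I S P Q \<longleftrightarrow> (\<forall>i\<in>S. \<forall>j\<in>S. keq I (P i j) (Q i j))"

definition is_kmat_inverse :: "real set \<Rightarrow> 'i set \<Rightarrow> 'i kmat \<Rightarrow> 'i kmat \<Rightarrow> bool" where
  "is_kmat_inverse I S P Q \<longleftrightarrow>
     (\<forall>i\<in>S. \<forall>j\<in>S. class_D I (Q i j)) \<and>
     kmat_eq I S (kmat_star S Q P) (kmat_one I) \<and> kmat_eq I S (kmat_star S P Q) (kmat_one I)"

text \<open>\<open>R\<close> is the \<open>*\<close>-resolvent of \<open>M\<close>; as a matrix over the associative algebra \<open>D\<close> it is unique up
  to equality of distributions.\<close>

definition is_star_resolvent :: "real set \<Rightarrow> 'i set \<Rightarrow> 'i kmat \<Rightarrow> 'i kmat \<Rightarrow> bool" where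
  "is_star_resolvent I S M R \<longleftrightarrow> is_kmat_inverse I S (kmat_minus (kmat_one I) M) R"

definition matrix_kernel :: "real set \<Rightarrow> (real \<Rightarrow> complex^'n^'n) \<Rightarrow> 'n kmat" where
  "matrix_kernel I A i j = fun_kernel I (times_theta (\<lambda>t' t. A t' $ i $ j))"

text \<open>\<open>w\<^sup>H P v\<close> for a matrix of distributions \<open>P\<close> and constant vectors \<open>w\<close>, \<open>v\<close>.\<close>

definition kmat_form :: "complex^'n \<Rightarrow> 'n kmat \<Rightarrow> complex^'n \<Rightarrow> kernel" where
  "kmat_form w P v t' \<phi> = (\<Sum>i\<in>UNIV. \<Sum>j\<in>UNIV. cnj (w $ i) * P i j t' \<phi> * v $ j)"

text \<open>Rows and columns are numbered from 0, so the \<open>(1,1)\<close> entry is \<open>tridiag I \<alpha> \<beta> 0 0\<close>, and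
  \<open>\<beta> i\<close> sits at position \<open>(i, i - 1)\<close>.\<close>

definition tridiag :: "real set \<Rightarrow> (nat \<Rightarrow> kernel) \<Rightarrow> (nat \<Rightarrow> kernel) \<Rightarrow> nat kmat" where
  "tridiag I \<alpha> \<beta> i j =
     (if j = i then \<alpha> i
      else if j = Suc i then star_one I
      else if i = Suc j then \<beta> i
      else (\<lambda>_ _. 0))"


section \<open>Time-ordered exponential\<close>

definition is_time_ordered_exp ::
  "real set \<Rightarrow> (real \<Rightarrow> complex^'n^'n) \<Rightarrow> (real \<Rightarrow> real \<Rightarrow> complex^'n^'n) \<Rightarrow> bool" where
  "is_time_ordered_exp I A U \<longleftrightarrow>
     (\<forall>t\<in>I. U t t = mat 1 \<and>
        (\<forall>t'\<in>I. t \<le> t' \<longrightarrow>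
           ((\<lambda>s. U s t) has_vector_derivative A t' ** U t' t) (at t' within (I \<inter> {t..}))) \<and>
        (\<forall>t'\<in>I. t' < t \<longrightarrow> U t' t = 0))"


section \<open>Non-Hermitian Lanczos algorithm\<close>

definition row_dot :: "complex^'n \<Rightarrow> complex^'n \<Rightarrow> complex" where
  "row_dot r x = (\<Sum>i\<in>UNIV. r $ i * x $ i)"

definition herm :: "complex^'n \<Rightarrow> complex^'n" where
  "herm w = (\<chi> i. cnj (w $ i))"

text \<open>The state after \<open>k\<close> iterations is
  \<open>(w\<^sub>k\<^sub>-\<^sub>1\<^sup>H, w\<^sub>k\<^sup>H, v\<^sub>k\<^sub>-\<^sub>1, v\<^sub>k, b\<^sub>k)\<close>, with \<open>w\<^sup>H\<close> stored as a row vector. Since the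
  \<open>w\<^sub>-\<^sub>1\<close> term is absent from the first iteration, \<open>b\<^sub>0\<close> is irrelevant and set to 0. After a
  breakdown (\<open>b\<^sub>k = 0\<close>) the later states are meaningless.\<close>

primrec lanczos ::
  "complex^'n^'n \<Rightarrow> complex^'n \<Rightarrow> complex^'n \<Rightarrow> nat \<Rightarrow>
     (complex^'n) \<times> (complex^'n) \<times> (complex^'n) \<times> (complex^'n) \<times> complex" where
  "lanczos M w v 0 = (0, herm w, 0, v, 0)"
| "lanczos M w v (Suc k) =
     (let (w_prev, w_cur, v_prev, v_cur, b) = lanczos M w v k;
          a = row_dot w_cur (M *v v_cur);
          w_next = w_cur v* M - a *s w_cur - b *s w_prev;
          v_hat = M *v v_cur - a *s v_cur - v_prev;
          b_next = row_dot w_next (M *v v_cur)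
      in (w_cur, w_next, v_cur, inverse b_next *s v_hat, b_next))"

definition lanczos_b :: "complex^'n^'n \<Rightarrow> complex^'n \<Rightarrow> complex^'n \<Rightarrow> nat \<Rightarrow> complex" where
  "lanczos_b M w v k = (case lanczos M w v k of (_, _, _, _, b) \<Rightarrow> b)"

definition no_breakdown :: "complex^'n^'n \<Rightarrow> complex^'n \<Rightarrow> complex^'n \<Rightarrow> nat \<Rightarrow> bool" where
  "no_breakdown M w v k \<longleftrightarrow> lanczos_b M w v k \<noteq> 0"

end

theory Submission
  imports Defs "HOL-Library.Function_Algebras"
begin

text \<open>
  Let \<open>\<partial>\<close> be differentiation of test functions; its inverse is \<open>*\<close>-multiplication by \<open>\<Theta>\<close>. Volterra operators of
  the second kind, \<open>\<phi> \<mapsto> c \<phi> + h * \<phi>\<close> with smooth \<open>c\<close> and \<open>h\<close>, form a ring that is stable under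
  conjugation by \<open>\<partial>\<close>, and such an operator is invertible as soon as its symbol \<open>c\<close> has no zero.
  Composing them with \<open>\<partial>\<^sup>m\<close> gives a graded algebra of operators of order \<open>m\<close> on which the symbol is
  multiplicative.

  The matrix \<open>A\<close> acts as the operator \<open>A(t) \<partial>\<^sup>-\<^sup>1\<close> of order \<open>-1\<close>. Running the Lanczos recursion in this algebra gives
  row vectors \<open>w\<^sub>k\<close> of order \<open>-k\<close>, column vectors \<open>v\<^sub>k\<close> of order \<open>k\<close>, and coefficients \<open>\<alpha>\<^sub>k\<close>, \<open>\<beta>\<^sub>k\<close> of
  order \<open>-1\<close> and \<open>-2\<close>, whose symbols are the quantities computed by the usual Lanczos algorithm for
  \<open>A(t)\<close>. The symbol \<open>b\<^sub>k(t)\<close> of \<open>\<beta>\<^sub>k\<close> is nonzero, so \<open>\<beta>\<^sub>k\<close> is invertible, its kernel vanishes on the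
  diagonal, and the first derivatives of the kernel on the diagonal are \<open>b\<^sub>k\<close> and \<open>-b\<^sub>k\<close>. Biorthogonality says
  that the matrices \<open>W\<close>, \<open>V\<close> formed by the vectors satisfy \<open>W V = 1\<close>; moreover \<open>V W = 1\<close>. Then
  \<open>T = W A V\<close>, so the powers of \<open>T\<close> are \<open>W A\<^sup>n V\<close> and its resolvent is \<open>W (1 - A)\<^sup>-\<^sup>1 V\<close>.
\<close>

section \<open>Functions of class \<open>C\<^sup>k\<close> on a set\<close>

text \<open>Dividing by \<open>\<beta>\<close> amounts to two differentiations, so the Lanczos
  vectors are in general no functions, even though the coefficients are smooth kernels; the
  recursion has to run in a noncommutative algebra that contains \<open>\<partial>\<close> and its
  inverse. Two choices make this algebra manageable. Test functions vanish near the left end of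
  \<open>I\<close>, so differentiation is bijective on them and no integration constants appear.
  Kernels are smooth on the whole square and are composed by oriented integrals, so nothing is
  differentiated across the jump of the Heaviside function. Over operators \<open>V W = 1\<close>
  does not follow formally from \<open>W V = 1\<close>: it is first obtained for the symbols, which
  are ordinary square matrices at each time, and the remaining defect is a Volterra operator.
  Inverting \<open>\<beta>\<close> needs no smallness of the kernel, as the Neumann series of a
  Volterra kernel always converges. The third derivative of delta comes from 2 + 1: the inverse of
  \<open>\<beta>\<close> has order 2, while smooth kernels have order \<open>- 1\<close>.\<close>

definition has_gradient ::
  "('a::euclidean_space \<Rightarrow> 'b::real_normed_vector) \<Rightarrow> ('a \<Rightarrow> 'a \<Rightarrow> 'b) \<Rightarrow> 'a set \<Rightarrow> bool" where
  "has_gradient f f' S \<longleftrightarrow>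
     (\<forall>x\<in>S. (f has_derivative (\<lambda>h. \<Sum>b\<in>Basis. (h \<bullet> b) *\<^sub>R f' b x)) (at x within S))"

lemma has_gradientD:
  "has_gradient f f' S \<Longrightarrow> x \<in> S \<Longrightarrow>
    (f has_derivative (\<lambda>h. \<Sum>b\<in>Basis. (h \<bullet> b) *\<^sub>R f' b x)) (at x within S)"
  by (simp add: has_gradient_def)

text \<open>The partial derivatives are quantified existentially because \<open>S\<close> is
  arbitrary: derivatives within \<open>S\<close> need not be unique at thin or isolated points, and
  a mere choice keeps the sum, product and chain rules free of assumptions on
  \<open>S\<close>.\<close>

primrec Ck :: "nat \<Rightarrow> 'a::euclidean_space set \<Rightarrow> ('a \<Rightarrow> 'b::real_normed_vector) \<Rightarrow> bool" where
  "Ck 0 S f \<longleftrightarrow> continuous_on S f"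
| "Ck (Suc n) S f \<longleftrightarrow> (\<exists>f'. has_gradient f f' S \<and> (\<forall>b\<in>Basis. Ck n S (f' b)))"

declare Ck.simps(2) [simp del]

lemma Ck_continuous_on: "Ck n S f \<Longrightarrow> continuous_on S f"
  by (cases n) (auto simp: Ck.simps(2) intro: has_derivative_continuous_on has_gradientD)

lemma Ck_Suc: "Ck (Suc n) S f \<Longrightarrow> Ck n S f"
proof (induction n arbitrary: f)
  case 0
  then show ?case using Ck_continuous_on[OF 0] by simp
next
  case (Suc n)
  from Suc.prems obtain f' where
    "has_gradient f f' S" "\<forall>b\<in>Basis. Ck (Suc n) S (f' b)"
    by (subst (asm) Ck.simps) blast
  then show ?case using Suc.IH by (subst Ck.simps) blast
qed

lemma Ck_SucI:
  assumes "\<And>x. x \<in> S \<Longrightarrow> (f has_derivative (\<lambda>h. \<Sum>b\<in>Basis. (h \<bullet> b) *\<^sub>R f' b x)) (at x within S)"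
    and "\<And>b. b \<in> Basis \<Longrightarrow> Ck n S (f' b)"
  shows "Ck (Suc n) S f"
  using assms by (auto simp: Ck.simps(2) has_gradient_def)

lemma Ck_SucE:
  assumes "Ck (Suc n) S f"
  obtains f' where "has_gradient f f' S" "\<And>b. b \<in> Basis \<Longrightarrow> Ck n S (f' b)"
  using assms by (auto simp: Ck.simps(2))

lemma Ck_cong:
  assumes "\<And>x. x \<in> S \<Longrightarrow> f x = g x"
  shows "Ck n S f \<longleftrightarrow> Ck n S g"
proof (cases n)
  case 0
  then show ?thesis using assms by (simp cong: continuous_on_cong)
next
  case (Suc k)
  have "(f has_derivative D) (at x within S) \<longleftrightarrow> (g has_derivative D) (at x within S)" if "x \<in> S" for D x
    using assms that by (metis has_derivative_transform)
  then show ?thesis using Suc by (auto simp: Ck.simps(2) has_gradient_def)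
qed

lemma Ck_const: "Ck n S (\<lambda>_. c)"
proof (induction n arbitrary: c)
  case (Suc n)
  show ?case by (rule Ck_SucI[where f' = "\<lambda>_ _. 0"]) (use Suc in auto)
qed auto

lemma Ck_bounded_linear:
  assumes "bounded_linear f"
  shows "Ck n S f"
proof (cases n)
  case 0
  then show ?thesis using linear_continuous_on[OF assms] by simp
next
  case (Suc k)
  interpret bounded_linear f by fact
  have "f h = (\<Sum>b\<in>Basis. (h \<bullet> b) *\<^sub>R f b)" for h
    by (subst euclidean_representation[of h, symmetric]) (simp only: sum scaleR)
  then have e: "f = (\<lambda>h. \<Sum>b\<in>Basis. (h \<bullet> b) *\<^sub>R f b)" ..
  have "Ck (Suc k) S f"
    by (rule Ck_SucI[where f' = "\<lambda>b _. f b"])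
      (use bounded_linear_imp_has_derivative[OF assms] e in \<open>auto simp: Ck_const\<close>)
  then show ?thesis using Suc by simp
qed

lemma Ck_add:
  assumes "Ck n S f" "Ck n S g"
  shows "Ck n S (\<lambda>x. f x + g x)"
  using assms
proof (induction n arbitrary: f g)
  case 0
  then show ?case by (auto intro: continuous_intros)
next
  case (Suc n)
  obtain f' where f': "has_gradient f f' (S)" "\<And>b. b \<in> Basis \<Longrightarrow> Ck n S (f' b)"
    using Ck_SucE[OF Suc.prems(1)] by blast
  obtain g' where g': "has_gradient g g' (S)" "\<And>b. b \<in> Basis \<Longrightarrow> Ck n S (g' b)"
    using Ck_SucE[OF Suc.prems(2)] by blast
  show ?case
  proof (rule Ck_SucI)
    fix x assume "x \<in> S"
    then show "((\<lambda>x. f x + g x) has_derivative (\<lambda>h. \<Sum>b\<in>Basis. (h \<bullet> b) *\<^sub>R (\<lambda>b x. f' b x + g' b x) b x)) (at x within S)"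
      using has_derivative_add[OF has_gradientD[OF f'(1)] has_gradientD[OF g'(1)]] by (simp add: scaleR_add_right sum.distrib)
  qed (use Suc.IH f' g' in auto)
qed

lemma Ck_sum:
  assumes "\<And>i. i \<in> F \<Longrightarrow> Ck n S (f i)"
  shows "Ck n S (\<lambda>x. \<Sum>i\<in>F. f i x)"
  using assms by (induction F rule: infinite_finite_induct) (auto simp: Ck_const intro: Ck_add)

text \<open>Induction works because both terms of the product rule are again products of functions
  one class lower. The product is arbitrary so that scaling, complex multiplication and matrix
  multiplication are all covered.\<close>

lemma Ck_bilinear:
  fixes f :: "'d::euclidean_space \<Rightarrow> 'a::real_normed_vector" and g :: "'d \<Rightarrow> 'b::real_normed_vector"
    and pr :: "'a \<Rightarrow> 'b \<Rightarrow> 'c::real_normed_vector"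
  assumes "bounded_bilinear pr" "Ck n S f" "Ck n S g"
  shows "Ck n S (\<lambda>x. pr (f x) (g x))"
  using assms(2,3)
proof (induction n arbitrary: f g)
  case 0
  then show ?case using bounded_bilinear.continuous_on[OF assms(1)] by auto
next
  case (Suc n)
  interpret bounded_bilinear pr by fact
  obtain f' where f': "has_gradient f f' (S)" "\<And>b. b \<in> Basis \<Longrightarrow> Ck n S (f' b)"
    using Ck_SucE[OF Suc.prems(1)] by blast
  obtain g' where g': "has_gradient g g' (S)" "\<And>b. b \<in> Basis \<Longrightarrow> Ck n S (g' b)"
    using Ck_SucE[OF Suc.prems(2)] by blast
  show ?case
  proof (rule Ck_SucI)
    fix x assume "x \<in> S"
    then show "((\<lambda>x. pr (f x) (g x)) has_derivative (\<lambda>h. \<Sum>b\<in>Basis. (h \<bullet> b) *\<^sub>R (\<lambda>b x. pr (f x) (g' b x) + pr (f' b x) (g x)) b x)) (at x within S)"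
      using FDERIV[OF has_gradientD[OF f'(1)] has_gradientD[OF g'(1)]] by (simp add: scaleR_add_right sum.distrib sum_left sum_right scaleR_left scaleR_right)
  next
    fix b :: 'd assume b: "b \<in> Basis"
    show "Ck n S ((\<lambda>b x. pr (f x) (g' b x) + pr (f' b x) (g x)) b)"
      by (intro Ck_add Suc.IH) (use b f' g' Suc.prems Ck_Suc in auto)
  qed
qed

lemma Ck_compose_linear:
  assumes "bounded_linear L" "Ck n S f"
  shows "Ck n S (\<lambda>x. L (f x))"
  using assms(2)
proof (induction n arbitrary: f)
  case 0
  then show ?case using bounded_linear.continuous_on[OF assms(1)] by auto
next
  case (Suc n)
  interpret bounded_linear L by fact
  obtain f' where f': "has_gradient f f' (S)" "\<And>b. b \<in> Basis \<Longrightarrow> Ck n S (f' b)"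
    using Ck_SucE[OF Suc.prems(1)] by blast
  show ?case
    by (rule Ck_SucI[where f' = "\<lambda>b x. L (f' b x)"])
      (use has_derivative[OF has_gradientD[OF f'(1)]] f'(2) Suc.IH in \<open>auto simp: sum scaleR\<close>)
qed

lemma Ck_compose:
  fixes f :: "'a::euclidean_space \<Rightarrow> 'c::real_normed_vector" and g :: "'b::euclidean_space \<Rightarrow> 'a"
  assumes "Ck n T f" "Ck n S g" "g ` S \<subseteq> T"
  shows "Ck n S (\<lambda>x. f (g x))"
  using assms(1,2)
proof (induction n arbitrary: f)
  case 0
  then show ?case using continuous_on_compose2[of T f S g] assms(3) by auto
next
  case (Suc n)
  obtain f' where f': "has_gradient f f' (T)" "\<And>b. b \<in> Basis \<Longrightarrow> Ck n T (f' b)"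
    using Ck_SucE[OF Suc.prems(1)] by blast
  obtain g' where g': "has_gradient g g' (S)" "\<And>b. b \<in> Basis \<Longrightarrow> Ck n S (g' b)"
    using Ck_SucE[OF Suc.prems(2)] by blast
  show ?case
  proof (rule Ck_SucI)
    fix x assume x: "x \<in> S"
    then have "(f has_derivative (\<lambda>h. \<Sum>b\<in>Basis. (h \<bullet> b) *\<^sub>R f' b (g x))) (at (g x) within g ` S)"
      using assms(3) by (intro has_derivative_subset[OF has_gradientD[OF f'(1)]]) auto
    from diff_chain_within[OF has_gradientD[OF g'(1) x] this]
    have "((\<lambda>x. f (g x)) has_derivative (\<lambda>h. \<Sum>c\<in>Basis. ((\<Sum>b\<in>Basis. (h \<bullet> b) *\<^sub>R g' b x) \<bullet> c) *\<^sub>R f' c (g x))) (at x within S)"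
      by (simp add: o_def)
    moreover have "(\<Sum>c\<in>Basis. ((\<Sum>b\<in>Basis. (h \<bullet> b) *\<^sub>R g' b x) \<bullet> c) *\<^sub>R f' c (g x))
       = (\<Sum>b\<in>Basis. (h \<bullet> b) *\<^sub>R (\<Sum>c\<in>Basis. (g' b x \<bullet> c) *\<^sub>R f' c (g x)))" for h
      by (simp add: inner_sum_left scaleR_sum_left scaleR_sum_right) (rule sum.swap)
    ultimately show "((\<lambda>x. f (g x)) has_derivative (\<lambda>h. \<Sum>b\<in>Basis. (h \<bullet> b) *\<^sub>R
        (\<lambda>b x. \<Sum>c\<in>Basis. (g' b x \<bullet> c) *\<^sub>R f' c (g x)) b x)) (at x within S)"
      by simp
  next
    fix b :: 'b assume b: "b \<in> Basis"
    show "Ck n S ((\<lambda>b x. \<Sum>c\<in>Basis. (g' b x \<bullet> c) *\<^sub>R f' c (g x)) b)"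
      by (intro Ck_sum Ck_bilinear[OF bounded_bilinear_scaleR]
          Ck_compose_linear[OF bounded_linear_inner_left] Suc.IH)
        (use b f' g' Suc.prems Ck_Suc in auto)
  qed
qed

lemma sum_Basis_prod:
  "(\<Sum>b\<in>(Basis::('a::euclidean_space \<times> 'b::euclidean_space) set). f b)
     = (\<Sum>b\<in>Basis. f (b, 0)) + (\<Sum>b\<in>Basis. f (0, b))"
proof -
  have "sum f (Basis::('a \<times> 'b) set) = sum f ((\<lambda>u. (u, 0)) ` Basis) + sum f ((\<lambda>v. (0, v)) ` Basis)"
    unfolding Basis_prod_def by (rule sum.union_disjoint) auto
  then show ?thesis by (simp add: sum.reindex inj_on_def)
qed

lemma Ck_integral:
  fixes f :: "'a::euclidean_space \<times> real \<Rightarrow> 'b::banach"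
  assumes "convex S" "Ck n (S \<times> {a..b}) f"
  shows "Ck n S (\<lambda>x. integral {a..b} (\<lambda>u. f (x, u)))"
  using assms(2)
proof (induction n arbitrary: f)
  case 0
  then have "continuous_on (S \<times> cbox a b) (\<lambda>(x, t). f (x, t))" by simp
  from integral_continuous_on_param[OF this] show ?case by simp
next
  case (Suc n)
  obtain f' where f': "has_gradient f f' (S \<times> {a..b})" "\<And>c. c \<in> Basis \<Longrightarrow> Ck n (S \<times> {a..b}) (f' c)"
    using Ck_SucE[OF Suc.prems(1)] by blast
  have cf: "continuous_on (S \<times> {a..b}) f" using Ck_continuous_on[OF Suc.prems] .
  have B: "(c, 0) \<in> (Basis :: ('a \<times> real) set)" if "c \<in> Basis" for c
    using that by (simp add: Basis_prod_def)
  \<comment> \<open>\<open>leibniz_rule\<close> wants the derivative in \<open>x\<close> as a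
    bounded linear function, so the partial derivatives in the directions \<open>(c, 0)\<close> are
    packed into one.\<close>
  define fx where "fx x u = (\<Sum>c\<in>Basis. blinfun_scaleR_left (f' (c, 0) (x, u)) o\<^sub>L blinfun_inner_left c)" for x u
  have fx: "blinfun_apply (fx x u) h = (\<Sum>c\<in>Basis. (h \<bullet> c) *\<^sub>R f' (c, 0) (x, u))" for x u h
    by (simp add: fx_def blinfun.sum_left)
  show ?case
  proof (rule Ck_SucI)
    fix x assume x: "x \<in> S"
    have "((\<lambda>x. integral (cbox a b) (\<lambda>u. f (x, u))) has_derivative integral (cbox a b) (fx x)) (at x within S)"
    proof (rule leibniz_rule[where f = "\<lambda>x u. f (x, u)"])
      fix y u assume y: "y \<in> S" "u \<in> cbox a b"
      have "((\<lambda>y. (y, u)) has_derivative (\<lambda>h. (h, 0))) (at y within S)"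
        by (auto intro!: derivative_eq_intros)
      moreover have "(f has_derivative (\<lambda>h. \<Sum>c\<in>Basis. (h \<bullet> c) *\<^sub>R f' c (y, u))) (at (y, u) within (\<lambda>y. (y, u)) ` S)"
        by (rule has_derivative_subset[OF has_gradientD[OF f'(1)]]) (use y in auto)
      ultimately have "((\<lambda>y. f (y, u)) has_derivative (\<lambda>h. \<Sum>c\<in>Basis. ((h, 0) \<bullet> c) *\<^sub>R f' c (y, u))) (at y within S)"
        by (rule diff_chain_within[unfolded o_def])
      moreover have "(\<lambda>h. \<Sum>c\<in>Basis. ((h, 0) \<bullet> c) *\<^sub>R f' c (y, u)) = blinfun_apply (fx y u)"
        by (simp add: fun_eq_iff fx sum_Basis_prod)
      ultimately show "((\<lambda>y. f (y, u)) has_derivative blinfun_apply (fx y u)) (at y within S)" by simp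
    next
      fix y assume "y \<in> S"
      then show "(\<lambda>u. f (y, u)) integrable_on cbox a b"
        by (intro integrable_continuous continuous_on_compose2[OF cf]) (auto intro: continuous_on_Pair continuous_on_const continuous_on_id)
    next
      have "continuous_on (S \<times> {a..b}) (\<lambda>p. f' (c, 0) p)" if "c \<in> Basis" for c
        using Ck_continuous_on[OF f'(2)[OF B[OF that]]] .
      then show "continuous_on (S \<times> cbox a b) (\<lambda>(x, t). fx x t)"
        unfolding fx_def split_beta prod.collapse box_real by (intro continuous_intros)
    qed (use x assms in auto)
    moreover have e: "blinfun_apply (integral {a..b} (fx x)) h = (\<Sum>c\<in>Basis. (h \<bullet> c) *\<^sub>R integral {a..b} (\<lambda>u. f' (c, 0) (x, u)))" for h
    proof -
      have c: "continuous_on {a..b} (\<lambda>u. f' (c, 0) (x, u))" if "c \<in> Basis" for c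
        by (rule continuous_on_compose2[OF Ck_continuous_on[OF f'(2)[OF B[OF that]]]])
          (use x in \<open>auto intro: continuous_on_Pair continuous_on_const continuous_on_id\<close>)
      have "fx x integrable_on {a..b}"
        unfolding fx_def[abs_def] by (intro integrable_continuous_interval continuous_intros c)
      then have "blinfun_apply (integral {a..b} (fx x)) h = integral {a..b} (\<lambda>u. blinfun_apply (fx x u) h)"
        by (rule blinfun_apply_integral)
      also have "\<dots> = (\<Sum>c\<in>Basis. integral {a..b} (\<lambda>u. (h \<bullet> c) *\<^sub>R f' (c, 0) (x, u)))"
        unfolding fx by (intro integral_sum integrable_continuous_interval continuous_intros c) auto
      finally show ?thesis by simp
    qed
    ultimately show "((\<lambda>x. integral {a..b} (\<lambda>u. f (x, u))) has_derivative (\<lambda>h. \<Sum>c\<in>Basis. (h \<bullet> c) *\<^sub>R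
        (\<lambda>c x. integral {a..b} (\<lambda>u. f' (c, 0) (x, u))) c x)) (at x within S)"
      by (simp only: e[abs_def] box_real)
  qed (use Suc.IH f'(2) B in auto)
qed

lemma Ck_inverse:
  fixes f :: "'a::euclidean_space \<Rightarrow> complex"
  assumes "Ck n S f" "\<And>x. x \<in> S \<Longrightarrow> f x \<noteq> 0"
  shows "Ck n S (\<lambda>x. inverse (f x))"
  using assms(1)
proof (induction n)
  case 0
  then show ?case using assms(2) by (auto intro!: continuous_intros)
next
  case (Suc n)
  obtain f' where f': "has_gradient f f' (S)" "\<And>b. b \<in> Basis \<Longrightarrow> Ck n S (f' b)"
    using Ck_SucE[OF Suc.prems(1)] by blast
  have i: "Ck n S (\<lambda>x. inverse (f x))" using Suc Ck_Suc by blast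
  show ?case
  proof (rule Ck_SucI)
    fix x assume x: "x \<in> S"
    show "((\<lambda>x. inverse (f x)) has_derivative (\<lambda>h. \<Sum>b\<in>Basis. (h \<bullet> b) *\<^sub>R
        (\<lambda>b x. - (inverse (f x) * f' b x * inverse (f x))) b x)) (at x within S)"
      using Deriv.has_derivative_inverse[OF assms(2)[OF x] has_gradientD[OF f'(1) x]]
      by (simp add: sum_distrib_left sum_distrib_right sum_negf)
  next
    fix b :: 'a assume b: "b \<in> Basis"
    show "Ck n S ((\<lambda>b x. - (inverse (f x) * f' b x * inverse (f x))) b)"
      by (intro Ck_compose_linear[OF bounded_linear_minus[OF bounded_linear_ident]]
        Ck_bilinear[OF bounded_bilinear_mult] i f'(2) b)
  qed
qed

lemma Ck_fst: "Ck n S fst" and Ck_snd: "Ck n S snd" and Ck_id: "Ck n T (\<lambda>x. x)"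
  by (auto intro: Ck_bounded_linear bounded_linear_fst bounded_linear_snd bounded_linear_ident)

lemma Ck_diff:
  "Ck n S f \<Longrightarrow> Ck n S g \<Longrightarrow> Ck n S (\<lambda>x. f x - g x)"
  using Ck_add[of n S f "\<lambda>x. - g x"] Ck_compose_linear[OF bounded_linear_minus[OF bounded_linear_ident], of n S g]
  by simp

lemma Ck_Pair:
  assumes "Ck n S f" "Ck n S g"
  shows "Ck n S (\<lambda>x. (f x, g x))"
proof -
  have "Ck n S (\<lambda>x. (f x, 0) + (0, g x))"
    by (intro Ck_add Ck_compose_linear[OF _ assms(1)] Ck_compose_linear[OF _ assms(2)]
        bounded_linear_Pair bounded_linear_ident bounded_linear_zero)
  then show ?thesis by simp
qed

section \<open>Functions of one and of two real variables\<close>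

lemma Ck_real_SucI:
  fixes f :: "real \<Rightarrow> 'b::real_normed_vector"
  assumes "\<And>x. x \<in> S \<Longrightarrow> (f has_vector_derivative f' x) (at x within S)" "Ck n S f'"
  shows "Ck (Suc n) S f"
  by (rule Ck_SucI[where f' = "\<lambda>_. f'"]) (use assms in \<open>simp_all add: has_vector_derivative_def\<close>)

lemma Ck_real_SucE:
  fixes f :: "real \<Rightarrow> 'b::real_normed_vector"
  assumes "Ck (Suc n) S f"
  obtains f' where "\<forall>x\<in>S. (f has_vector_derivative f' x) (at x within S)" "Ck n S f'"
proof -
  obtain f' where f': "has_gradient f f' S" "\<And>b. b \<in> Basis \<Longrightarrow> Ck n S (f' b)"
    using Ck_SucE[OF assms] by blast
  show ?thesis
    by (rule that[of "f' 1"]) (use f' in \<open>simp_all add: has_gradient_def has_vector_derivative_def\<close>)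
qed

text \<open>Two partial derivatives combine to a total derivative because the one in
  \<open>y\<close> is continuous; the mean value argument for this runs along \<open>T\<close>,
  hence the convexity.\<close>

lemma Ck_prod_SucI:
  fixes f :: "real \<Rightarrow> real \<Rightarrow> 'b::real_normed_vector"
  assumes fx: "\<And>x y. x \<in> S \<Longrightarrow> y \<in> T \<Longrightarrow> ((\<lambda>s. f s y) has_vector_derivative fx x y) (at x within S)"
    and fy: "\<And>x y. x \<in> S \<Longrightarrow> y \<in> T \<Longrightarrow> (f x has_vector_derivative fy x y) (at y within T)"
    and "Ck n (S \<times> T) (\<lambda>(x, y). fx x y)" "Ck n (S \<times> T) (\<lambda>(x, y). fy x y)" and "convex T"
  shows "Ck (Suc n) (S \<times> T) (\<lambda>(x, y). f x y)"
proof (rule Ck_SucI)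
  fix p assume p: "p \<in> S \<times> T"
  obtain x y where xy: "p = (x, y)" "x \<in> S" "y \<in> T" using p by auto
  have "((\<lambda>(x, y). f x y) has_derivative (\<lambda>(tx, ty). tx *\<^sub>R fx x y + blinfun_apply (blinfun_scaleR_left (fy x y)) ty))
      (at (x, y) within S \<times> T)"
  proof (rule has_derivative_partialsI)
    show "((\<lambda>x. f x y) has_derivative (\<lambda>tx. tx *\<^sub>R fx x y)) (at x within S)"
      using fx xy by (simp add: has_vector_derivative_def)
    show "(f x has_derivative blinfun_apply (blinfun_scaleR_left (fy x y))) (at y within T)"
      if "x \<in> S" "y \<in> T" for x y
      using fy[OF that] by (simp add: has_vector_derivative_def)
    have "continuous_on (S \<times> T) (\<lambda>p. blinfun_scaleR_left ((\<lambda>(x, y). fy x y) p))"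
      by (intro bounded_linear.continuous_on[OF bounded_linear_blinfun_scaleR_left] Ck_continuous_on[OF assms(4)])
    then have "continuous_on (S \<times> T) (\<lambda>(x, y). blinfun_scaleR_left (fy x y))"
      by (simp add: split_beta)
    then show "continuous (at (x, y) within S \<times> T) (\<lambda>(x, y). blinfun_scaleR_left (fy x y))"
      using xy unfolding continuous_on_eq_continuous_within by blast
  qed (use xy assms in auto)
  then show "((\<lambda>(x, y). f x y) has_derivative (\<lambda>h. \<Sum>b\<in>Basis. (h \<bullet> b) *\<^sub>R
      (\<lambda>b p. fst b *\<^sub>R (\<lambda>(x, y). fx x y) p + snd b *\<^sub>R (\<lambda>(x, y). fy x y) p) b p)) (at p within S \<times> T)"
    by (simp add: xy sum_Basis_prod split_beta' inner_prod_def)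
next
  fix b :: "real \<times> real"
  show "Ck n (S \<times> T) ((\<lambda>b p. fst b *\<^sub>R (\<lambda>(x, y). fx x y) p + snd b *\<^sub>R (\<lambda>(x, y). fy x y) p) b)"
    by (intro Ck_add Ck_compose_linear[OF bounded_linear_scaleR_right] assms)
qed

lemma Ck_prod_SucE:
  fixes f :: "real \<Rightarrow> real \<Rightarrow> 'b::real_normed_vector"
  assumes "Ck (Suc n) (S \<times> T) (\<lambda>(x, y). f x y)"
  obtains fx fy where
    "\<forall>x\<in>S. \<forall>y\<in>T. ((\<lambda>s. f s y) has_vector_derivative fx x y) (at x within S)"
    "\<forall>x\<in>S. \<forall>y\<in>T. (f x has_vector_derivative fy x y) (at y within T)"
    "Ck n (S \<times> T) (\<lambda>(x, y). fx x y)" "Ck n (S \<times> T) (\<lambda>(x, y). fy x y)"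
proof -
  obtain f' where f': "has_gradient (\<lambda>(x, y). f x y) f' (S \<times> T)" "\<And>b. b \<in> Basis \<Longrightarrow> Ck n (S \<times> T) (f' b)"
    using Ck_SucE[OF assms] by blast
  have D: "((\<lambda>(x, y). f x y) has_derivative (\<lambda>h. fst h *\<^sub>R f' (1, 0) (x, y) + snd h *\<^sub>R f' (0, 1) (x, y))) (at (x, y) within S \<times> T)"
    if "x \<in> S" "y \<in> T" for x y
    using has_gradientD[OF f'(1), of "(x, y)"] that by (simp add: sum_Basis_prod inner_prod_def)
  have B: "(1, 0) \<in> (Basis :: (real \<times> real) set)" "(0, 1) \<in> (Basis :: (real \<times> real) set)"
    by (auto simp: Basis_prod_def)
  show ?thesis
  proof (rule that[of "\<lambda>x y. f' (1, 0) (x, y)" "\<lambda>x y. f' (0, 1) (x, y)"])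
    show "\<forall>x\<in>S. \<forall>y\<in>T. ((\<lambda>s. f s y) has_vector_derivative f' (1, 0) (x, y)) (at x within S)"
    proof (intro ballI)
      fix x y assume xy: "x \<in> S" "y \<in> T"
      have 1: "((\<lambda>s. (s, y)) has_derivative (\<lambda>h. (h, 0))) (at x within S)"
        by (auto intro!: derivative_eq_intros)
      have 2: "((\<lambda>(x, y). f x y) has_derivative (\<lambda>h. fst h *\<^sub>R f' (1, 0) (x, y) + snd h *\<^sub>R f' (0, 1) (x, y))) (at (x, y) within (\<lambda>s. (s, y)) ` S)"
        by (rule has_derivative_subset[OF D]) (use xy in auto)
      from diff_chain_within[OF 1 2] show "((\<lambda>s. f s y) has_vector_derivative f' (1, 0) (x, y)) (at x within S)"
        by (simp add: has_vector_derivative_def o_def)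
    qed
    show "\<forall>x\<in>S. \<forall>y\<in>T. (f x has_vector_derivative f' (0, 1) (x, y)) (at y within T)"
    proof (intro ballI)
      fix x y assume xy: "x \<in> S" "y \<in> T"
      have 1: "((\<lambda>s. (x, s)) has_derivative (\<lambda>h. (0, h))) (at y within T)"
        by (auto intro!: derivative_eq_intros)
      have 2: "((\<lambda>(x, y). f x y) has_derivative (\<lambda>h. fst h *\<^sub>R f' (1, 0) (x, y) + snd h *\<^sub>R f' (0, 1) (x, y))) (at (x, y) within (\<lambda>s. (x, s)) ` T)"
        by (rule has_derivative_subset[OF D]) (use xy in auto)
      from diff_chain_within[OF 1 2] show "(f x has_vector_derivative f' (0, 1) (x, y)) (at y within T)"
        by (simp add: has_vector_derivative_def o_def)
    qed
  qed (use f'(2) B in simp_all)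
qed

section \<open>Smooth functions and their closure properties\<close>

definition cinf :: "'a::euclidean_space set \<Rightarrow> ('a \<Rightarrow> 'b::real_normed_vector) \<Rightarrow> bool" where
  "cinf S f \<longleftrightarrow> (\<forall>n. Ck n S f)"

lemma cinf_cong: "(\<And>x. x \<in> S \<Longrightarrow> f x = g x) \<Longrightarrow> cinf S f \<longleftrightarrow> cinf S g"
  unfolding cinf_def using Ck_cong by blast

lemma cinf_continuous_on: "cinf S f \<Longrightarrow> continuous_on S f"
  unfolding cinf_def using Ck_continuous_on by blast

lemma
  cinf_const: "cinf S (\<lambda>_. c)" and
  cinf_add: "cinf S f \<Longrightarrow> cinf S g \<Longrightarrow> cinf S (\<lambda>x. f x + g x)" and
  cinf_sum: "(\<And>i. i \<in> F \<Longrightarrow> cinf S (h i)) \<Longrightarrow> cinf S (\<lambda>x. \<Sum>i\<in>F. h i x)"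
  unfolding cinf_def by (auto intro: Ck_const Ck_add Ck_sum)

lemma cinf_linear: "bounded_linear L \<Longrightarrow> cinf S f \<Longrightarrow> cinf S (\<lambda>x. L (f x))"
  unfolding cinf_def by (auto intro: Ck_compose_linear)

lemma cinf_bilinear:
  "bounded_bilinear pr \<Longrightarrow> cinf S f \<Longrightarrow> cinf S g \<Longrightarrow> cinf S (\<lambda>x. pr (f x) (g x))"
  unfolding cinf_def by (auto intro: Ck_bilinear)

lemmas cinf_mult = cinf_bilinear[OF bounded_bilinear_mult]

lemma cinf_minus: "cinf S f \<Longrightarrow> cinf S (\<lambda>x. - f x)"
  by (rule cinf_linear[OF bounded_linear_minus[OF bounded_linear_ident]])

lemma cinf_inverse:
  fixes f :: "'a::euclidean_space \<Rightarrow> complex"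
  shows "cinf S f \<Longrightarrow> (\<And>x. x \<in> S \<Longrightarrow> f x \<noteq> 0) \<Longrightarrow> cinf S (\<lambda>x. inverse (f x))"
  unfolding cinf_def by (auto intro: Ck_inverse)

lemma cinf_compose:
  fixes f :: "'a::euclidean_space \<Rightarrow> 'c::real_normed_vector" and g :: "'b::euclidean_space \<Rightarrow> 'a"
  shows "cinf T f \<Longrightarrow> cinf S g \<Longrightarrow> g ` S \<subseteq> T \<Longrightarrow> cinf S (\<lambda>x. f (g x))"
  unfolding cinf_def by (auto intro: Ck_compose)

lemma cinf_fst: "cinf S fst" and cinf_snd: "cinf S snd" and cinf_id: "cinf T (\<lambda>x. x)"
  unfolding cinf_def by (auto intro: Ck_fst Ck_snd Ck_id)

lemma cinf_Pair: "cinf S f \<Longrightarrow> cinf S g \<Longrightarrow> cinf S (\<lambda>x. (f x, g x))"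
  unfolding cinf_def by (auto intro: Ck_Pair)

lemma cinf_curry1: "cinf S f \<Longrightarrow> cinf (S \<times> T) (\<lambda>(x, y). f x)"
  and cinf_curry2: "cinf T f \<Longrightarrow> cinf (S \<times> T) (\<lambda>(x, y). f y)"
  unfolding split_beta by (auto intro: cinf_compose cinf_fst cinf_snd)

lemma cinf_diag: "cinf (S \<times> S) (\<lambda>(x, y). f x y) \<Longrightarrow> cinf S (\<lambda>x. f x x)"
  using cinf_compose[where T = "S \<times> S" and f = "\<lambda>(x, y). f x y" and S = S and g = "\<lambda>x. (x, x)"] cinf_Pair[OF cinf_id cinf_id, of S]
  by (simp add: image_subset_iff)

lemma cinf_section1: "cinf (S \<times> T) (\<lambda>(x, y). f x y) \<Longrightarrow> y \<in> T \<Longrightarrow> cinf S (\<lambda>x. f x y)"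
  using cinf_compose[where T = "S \<times> T" and f = "\<lambda>(x, y). f x y" and S = S and g = "\<lambda>x. (x, y)"] cinf_Pair[OF cinf_id cinf_const, of S y]
  by (simp add: image_subset_iff)

lemma cinf_section2: "cinf (S \<times> T) (\<lambda>(x, y). f x y) \<Longrightarrow> x \<in> S \<Longrightarrow> cinf T (f x)"
  using cinf_compose[where T = "S \<times> T" and f = "\<lambda>(x, y). f x y" and S = T and g = "\<lambda>y. (x, y)"] cinf_Pair[OF cinf_const cinf_id, of T x]
  by (simp add: image_subset_iff)

section \<open>Oriented integrals\<close>

text \<open>The scaled form covers both orientations and makes smooth dependence on the limits
  a special case of smooth dependence on parameters.\<close>

definition sint :: "real \<Rightarrow> real \<Rightarrow> (real \<Rightarrow> 'a::banach) \<Rightarrow> 'a" where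
  "sint a b f = (b - a) *\<^sub>R integral {0..1} (\<lambda>u. f (a + u * (b - a)))"

lemma segment_point:
  fixes a b u :: real
  assumes "is_interval I" "a \<in> I" "b \<in> I" "u \<in> {0..1}"
  shows "a + u * (b - a) \<in> I"
proof -
  have "(1 - u) *\<^sub>R a + u *\<^sub>R b \<in> I"
    using is_interval_convex[OF assms(1)] assms by (auto simp: convex_alt)
  then show ?thesis by (simp add: algebra_simps)
qed

locale nondegenerate_interval =
  fixes I :: "real set"
  assumes iv: "is_interval I" and int_ne: "interior I \<noteq> {}"
begin

abbreviation DI :: "(real \<Rightarrow> 'b::real_normed_vector) \<Rightarrow> real \<Rightarrow> 'b" where
  "DI f \<equiv> \<lambda>x. vector_derivative f (at x within I)"

abbreviation cinf2 :: "(real \<Rightarrow> real \<Rightarrow> 'b::real_normed_vector) \<Rightarrow> bool" where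
  "cinf2 f \<equiv> cinf (I \<times> I) (\<lambda>(x, y). f x y)"

lemma convex_I: "convex I"
  using iv by (rule is_interval_convex)

text \<open>Uniqueness of derivatives within \<open>I\<close> rests on this: a connected set with
  more than one point has no isolated points.\<close>

lemma at_within_I_nontrivial: "x \<in> I \<Longrightarrow> at x within I \<noteq> bot"
proof -
  assume x: "x \<in> I"
  obtain c where "c \<in> interior I" using int_ne by blast
  then obtain e where e: "e > 0" "ball c e \<subseteq> I" by (auto simp: mem_interior)
  then have "c \<in> I" "c + e / 2 \<in> I" by (auto simp: dist_real_def subset_iff)
  then have "\<not> (\<exists>a. I = {a})" using e by auto
  then show ?thesis
    using connected_imp_perfect[OF is_interval_connected[OF iv] x] trivial_limit_within[of x I] by metis
qed

lemma DI_eq: "x \<in> I \<Longrightarrow> (f has_vector_derivative D) (at x within I) \<Longrightarrow> DI f x = D"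
  using at_within_I_nontrivial by (intro vector_derivative_within)

text \<open>Results on compact intervals are transferred to \<open>I\<close> through this. The end
  points are taken strictly beyond \<open>x\<close> wherever \<open>I\<close> extends beyond
  \<open>x\<close>, so that \<open>{c..d}\<close> contains a neighbourhood of \<open>x\<close> in
  \<open>I\<close>.\<close>

lemma nbhd_in_I:
  assumes x: "x \<in> I" and a: "a \<in> I"
  obtains c d where "c \<in> I" "d \<in> I" "x \<in> {c..d}" "a \<in> {c..d}" "{c..d} \<subseteq> I" "at x within I = at x within {c..d}"
proof -
  define c where "c = (if \<exists>y\<in>I. y < x then min a (SOME y. y \<in> I \<and> y < x) else x)"
  define d where "d = (if \<exists>y\<in>I. y > x then max a (SOME y. y \<in> I \<and> y > x) else x)"
  have c: "c \<in> I" "c \<le> x" "c \<le> a" "c < x \<or> (\<forall>y\<in>I. x \<le> y)"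
  proof -
    have "c \<in> I \<and> c \<le> x \<and> c \<le> a \<and> (c < x \<or> (\<forall>y\<in>I. x \<le> y))"
    proof (cases "\<exists>y\<in>I. y < x")
      case True
      then have "(SOME y. y \<in> I \<and> y < x) \<in> I \<and> (SOME y. y \<in> I \<and> y < x) < x"
        by (intro someI_ex[of "\<lambda>y. y \<in> I \<and> y < x"]) auto
      with True x a show ?thesis unfolding c_def by (auto simp: min_def)
    qed (use x a in \<open>auto simp: c_def not_less\<close>)
    then show "c \<in> I" "c \<le> x" "c \<le> a" "c < x \<or> (\<forall>y\<in>I. x \<le> y)" by blast+
  qed
  have d: "d \<in> I" "x \<le> d" "a \<le> d" "x < d \<or> (\<forall>y\<in>I. y \<le> x)"
  proof -
    have "d \<in> I \<and> x \<le> d \<and> a \<le> d \<and> (x < d \<or> (\<forall>y\<in>I. y \<le> x))"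
    proof (cases "\<exists>y\<in>I. y > x")
      case True
      then have "(SOME y. y \<in> I \<and> y > x) \<in> I \<and> (SOME y. y \<in> I \<and> y > x) > x"
        by (intro someI_ex[of "\<lambda>y. y \<in> I \<and> y > x"]) auto
      with True x a show ?thesis unfolding d_def by (auto simp: max_def)
    qed (use x a in \<open>auto simp: d_def not_less\<close>)
    then show "d \<in> I" "x \<le> d" "a \<le> d" "x < d \<or> (\<forall>y\<in>I. y \<le> x)" by blast+
  qed
  have sub: "{c..d} \<subseteq> I"
    using iv c(1) d(1) unfolding is_interval_1 by (meson atLeastAtMost_iff subsetI)
  define S where "S = {(if c < x then c else x - 1) <..< (if x < d then d else x + 1)}"
  have "at x within I = at x within {c..d}"
  proof (rule at_within_nhd)
    show "x \<in> S" "open S" using c d by (auto simp: S_def)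
    have "c \<le> y" "y \<le> d" if "y \<in> I" "y \<in> S" for y
      using that c(2,4) d(2,4) unfolding S_def by (fastforce split: if_splits)+
    then show "I \<inter> S - {x} = {c..d} \<inter> S - {x}"
      using sub by auto
  qed
  then show ?thesis using that c d sub by auto
qed

text \<open>The interval \<open>J\<close> is free because the rule is applied both to
  \<open>I\<close> itself and to compact subintervals.\<close>

lemma sint_FTC_sub:
  assumes "is_interval J" "a \<in> J" "b \<in> J"
    and F: "\<And>x. x \<in> J \<Longrightarrow> (F has_vector_derivative f x) (at x within J)"
  shows "sint a b f = F b - F a"
proof -
  have "((\<lambda>u. (b - a) *\<^sub>R f (a + u * (b - a))) has_integral F (a + 1 * (b - a)) - F (a + 0 * (b - a))) {0..1}"
  proof (rule fundamental_theorem_of_calculus)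
    fix u :: real assume u: "u \<in> {0..1}"
    have 1: "((\<lambda>u. a + u * (b - a)) has_vector_derivative (b - a)) (at u within {0..1})"
      by (auto intro!: derivative_eq_intros)
    have "(F has_vector_derivative f (a + u * (b - a))) (at (a + u * (b - a)) within (\<lambda>u. a + u * (b - a)) ` {0..1})"
      using segment_point[OF assms(1-3)] u by (intro has_vector_derivative_within_subset[OF F]) blast+
    from vector_diff_chain_within[OF 1 this]
    show "((\<lambda>u. F (a + u * (b - a))) has_vector_derivative (b - a) *\<^sub>R f (a + u * (b - a))) (at u within {0..1})"
      by (simp add: o_def)
  qed simp
  then have "integral {0..1} (\<lambda>u. (b - a) *\<^sub>R f (a + u * (b - a))) = F b - F a"
    by (subst integral_unique) simp_all
  then show ?thesis by (simp only: sint_def integral_cmul)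
qed

lemmas sint_FTC = sint_FTC_sub[OF iv]

lemma sint_has_vector_derivative:
  fixes f :: "real \<Rightarrow> 'a::banach"
  assumes f: "continuous_on I f" and a: "a \<in> I" and x: "x \<in> I"
  shows "((\<lambda>x. sint a x f) has_vector_derivative f x) (at x within I)"
proof -
  obtain c d where cd: "c \<in> I" "d \<in> I" "x \<in> {c..d}" "a \<in> {c..d}" "{c..d} \<subseteq> I" "at x within I = at x within {c..d}"
    using nbhd_in_I[OF x a] by blast
  obtain G where G: "\<And>x. x \<in> {c..d} \<Longrightarrow> (G has_vector_derivative f x) (at x within {c..d})"
    using antiderivative_continuous[OF continuous_on_subset[OF f cd(5)]] by blast
  have e: "sint a y f = G y - G a" if "y \<in> {c..d}" for y
    using that cd G by (intro sint_FTC_sub[of "{c..d}"]) (auto simp: is_interval_cc)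
  have "((\<lambda>y. G y - G a) has_vector_derivative f x) (at x within {c..d})"
    using has_vector_derivative_diff[OF G[OF cd(3)] has_vector_derivative_const[of "G a"]] by simp
  then have "((\<lambda>y. sint a y f) has_vector_derivative f x) (at x within {c..d})"
    by (rule has_vector_derivative_transform[rotated 2]) (use e cd(3) in auto)
  then show ?thesis using cd by simp
qed

lemma sint_eq_integral:
  fixes f :: "real \<Rightarrow> 'a::banach"
  assumes f: "continuous_on I f" and "a \<in> I" "b \<in> I" "a \<le> b"
  shows "sint a b f = integral {a..b} f"
proof -
  have sub: "{a..b} \<subseteq> I"
    using iv assms(2,3) unfolding is_interval_1 by (meson atLeastAtMost_iff subsetI)
  have "(f has_integral sint a b f - sint a a f) {a..b}"
    by (rule fundamental_theorem_of_calculus[OF assms(4)])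
      (use has_vector_derivative_within_subset[OF sint_has_vector_derivative[OF f assms(2)] sub] sub in blast)
  then show ?thesis by (simp add: integral_unique sint_def)
qed

lemma sint_cong:
  assumes "a \<in> I" "b \<in> I" "\<And>x. x \<in> I \<Longrightarrow> f x = g x"
  shows "sint a b f = sint a b g"
  unfolding sint_def
  by (intro arg_cong[where f = "(*\<^sub>R) (b - a)"] integral_cong assms(3) segment_point[OF iv assms(1,2)])

lemma sint_self [simp]: "sint a a f = 0"
  by (simp add: sint_def)

lemma sint_integrable:
  fixes f :: "real \<Rightarrow> 'a::banach"
  assumes f: "continuous_on I f" and "a \<in> I" "b \<in> I"
  shows "(\<lambda>u. f (a + u * (b - a))) integrable_on {0..1}"
  using segment_point[OF iv assms(2,3)]
  by (intro integrable_continuous_interval continuous_on_compose2[OF f] continuous_intros) auto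

lemma sint_add:
  fixes f :: "real \<Rightarrow> 'a::banach"
  assumes "continuous_on I f" "continuous_on I g" "a \<in> I" "b \<in> I"
  shows "sint a b (\<lambda>x. f x + g x) = sint a b f + sint a b g"
  unfolding sint_def using assms by (simp add: integral_add sint_integrable scaleR_add_right)

lemma sint_linear:
  fixes f :: "real \<Rightarrow> 'a::banach" and L :: "'a \<Rightarrow> 'b::banach"
  assumes L: "bounded_linear L" and f: "continuous_on I f" and "a \<in> I" "b \<in> I"
  shows "sint a b (\<lambda>x. L (f x)) = L (sint a b f)"
  unfolding sint_def using integral_linear[OF sint_integrable[OF f assms(3,4)] L]
  by (simp add: o_def linear_cmul[OF bounded_linear.linear[OF L]])

lemma sint_diff:
  fixes f :: "real \<Rightarrow> 'a::banach"
  assumes "continuous_on I f" "continuous_on I g" "a \<in> I" "b \<in> I"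
  shows "sint a b (\<lambda>x. f x - g x) = sint a b f - sint a b g"
  unfolding sint_def using assms by (simp add: integral_diff sint_integrable scaleR_diff_right)

lemma sint_combine:
  fixes f :: "real \<Rightarrow> 'a::banach"
  assumes "continuous_on I f" "a \<in> I" "b \<in> I" "c \<in> I"
  shows "sint a b f + sint b c f = sint a c f"
  using sint_FTC[OF assms(2,3) sint_has_vector_derivative[OF assms(1,2)]]
    sint_FTC[OF assms(3,4) sint_has_vector_derivative[OF assms(1,2)]] by simp

lemma Ck_sint:
  fixes q :: "'p::euclidean_space \<Rightarrow> real \<Rightarrow> 'a::banach"
  assumes S: "convex S" and q: "Ck n (S \<times> I) (\<lambda>(p, t). q p t)" and g: "Ck n S g" and h: "Ck n S h"
    and gh: "g ` S \<subseteq> I" "h ` S \<subseteq> I"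
  shows "Ck n S (\<lambda>p. sint (g p) (h p) (q p))"
proof -
  have g2: "Ck n (S \<times> {0..1::real}) (\<lambda>z. g (fst z))" and h2: "Ck n (S \<times> {0..1::real}) (\<lambda>z. h (fst z))"
    by (auto intro!: Ck_compose[OF g] Ck_compose[OF h] Ck_fst)
  have "Ck n (S \<times> {0..1}) (\<lambda>z. (\<lambda>(p, t). q p t) (fst z, g (fst z) + snd z *\<^sub>R (h (fst z) - g (fst z))))"
  proof (rule Ck_compose[OF q])
    show "Ck n (S \<times> {0..1::real}) (\<lambda>z. (fst z, g (fst z) + snd z *\<^sub>R (h (fst z) - g (fst z))))"
      by (intro Ck_Pair Ck_add Ck_diff Ck_fst Ck_snd g2 h2 Ck_bilinear[OF bounded_bilinear_scaleR])
    show "(\<lambda>z. (fst z, g (fst z) + snd z *\<^sub>R (h (fst z) - g (fst z)))) ` (S \<times> {0..1}) \<subseteq> S \<times> I"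
      using gh segment_point[OF iv] by (auto simp: image_subset_iff simp del: atLeastAtMost_iff)
  qed
  then have "Ck n S (\<lambda>p. integral {0..1} (\<lambda>u. q p (g p + u * (h p - g p))))"
    using Ck_integral[OF S, of n 0 1 "\<lambda>z. q (fst z) (g (fst z) + snd z * (h (fst z) - g (fst z)))"] by simp
  then show ?thesis
    unfolding sint_def by (intro Ck_bilinear[OF bounded_bilinear_scaleR] Ck_diff g h)
qed

text \<open>The integral is the restriction to the diagonal of a function of two variables, the
  parameter \<open>x\<close> and the upper limit \<open>z\<close>, which has both partial
  derivatives. In \<open>t\<close> only continuity is asked for, so \<open>vstar_D1\<close> can
  multiply by a kernel that is merely known to be continuous.\<close>

lemma leibniz_sint:
  fixes p :: "real \<Rightarrow> real \<Rightarrow> 'a::banach"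
  assumes p: "continuous_on (I \<times> I) (\<lambda>(x, t). p x t)" and px: "continuous_on (I \<times> I) (\<lambda>(x, t). px x t)"
    and d: "\<And>x t. x \<in> I \<Longrightarrow> t \<in> I \<Longrightarrow> ((\<lambda>x. p x t) has_vector_derivative px x t) (at x within I)"
    and y: "y \<in> I" and x: "x \<in> I"
  shows "((\<lambda>x. sint y x (p x)) has_vector_derivative p x x + sint y x (px x)) (at x within I)"
proof -
  have sec: "continuous_on I (p z)" if "z \<in> I" for z
    using continuous_on_compose2[OF p, of I "\<lambda>t. (z, t)", OF continuous_on_Pair[OF continuous_on_const continuous_on_id]] that
    by (auto simp: image_subset_iff)
  have "((\<lambda>(x, z). sint y z (p x)) has_derivative (\<lambda>(tx, tz). tx *\<^sub>R sint y x (px x) + blinfun_apply (blinfun_scaleR_left (p x x)) tz))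
      (at (x, x) within I \<times> I)"
  proof (rule has_derivative_partialsI[where f = "\<lambda>x z. sint y z (p x)" and fy = "\<lambda>s z. blinfun_scaleR_left (p s z)"])
    have seg: "y + u * (x - y) \<in> I" if "u \<in> {0..1}" for u
      using segment_point[OF iv y x] that by blast
    have "((\<lambda>z. integral (cbox 0 1) (\<lambda>u. p z (y + u * (x - y)))) has_vector_derivative
        integral (cbox 0 1) (\<lambda>u. px x (y + u * (x - y)))) (at x within I)"
    proof (rule leibniz_rule_vector_derivative[where f = "\<lambda>z u. p z (y + u * (x - y))" and fx = "\<lambda>z u. px z (y + u * (x - y))"])
      show "((\<lambda>z. p z (y + u * (x - y))) has_vector_derivative px z (y + u * (x - y))) (at z within I)"
        if "z \<in> I" "u \<in> cbox 0 1" for z u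
        using d seg that by simp
      show "(\<lambda>u. p z (y + u * (x - y))) integrable_on cbox 0 1" if "z \<in> I" for z
        using sint_integrable[OF sec[OF that] y x] by simp
      show "continuous_on (I \<times> cbox 0 1) (\<lambda>(z, u). px z (y + u * (x - y)))"
        using continuous_on_compose2[OF px, of "I \<times> cbox 0 1" "\<lambda>q. (fst q, y + snd q * (x - y))"] seg
        by (simp add: split_beta image_subset_iff continuous_on_Pair continuous_on_fst continuous_on_snd
            continuous_on_add continuous_on_mult continuous_on_id continuous_on_const)
    qed (use x convex_I in auto)
    then have "((\<lambda>z. sint y x (p z)) has_vector_derivative sint y x (px x)) (at x within I)"
      unfolding sint_def by (auto intro: bounded_linear.has_vector_derivative[OF bounded_linear_scaleR_right])
    then show "((\<lambda>z. sint y x (p z)) has_derivative (\<lambda>tx. tx *\<^sub>R sint y x (px x))) (at x within I)"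
      by (simp add: has_vector_derivative_def)
    show "((\<lambda>z. sint y z (p s)) has_derivative blinfun_apply (blinfun_scaleR_left (p s z))) (at z within I)"
      if "s \<in> I" "z \<in> I" for s z :: real
      using sint_has_vector_derivative[OF sec[OF that(1)] y that(2)] by (simp add: has_vector_derivative_def)
    have "continuous_on (I \<times> I) (\<lambda>q. blinfun_scaleR_left ((\<lambda>(x, z). p x z) q))"
      by (intro bounded_linear.continuous_on[OF bounded_linear_blinfun_scaleR_left] p)
    then have "continuous_on (I \<times> I) (\<lambda>(x, z). blinfun_scaleR_left (p x z))"
      by (simp add: split_beta)
    then show "continuous (at (x, x) within I \<times> I) (\<lambda>(x, z). blinfun_scaleR_left (p x z))"
      using x unfolding continuous_on_eq_continuous_within by blast
  qed (use x convex_I in auto)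
  then have 1: "((\<lambda>(x, z). sint y z (p x)) has_derivative (\<lambda>(tx, tz). tx *\<^sub>R sint y x (px x) + tz *\<^sub>R p x x))
      (at (x, x) within (\<lambda>s. (s, s)) ` I)"
    unfolding blinfun_scaleR_left.rep_eq by (rule has_derivative_subset) auto
  have 2: "((\<lambda>s. (s, s)) has_derivative (\<lambda>h. (h, h))) (at x within I)"
    by (auto intro!: derivative_eq_intros)
  from diff_chain_within[OF 2 1] show ?thesis
    by (simp add: has_vector_derivative_def o_def scaleR_add_right add.commute)
qed

text \<open>The weight \<open>u ^ n\<close> is kept because its integral \<open>1 / (n + 1)\<close>
  builds up the factorial in \<open>neumann_bound\<close>.\<close>

lemma norm_sint_le:
  fixes f :: "real \<Rightarrow> 'a::banach"
  assumes f: "continuous_on I f" and "a \<in> I" "b \<in> I"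
    and M: "\<And>u. u \<in> {0..1} \<Longrightarrow> norm (f (a + u * (b - a))) \<le> M * u ^ n"
  shows "norm (sint a b f) \<le> \<bar>b - a\<bar> * M / (real n + 1)"
proof -
  have i: "((\<lambda>u. M * u ^ n) has_integral M * (1 / (real n + 1))) {0..1}"
  proof (rule has_integral_mult_right)
    have "((\<lambda>u::real. u ^ n) has_integral 1 ^ (Suc n) / (real n + 1) - 0 ^ (Suc n) / (real n + 1)) {0..1}"
    proof (rule fundamental_theorem_of_calculus)
      fix u :: real
      show "((\<lambda>u. u ^ Suc n / (real n + 1)) has_vector_derivative u ^ n) (at u within {0..1})"
        unfolding has_real_derivative_iff_has_vector_derivative[symmetric]
        using DERIV_cdivide[OF DERIV_pow[of "Suc n" u "{0..1}"], of "real n + 1"]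
        by (simp add: add.commute del: power_Suc)
    qed simp
    then show "((\<lambda>u::real. u ^ n) has_integral 1 / (real n + 1)) {0..1}" by simp
  qed
  have "norm (integral {0..1} (\<lambda>u. f (a + u * (b - a)))) \<le> integral {0..1} (\<lambda>u. M * u ^ n)"
    by (rule integral_norm_bound_integral[OF sint_integrable[OF f assms(2,3)] has_integral_integrable[OF i] M])
  also have "\<dots> = M / (real n + 1)" using integral_unique[OF i] by simp
  finally show ?thesis
    unfolding sint_def norm_scaleR using mult_left_mono[of _ "M / (real n + 1)" "\<bar>b - a\<bar>"] by simp
qed

section \<open>Derivatives of smooth functions within the interval\<close>

lemma DI_has_vector_derivative:
  assumes "cinf I f" "x \<in> I"
  shows "(f has_vector_derivative DI f x) (at x within I)"
proof -
  have "Ck (Suc 0) I f" using assms by (simp add: cinf_def)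
  then obtain f' where "\<forall>x\<in>I. (f has_vector_derivative f' x) (at x within I)" by (rule Ck_real_SucE)
  then have f': "(f has_vector_derivative f' x) (at x within I)" using assms(2) by blast
  then show ?thesis unfolding DI_eq[OF assms(2) f'] .
qed

lemma cinf_DI:
  assumes "cinf I f"
  shows "cinf I (DI f)"
  unfolding cinf_def
proof
  fix n
  have "Ck (Suc n) I f" using assms by (simp add: cinf_def)
  then obtain f' where f': "\<forall>x\<in>I. (f has_vector_derivative f' x) (at x within I)" "Ck n I f'" by (rule Ck_real_SucE)
  then have "DI f x = f' x" if "x \<in> I" for x using that by (intro DI_eq) auto
  with f' show "Ck n I (DI f)" using Ck_cong[of I "DI f" f' n] by simp
qed

abbreviation D1 :: "(real \<Rightarrow> real \<Rightarrow> 'b::real_normed_vector) \<Rightarrow> real \<Rightarrow> real \<Rightarrow> 'b" where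
  "D1 f x y \<equiv> DI (\<lambda>s. f s y) x"

abbreviation D2 :: "(real \<Rightarrow> real \<Rightarrow> 'b::real_normed_vector) \<Rightarrow> real \<Rightarrow> real \<Rightarrow> 'b" where
  "D2 f x y \<equiv> DI (f x) y"

lemma
  assumes "cinf2 f" "x \<in> I" "y \<in> I"
  shows D1_has_vector_derivative: "((\<lambda>s. f s y) has_vector_derivative D1 f x y) (at x within I)"
    and D2_has_vector_derivative: "(f x has_vector_derivative D2 f x y) (at y within I)"
proof -
  show "((\<lambda>s. f s y) has_vector_derivative D1 f x y) (at x within I)"
    by (intro DI_has_vector_derivative cinf_section1[OF assms(1)] assms)
  show "(f x has_vector_derivative D2 f x y) (at y within I)"
    by (intro DI_has_vector_derivative cinf_section2[OF assms(1)] assms)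
qed

lemma
  assumes "cinf2 f"
  shows cinf2_D1: "cinf2 (D1 f)" and cinf2_D2: "cinf2 (D2 f)"
proof -
  have "Ck n (I \<times> I) (\<lambda>(x, y). D1 f x y) \<and> Ck n (I \<times> I) (\<lambda>(x, y). D2 f x y)" for n
  proof -
    have "Ck (Suc n) (I \<times> I) (\<lambda>(x, y). f x y)" using assms by (simp add: cinf_def)
    then obtain fx fy where f:
      "\<forall>x\<in>I. \<forall>y\<in>I. ((\<lambda>s. f s y) has_vector_derivative fx x y) (at x within I)"
      "\<forall>x\<in>I. \<forall>y\<in>I. (f x has_vector_derivative fy x y) (at y within I)"
      "Ck n (I \<times> I) (\<lambda>(x, y). fx x y)" "Ck n (I \<times> I) (\<lambda>(x, y). fy x y)" by (rule Ck_prod_SucE)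
    have "D1 f x y = fx x y" "D2 f x y = fy x y" if "x \<in> I" "y \<in> I" for x y
      using that f(1,2) by (auto intro!: DI_eq)
    then show ?thesis
      using f(3,4) Ck_cong[of "I \<times> I" "\<lambda>(x, y). D1 f x y" "\<lambda>(x, y). fx x y" n]
        Ck_cong[of "I \<times> I" "\<lambda>(x, y). D2 f x y" "\<lambda>(x, y). fy x y" n] by auto
  qed
  then show "cinf2 (D1 f)" "cinf2 (D2 f)" by (auto simp: cinf_def)
qed

lemma iter_deriv_0 [simp]: "iter_deriv I 0 f = f"
  and iter_deriv_Suc: "iter_deriv I (Suc k) f = DI (iter_deriv I k f)"
  and iter_deriv_Suc': "iter_deriv I (Suc k) f = iter_deriv I k (DI f)"
  unfolding iter_deriv_def using funpow_swap1[of "\<lambda>g t. vector_derivative g (at t within I)" k f] by simp_all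

lemma cinf_iter_deriv: "cinf I f \<Longrightarrow> cinf I (iter_deriv I k f)"
  by (induction k) (simp_all add: iter_deriv_Suc cinf_DI)

lemma smooth_on_iff_cinf: "smooth_on I f \<longleftrightarrow> cinf I f"
proof
  assume "cinf I f"
  then show "smooth_on I f"
    unfolding smooth_on_def using DI_has_vector_derivative[OF cinf_iter_deriv] differentiableI_vector by blast
next
  have "Ck n I f" if "smooth_on I f" for n
    using that
  proof (induction n arbitrary: f)
    case 0
    then have "\<forall>t\<in>I. iter_deriv I 0 f differentiable (at t within I)" unfolding smooth_on_def by blast
    then show ?case by (simp add: differentiable_imp_continuous_on differentiable_on_def)
  next
    case (Suc n)
    then have "\<forall>t\<in>I. iter_deriv I 0 f differentiable (at t within I)" unfolding smooth_on_def by blast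
    moreover have "smooth_on I (DI f)"
      using Suc.prems unfolding smooth_on_def by (metis iter_deriv_Suc')
    ultimately show ?case
      by (intro Ck_real_SucI[of I f "DI f"] Suc.IH) (auto simp: vector_derivative_works)
  qed
  then show "smooth_on I f \<Longrightarrow> cinf I f" by (simp add: cinf_def)
qed

lemma cinf2_partial_deriv:
  assumes "cinf2 f"
  shows "cinf2 (partial_deriv I j k f)"
proof -
  have 1: "cinf2 (\<lambda>x y. iter_deriv I k (f x) y)"
    using assms by (induction k) (simp_all add: iter_deriv_Suc cinf2_D2)
  have "cinf2 (\<lambda>x y. iter_deriv I j (\<lambda>s. iter_deriv I k (f s) y) x)"
  proof (induction j)
    case (Suc j)
    show ?case using cinf2_D1[OF Suc.IH] by (simp add: iter_deriv_Suc)
  qed (use 1 in simp)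
  then show ?thesis by (simp add: partial_deriv_def[abs_def])
qed

lemma cinf2_imp_smooth2_on: "cinf2 f \<Longrightarrow> smooth2_on I f"
  unfolding smooth2_on_def
  by (intro allI conjI ballI differentiableI_vector[OF D1_has_vector_derivative]
      differentiableI_vector[OF D2_has_vector_derivative] cinf_continuous_on cinf2_partial_deriv)

lemma partial_deriv_10: "partial_deriv I 1 0 f = D1 f"
  and partial_deriv_01: "partial_deriv I 0 1 f = D2 f"
  by (simp_all add: partial_deriv_def fun_eq_iff iter_deriv_Suc)

lemma interval_subset: "a \<in> I \<Longrightarrow> b \<in> I \<Longrightarrow> {a..b} \<subseteq> I"
  using iv unfolding is_interval_1 by (meson atLeastAtMost_iff subsetI)

text \<open>A convergent sequence together with its limit is compact, so all its coordinates lie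
  between two points of \<open>I\<close>. Uniform convergence of the Neumann series will be proved
  on such squares.\<close>

lemma continuous_on_compact_squares:
  fixes f :: "real \<times> real \<Rightarrow> 'b::topological_space"
  assumes "\<And>c d. c \<in> I \<Longrightarrow> d \<in> I \<Longrightarrow> continuous_on ({c..d} \<times> {c..d}) f"
  shows "continuous_on (I \<times> I) f"
  unfolding continuous_on_sequentially
proof (intro allI ballI impI)
  fix xs p assume p: "p \<in> I \<times> I" and "(\<forall>n. xs n \<in> I \<times> I) \<and> xs \<longlonglongrightarrow> p"
  then have xs: "\<And>n. xs n \<in> I \<times> I" "xs \<longlonglongrightarrow> p" by auto
  define K where "K = fst ` (insert p (range xs)) \<union> snd ` (insert p (range xs))"
  have K: "compact K" "K \<noteq> {}" "K \<subseteq> I"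
  proof -
    have "fst q \<in> I" "snd q \<in> I" if "q \<in> insert p (range xs)" for q
      using that xs(1) p by (auto simp: mem_Times_iff)
    then show "K \<subseteq> I" unfolding K_def by (intro Un_least image_subsetI)
    show "compact K" unfolding K_def using compact_sequence_with_limit[OF xs(2)]
      by (intro compact_Un compact_continuous_image continuous_on_fst continuous_on_snd continuous_on_id)
  qed (simp add: K_def)
  obtain c where c: "c \<in> K" "\<forall>y\<in>K. c \<le> y" using compact_attains_inf[OF K(1,2)] by blast
  obtain d where d: "d \<in> K" "\<forall>y\<in>K. y \<le> d" using compact_attains_sup[OF K(1,2)] by blast
  have in_K: "fst q \<in> K" "snd q \<in> K" if "q \<in> insert p (range xs)" for q
    using that unfolding K_def by blast+
  have "q \<in> {c..d} \<times> {c..d}" if "q \<in> insert p (range xs)" for q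
    using in_K[OF that] c d by (cases q) auto
  then have "p \<in> {c..d} \<times> {c..d}" "\<And>n. xs n \<in> {c..d} \<times> {c..d}" by auto
  moreover have "continuous_on ({c..d} \<times> {c..d}) f"
    using assms c(1) d(1) K(3) by blast
  ultimately show "(f \<circ> xs) \<longlonglongrightarrow> f p"
    using xs(2) unfolding continuous_on_sequentially by blast
qed

lemma sint_uniform_limit:
  fixes f :: "nat \<Rightarrow> real \<Rightarrow> 'a::banach"
  assumes "uniform_limit {c..d} f g sequentially" "\<And>n. continuous_on I (f n)" "continuous_on I g"
    and cd: "c \<in> I" "d \<in> I" and ab: "a \<in> {c..d}" "b \<in> {c..d}"
  shows "(\<lambda>n. sint a b (f n)) \<longlonglongrightarrow> sint a b g"
proof (rule tendstoI)
  fix e :: real assume e: "e > 0"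
  have I: "a \<in> I" "b \<in> I" using interval_subset[OF cd] ab by auto
  define e' where "e' = e / (\<bar>b - a\<bar> + 1)"
  have e': "e' > 0" "\<bar>b - a\<bar> * e' < e" using e by (auto simp: e'_def field_simps)
  have "\<forall>\<^sub>F n in sequentially. \<forall>x\<in>{c..d}. dist (f n x) (g x) < e'"
    using uniform_limitD[OF assms(1) e'(1)] .
  then show "\<forall>\<^sub>F n in sequentially. dist (sint a b (f n)) (sint a b g) < e"
  proof eventually_elim
    case (elim n)
    have "norm (sint a b (\<lambda>x. f n x - g x)) \<le> \<bar>b - a\<bar> * e' / (real 0 + 1)"
    proof (rule norm_sint_le[OF _ I])
      show "continuous_on I (\<lambda>x. f n x - g x)" by (intro continuous_intros assms)
      fix u :: real assume "u \<in> {0..1}"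
      then have "a + u * (b - a) \<in> {c..d}" using segment_point[OF is_interval_cc ab] by blast
      then show "norm (f n (a + u * (b - a)) - g (a + u * (b - a))) \<le> e' * u ^ 0"
        using elim by (auto simp: dist_norm less_imp_le)
    qed
    then show ?case
      using e'(2) by (simp add: dist_norm sint_diff[OF assms(2,3) I])
  qed
qed

lemma sint_swap:
  fixes f :: "real \<Rightarrow> 'a::banach"
  assumes "continuous_on I f" "a \<in> I" "b \<in> I"
  shows "sint b a f = - sint a b f"
  using sint_combine[OF assms assms(2)] by (simp add: eq_neg_iff_add_eq_0 add.commute)

end

section \<open>Volterra composition and resolvent kernels\<close>

text \<open>The product is a parameter because the theory serves both complex kernels and matrix
  kernels.\<close>

locale volterra_product = nondegenerate_interval I + bounded_bilinear pr
  for I :: "real set" and pr :: "'a::banach \<Rightarrow> 'a \<Rightarrow> 'a" +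
  assumes pr_assoc: "pr (pr a b) c = pr a (pr b c)"
begin

text \<open>This is the smooth part of the \<open>*\<close>-product, extended by the oriented
  integral to \<open>x < y\<close>, where the Heaviside factor hides it. Smoothness on the whole
  square is then inherited from the factors.\<close>

definition vstar :: "(real \<Rightarrow> real \<Rightarrow> 'a) \<Rightarrow> (real \<Rightarrow> real \<Rightarrow> 'a) \<Rightarrow> real \<Rightarrow> real \<Rightarrow> 'a" where
  "vstar h k x y = sint y x (\<lambda>t. pr (h x t) (k t y))"

abbreviation Ck2 :: "nat \<Rightarrow> (real \<Rightarrow> real \<Rightarrow> 'a) \<Rightarrow> bool" where
  "Ck2 n f \<equiv> Ck n (I \<times> I) (\<lambda>(x, y). f x y)"

lemma Ck2_compose:
  assumes "Ck2 n f" "Ck n S g" "Ck n S h" "g ` S \<subseteq> I" "h ` S \<subseteq> I"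
  shows "Ck n S (\<lambda>p. f (g p) (h p))"
  using Ck_compose[OF assms(1) Ck_Pair[OF assms(2,3)]] assms(4,5) by auto

lemma continuous_section1: "Ck2 0 f \<Longrightarrow> y \<in> I \<Longrightarrow> continuous_on I (\<lambda>x. f x y)"
  using Ck2_compose[of 0 f I "\<lambda>x. x" "\<lambda>_. y"] by (auto simp: Ck_id Ck_const intro: continuous_intros)

lemma continuous_section2: "Ck2 0 f \<Longrightarrow> x \<in> I \<Longrightarrow> continuous_on I (f x)"
  using Ck2_compose[of 0 f I "\<lambda>_. x" "\<lambda>x. x"] by (auto simp: Ck_id Ck_const intro: continuous_intros)

lemma continuous_integrand:
  assumes "Ck2 0 h" "Ck2 0 k" "x \<in> I" "y \<in> I"
  shows "continuous_on I (\<lambda>t. pr (h x t) (k t y))"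
  by (intro continuous_on continuous_section1 continuous_section2 assms)

lemma vstar_cong:
  assumes "\<And>x y. x \<in> I \<Longrightarrow> y \<in> I \<Longrightarrow> h x y = h' x y" "\<And>x y. x \<in> I \<Longrightarrow> y \<in> I \<Longrightarrow> k x y = k' x y"
    and "x \<in> I" "y \<in> I"
  shows "vstar h k x y = vstar h' k' x y"
  unfolding vstar_def by (rule sint_cong) (use assms in auto)

lemma Ck2_vstar:
  assumes "Ck2 n h" "Ck2 n k"
  shows "Ck2 n (vstar h k)"
proof -
  have "Ck n (I \<times> I) (\<lambda>p. sint (snd p) (fst p) (\<lambda>t. pr (h (fst p) t) (k t (snd p))))"
  proof (rule Ck_sint)
    have "Ck n ((I \<times> I) \<times> I) (\<lambda>z. pr (h (fst (fst z)) (snd z)) (k (snd z) (snd (fst z))))"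
      by (intro Ck_bilinear[OF bounded_bilinear_axioms] Ck2_compose[OF assms(1)] Ck2_compose[OF assms(2)]
          Ck_compose[OF Ck_fst, of n _ _ UNIV] Ck_compose[OF Ck_snd, of n _ _ UNIV] Ck_fst Ck_snd) auto
    then show "Ck n ((I \<times> I) \<times> I) (\<lambda>(p, t). pr (h (fst p) t) (k t (snd p)))"
      by (simp add: split_beta')
  qed (auto intro: Ck_fst Ck_snd convex_Times convex_I)
  then show ?thesis by (simp add: vstar_def split_beta')
qed

text \<open>Both sides are the values at \<open>z = x\<close> of functions of an upper limit \<open>z\<close> with the same derivative,
  so no interchange of integrals is needed.\<close>

lemma vstar_assoc:
  assumes h: "Ck2 0 h" and k: "Ck2 0 k" and g: "Ck2 0 g" and x: "x \<in> I" and y: "y \<in> I"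
  shows "vstar h (vstar k g) x y = vstar (vstar h k) g x y"
proof -
  define f where "f z = pr (h x z) (vstar k g z y)" for z
  have cf: "continuous_on I f"
    unfolding f_def using continuous_integrand[OF h Ck2_vstar[OF k g] x y] .
  have L: "((\<lambda>z. sint y z f) has_vector_derivative f z) (at z within I)" if "z \<in> I" for z
    by (rule sint_has_vector_derivative[OF cf y that])
  define p where "p z s = pr (sint s z (\<lambda>t. pr (h x t) (k t s))) (g s y)" for z s
  define pz where "pz z s = pr (pr (h x z) (k z s)) (g s y)" for z s
  have R: "((\<lambda>z. sint y z (p z)) has_vector_derivative f z) (at z within I)" if z: "z \<in> I" for z
  proof -
    have "((\<lambda>z. sint y z (p z)) has_vector_derivative p z z + sint y z (pz z)) (at z within I)"
    proof (rule leibniz_sint[OF _ _ _ y z])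
      have "Ck 0 (I \<times> I) (\<lambda>q. sint (snd q) (fst q) (\<lambda>t. pr (h x t) (k t (snd q))))"
      proof (rule Ck_sint)
        have "Ck 0 ((I \<times> I) \<times> I) (\<lambda>z. pr (h x (snd z)) (k (snd z) (snd (fst z))))"
          by (intro Ck_bilinear[OF bounded_bilinear_axioms] Ck2_compose[OF h] Ck2_compose[OF k]
              Ck_compose[OF Ck_snd, of 0 _ _ UNIV] Ck_fst Ck_snd Ck_const) (use x in auto)
        then show "Ck 0 ((I \<times> I) \<times> I) (\<lambda>(p, t). pr (h x t) (k t (snd p)))"
          by (simp add: split_beta')
      qed (auto intro: Ck_fst Ck_snd convex_Times convex_I simp del: Ck.simps)
      then have "Ck 0 (I \<times> I) (\<lambda>q. p (fst q) (snd q))"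
        unfolding p_def
        by (intro Ck_bilinear[OF bounded_bilinear_axioms] Ck2_compose[OF g] Ck_snd Ck_const) (use y in auto)
      then show "continuous_on (I \<times> I) (\<lambda>(z, s). p z s)" by (simp add: split_beta')
      have "Ck 0 (I \<times> I) (\<lambda>q. pz (fst q) (snd q))"
        unfolding pz_def
        by (intro Ck_bilinear[OF bounded_bilinear_axioms] Ck2_compose[OF g] Ck2_compose[OF h] Ck2_compose[OF k]
            Ck_fst Ck_snd Ck_const) (use x y in auto)
      then show "continuous_on (I \<times> I) (\<lambda>(z, s). pz z s)" by (simp add: split_beta')
      show "((\<lambda>z. p z s) has_vector_derivative pz z s) (at z within I)" if "z \<in> I" "s \<in> I" for z s
        unfolding p_def pz_def
        by (intro bounded_linear.has_vector_derivative[OF bounded_linear_left] sint_has_vector_derivative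
            continuous_integrand[OF h k x that(2)] that)
    qed
    moreover have "p z z = 0" by (simp add: p_def zero_left)
    moreover have "sint y z (pz z) = f z"
      unfolding pz_def f_def vstar_def pr_assoc
      by (rule sint_linear[OF bounded_linear_right continuous_integrand[OF k g z y] y z])
    ultimately show ?thesis by simp
  qed
  have "sint y x f = sint y x (p x)"
    using sint_FTC[OF y x R] by simp
  then show ?thesis by (simp add: f_def[abs_def] p_def[abs_def] vstar_def)
qed

lemma vstar_add_right:
  assumes "Ck2 0 h" "Ck2 0 k" "Ck2 0 l" "x \<in> I" "y \<in> I"
  shows "vstar h (\<lambda>x y. k x y + l x y) x y = vstar h k x y + vstar h l x y"
  unfolding vstar_def add_right using assms by (intro sint_add continuous_integrand)

lemma vstar_add_left:
  assumes "Ck2 0 h" "Ck2 0 k" "Ck2 0 l" "x \<in> I" "y \<in> I"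
  shows "vstar (\<lambda>x y. k x y + l x y) h x y = vstar k h x y + vstar l h x y"
  unfolding vstar_def add_left using assms by (intro sint_add continuous_integrand)

lemma vstar_D1:
  assumes h: "cinf2 h" and g: "Ck2 0 g" and x: "x \<in> I" and y: "y \<in> I"
  shows "((\<lambda>x. vstar h g x y) has_vector_derivative pr (h x x) (g x y) + vstar (D1 h) g x y) (at x within I)"
proof -
  have h0: "Ck2 0 h" "Ck2 0 (D1 h)" using h cinf2_D1[OF h] by (simp_all only: cinf_def)
  have c: "Ck 0 (I \<times> I) (\<lambda>q. pr (f (fst q) (snd q)) (g (snd q) y))" if "Ck2 0 f" for f
    by (intro Ck_bilinear[OF bounded_bilinear_axioms] Ck2_compose[OF g] Ck2_compose[OF that]
        Ck_fst Ck_snd Ck_const) (use y in auto)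
  show ?thesis
    unfolding vstar_def
  proof (rule leibniz_sint[OF _ _ _ y x])
    show "continuous_on (I \<times> I) (\<lambda>(x, t). pr (h x t) (g t y))"
      "continuous_on (I \<times> I) (\<lambda>(x, t). pr (D1 h x t) (g t y))"
      using c[OF h0(1)] c[OF h0(2)] by (simp_all add: split_beta')
    show "((\<lambda>x. pr (h x t) (g t y)) has_vector_derivative pr (D1 h x t) (g t y)) (at x within I)"
      if "x \<in> I" "t \<in> I" for x t
      by (intro bounded_linear.has_vector_derivative[OF bounded_linear_left] D1_has_vector_derivative[OF h that])
  qed
qed

lemma vstar_D2:
  assumes h: "cinf2 h" and g: "Ck2 0 g" and x: "x \<in> I" and y: "y \<in> I"
  shows "(vstar g h x has_vector_derivative vstar g (D2 h) x y - pr (g x y) (h y y)) (at y within I)"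
proof -
  have h0: "Ck2 0 h" "Ck2 0 (D2 h)" using h cinf2_D2[OF h] by (simp_all only: cinf_def)
  have c: "Ck 0 (I \<times> I) (\<lambda>q. pr (g x (snd q)) (f (snd q) (fst q)))" if "Ck2 0 f" for f
    by (intro Ck_bilinear[OF bounded_bilinear_axioms] Ck2_compose[OF g] Ck2_compose[OF that]
        Ck_fst Ck_snd Ck_const) (use x in auto)
  \<comment> \<open>The moving limit is the lower one in \<open>vstar\<close>; reversing the
    orientation makes it the upper one and accounts for the minus sign.\<close>
  have "((\<lambda>y. sint x y (\<lambda>t. pr (g x t) (h t y))) has_vector_derivative
      pr (g x y) (h y y) + sint x y (\<lambda>t. pr (g x t) (D2 h t y))) (at y within I)"
  proof (rule leibniz_sint[OF _ _ _ x y])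
    show "continuous_on (I \<times> I) (\<lambda>(y, t). pr (g x t) (h t y))"
      "continuous_on (I \<times> I) (\<lambda>(y, t). pr (g x t) (D2 h t y))"
      using c[OF h0(1)] c[OF h0(2)] by (simp_all add: split_beta')
    show "((\<lambda>y. pr (g x t) (h t y)) has_vector_derivative pr (g x t) (D2 h t y)) (at y within I)"
      if "y \<in> I" "t \<in> I" for y t
      by (intro bounded_linear.has_vector_derivative[OF bounded_linear_right] D2_has_vector_derivative[OF h that(2,1)])
  qed
  from has_vector_derivative_minus[OF this]
  have "((\<lambda>y. - sint x y (\<lambda>t. pr (g x t) (h t y))) has_vector_derivative
      - (pr (g x y) (h y y) + sint x y (\<lambda>t. pr (g x t) (D2 h t y)))) (at y within I)" .
  moreover have "- (pr (g x y) (h y y) + sint x y (\<lambda>t. pr (g x t) (D2 h t y))) = vstar g (D2 h) x y - pr (g x y) (h y y)"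
    using sint_swap[OF continuous_integrand[OF g h0(2) x y] x y] by (simp add: vstar_def)
  ultimately have "((\<lambda>y. - sint x y (\<lambda>t. pr (g x t) (h t y))) has_vector_derivative
      vstar g (D2 h) x y - pr (g x y) (h y y)) (at y within I)" by (simp only:)
  then show ?thesis
    by (rule has_vector_derivative_transform[rotated 2])
      (use x y sint_swap[OF continuous_integrand[OF g h0(1) x] x] in \<open>simp_all add: vstar_def\<close>)
qed

section \<open>Neumann series and resolvent kernels\<close>

primrec neumann :: "(real \<Rightarrow> real \<Rightarrow> 'a) \<Rightarrow> nat \<Rightarrow> real \<Rightarrow> real \<Rightarrow> 'a" where
  "neumann h 0 = h"
| "neumann h (Suc n) = vstar h (neumann h n)"

context
  fixes h :: "real \<Rightarrow> real \<Rightarrow> 'a"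
  assumes h: "cinf2 h"
begin

lemma h_cont: "Ck2 0 h"
  using h by (simp only: cinf_def)

lemma neumann_cont: "Ck2 0 (neumann h n)"
  by (induction n) (auto intro: h_cont Ck2_vstar simp del: Ck.simps)

lemma neumann_commute:
  "x \<in> I \<Longrightarrow> y \<in> I \<Longrightarrow> vstar (neumann h n) h x y = vstar h (neumann h n) x y"
proof (induction n arbitrary: x y)
  case (Suc n)
  have "vstar (neumann h (Suc n)) h x y = vstar h (vstar (neumann h n) h) x y"
    using vstar_assoc[OF h_cont neumann_cont h_cont Suc.prems] by simp
  also have "\<dots> = vstar h (neumann h (Suc n)) x y"
    by (rule vstar_cong) (use Suc in auto)
  finally show ?case .
qed simp

text \<open>Each further factor integrates a bound proportional to the \<open>n\<close>th power of
  the distance along the segment, which gains a factor \<open>1 / (n + 1)\<close>. The resulting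
  factorial makes the series converge however large \<open>h\<close> is.\<close>

lemma neumann_bound:
  assumes cd: "c \<in> I" "d \<in> I" "\<And>x y. x \<in> {c..d} \<Longrightarrow> y \<in> {c..d} \<Longrightarrow> norm (h x y) \<le> C"
    and K: "\<And>a b. norm (pr a b) \<le> norm a * norm b * K" "K \<ge> 0" and C: "C \<ge> 0"
    and "x \<in> {c..d}" "y \<in> {c..d}"
  shows "norm (neumann h n x y) \<le> C * (C * K * \<bar>x - y\<bar>) ^ n / fact n"
  using assms(7,8)
proof (induction n arbitrary: x y)
  case (Suc n)
  have I: "x \<in> I" "y \<in> I" using Suc.prems interval_subset[OF cd(1,2)] by auto
  have "norm (vstar h (neumann h n) x y) \<le> \<bar>x - y\<bar> * (C * K * (C * (C * K * \<bar>x - y\<bar>) ^ n / fact n)) / (real n + 1)"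
    unfolding vstar_def
  proof (rule norm_sint_le[OF continuous_integrand[OF h_cont neumann_cont I] I(2,1)])
    fix u :: real assume u: "u \<in> {0..1}"
    define t where "t = y + u * (x - y)"
    have t: "t \<in> {c..d}" unfolding t_def using segment_point[OF is_interval_cc Suc.prems(2,1) u] .
    have ty: "\<bar>t - y\<bar> = u * \<bar>x - y\<bar>" using u by (simp add: t_def abs_mult)
    have "norm (pr (h x t) (neumann h n t y)) \<le> norm (h x t) * norm (neumann h n t y) * K"
      by (rule K)
    also have "\<dots> \<le> C * (C * (C * K * \<bar>t - y\<bar>) ^ n / fact n) * K"
      by (intro mult_right_mono mult_mono cd(3) Suc.IH) (use Suc.prems t K C in auto)
    also have "\<dots> = C * K * (C * (C * K * \<bar>x - y\<bar>) ^ n / fact n) * u ^ n"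
      by (simp add: ty power_mult_distrib)
    finally show "norm (pr (h x (y + u * (x - y))) (neumann h n (y + u * (x - y)) y))
       \<le> C * K * (C * (C * K * \<bar>x - y\<bar>) ^ n / fact n) * u ^ n"
      by (simp only: t_def)
  qed
  also have "\<dots> = C * (C * K * \<bar>x - y\<bar>) ^ Suc n / fact (Suc n)"
    by (simp add: field_simps)
  finally show ?case by simp
qed (use cd(3) in simp)

text \<open>Since \<open>neumann h n\<close> is the power with exponent \<open>n + 1\<close>, this
  is the sum of all \<open>*\<close>-powers of \<open>h\<close> from the first on.\<close>

definition resolvent :: "real \<Rightarrow> real \<Rightarrow> 'a" where
  "resolvent x y = (\<Sum>n. neumann h n x y)"

lemma resolvent_uniform_limit:
  assumes cd: "c \<in> I" "d \<in> I"
  shows "uniform_limit ({c..d} \<times> {c..d}) (\<lambda>n (x, y). \<Sum>i<n. neumann h i x y) (\<lambda>(x, y). resolvent x y) sequentially"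
proof -
  obtain K where K: "0 < K" "\<And>a b. norm (pr a b) \<le> norm a * norm b * K" using pos_bounded by blast
  have sub: "{c..d} \<times> {c..d} \<subseteq> I \<times> I"
    using interval_subset[OF cd] by blast
  have "compact ((\<lambda>(x, y). h x y) ` ({c..d} \<times> {c..d}))"
    by (rule compact_continuous_image[OF continuous_on_subset[OF Ck_continuous_on[OF h_cont] sub]])
      (simp add: compact_Times)
  then have "bounded ((\<lambda>(x, y). h x y) ` ({c..d} \<times> {c..d}))" by (rule compact_imp_bounded)
  then obtain C where "C > 0" "\<forall>z\<in>(\<lambda>(x, y). h x y) ` ({c..d} \<times> {c..d}). norm z \<le> C"
    unfolding bounded_pos by blast
  then have C: "\<And>x y. x \<in> {c..d} \<Longrightarrow> y \<in> {c..d} \<Longrightarrow> norm (h x y) \<le> C" "C > 0" by auto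
  have "uniform_limit ({c..d} \<times> {c..d}) (\<lambda>n p. \<Sum>i<n. (\<lambda>(x, y). neumann h i x y) p)
      (\<lambda>p. \<Sum>i. (\<lambda>(x, y). neumann h i x y) p) sequentially"
  proof (rule Weierstrass_m_test)
    show "summable (\<lambda>n. C * ((C * K * (d - c)) ^ n / fact n))"
      using summable_exp[of "C * K * (d - c)"] by (intro summable_mult) (simp add: field_simps)
    fix n and p :: "real \<times> real" assume "p \<in> {c..d} \<times> {c..d}"
    then obtain x y where p: "p = (x, y)" "x \<in> {c..d}" "y \<in> {c..d}" by auto
    have "norm (neumann h n x y) \<le> C * (C * K * \<bar>x - y\<bar>) ^ n / fact n"
      by (rule neumann_bound[OF cd C(1) K(2)]) (use K(1) C(2) p in auto)
    also have "\<dots> \<le> C * (C * K * (d - c)) ^ n / fact n"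
      by (intro divide_right_mono mult_left_mono power_mono) (use K(1) C(2) p in auto)
    finally show "norm ((\<lambda>(x, y). neumann h n x y) p) \<le> C * ((C * K * (d - c)) ^ n / fact n)"
      by (simp add: p)
  qed
  then show ?thesis by (simp add: resolvent_def split_beta')
qed

lemma resolvent_cont: "Ck2 0 resolvent"
proof -
  have "continuous_on (I \<times> I) (\<lambda>(x, y). resolvent x y)"
  proof (rule continuous_on_compact_squares)
    fix c d assume cd: "c \<in> I" "d \<in> I"
    show "continuous_on ({c..d} \<times> {c..d}) (\<lambda>(x, y). resolvent x y)"
    proof (rule uniform_limit_theorem[OF _ resolvent_uniform_limit[OF cd]])
      have "continuous_on ({c..d} \<times> {c..d}) (\<lambda>(x, y). neumann h i x y)" for i
        using interval_subset[OF cd]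
        by (intro continuous_on_subset[OF Ck_continuous_on[OF neumann_cont]]) auto
      then show "\<forall>\<^sub>F n in sequentially. continuous_on ({c..d} \<times> {c..d}) (\<lambda>(x, y). \<Sum>i<n. neumann h i x y)"
        by (auto simp: split_beta' intro!: always_eventually continuous_on_sum)
    qed simp
  qed
  then show ?thesis by simp
qed

lemma partial_sums_cont: "Ck2 0 (\<lambda>x y. \<Sum>i<n. neumann h i x y)"
  using Ck_sum[of "{..<n}" 0 "I \<times> I" "\<lambda>i (x, y). neumann h i x y"] neumann_cont
  by (simp add: split_beta' del: Ck.simps)

lemma partial_sums_Suc:
  assumes "x \<in> I" "y \<in> I"
  shows "(\<Sum>i<Suc n. neumann h i x y) = h x y + vstar h (\<lambda>x y. \<Sum>i<n. neumann h i x y) x y"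
    and "(\<Sum>i<Suc n. neumann h i x y) = h x y + vstar (\<lambda>x y. \<Sum>i<n. neumann h i x y) h x y"
proof -
  have z: "vstar h (\<lambda>x y. 0) x y = 0" "vstar (\<lambda>x y. 0) h x y = 0"
    by (simp_all add: vstar_def zero_left zero_right sint_def)
  have "vstar h (\<lambda>x y. \<Sum>i<n. neumann h i x y) x y = (\<Sum>i<n. neumann h (Suc i) x y) \<and>
      vstar (\<lambda>x y. \<Sum>i<n. neumann h i x y) h x y = (\<Sum>i<n. neumann h (Suc i) x y)"
  proof (induction n)
    case (Suc n)
    then show ?case
      using vstar_add_right[OF h_cont partial_sums_cont neumann_cont assms, of n n]
        vstar_add_left[OF h_cont partial_sums_cont neumann_cont assms, of n n] neumann_commute[OF assms, of n]
      by simp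
  qed (simp add: z)
  then show "(\<Sum>i<Suc n. neumann h i x y) = h x y + vstar h (\<lambda>x y. \<Sum>i<n. neumann h i x y) x y"
    "(\<Sum>i<Suc n. neumann h i x y) = h x y + vstar (\<lambda>x y. \<Sum>i<n. neumann h i x y) h x y"
    by (simp_all add: sum.lessThan_Suc_shift del: sum.lessThan_Suc)
qed

text \<open>The recursion of the partial sums passes to the limit, because between \<open>x\<close>
  and \<open>y\<close> the integrands converge uniformly.\<close>

lemma resolvent_eq:
  assumes x: "x \<in> I" and y: "y \<in> I"
  shows "resolvent x y = h x y + vstar h resolvent x y"
    and "resolvent x y = h x y + vstar resolvent h x y"
proof -
  define c d where "c = min x y" and "d = max x y"
  have cd: "c \<in> I" "d \<in> I" "x \<in> {c..d}" "y \<in> {c..d}" using x y by (auto simp: c_def d_def min_def max_def)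
  define S where "S n x y = (\<Sum>i<n. neumann h i x y)" for n x y
  have S_Suc: "S (Suc n) x y = h x y + vstar h (S n) x y" "S (Suc n) x y = h x y + vstar (S n) h x y" for n
    unfolding S_def[abs_def] using partial_sums_Suc[OF x y] by blast+
  have Sc: "Ck2 0 (S n)" for n unfolding S_def by (rule partial_sums_cont)
  have u: "uniform_limit ({c..d} \<times> {c..d}) (\<lambda>n (x, y). S n x y) (\<lambda>(x, y). resolvent x y) sequentially"
    unfolding S_def by (rule resolvent_uniform_limit[OF cd(1,2)])
  have lim: "(\<lambda>n. S n x y) \<longlonglongrightarrow> resolvent x y"
    using tendsto_uniform_limitI[OF u, of "(x, y)"] cd by simp
  have b: "bounded (f ` {c..d})" if "continuous_on I f" for f :: "real \<Rightarrow> 'a"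
    using interval_subset[OF cd(1,2)] that
    by (intro compact_imp_bounded compact_continuous_image) (auto intro: continuous_on_subset)
  have u1: "uniform_limit {c..d} (\<lambda>n t. S n t y) (\<lambda>t. resolvent t y) sequentially"
    using uniform_limit_compose'[OF u, of "\<lambda>t. (t, y)" "{c..d}"] cd by simp
  have u2: "uniform_limit {c..d} (\<lambda>n t. S n x t) (\<lambda>t. resolvent x t) sequentially"
    using uniform_limit_compose'[OF u, of "\<lambda>t. (x, t)" "{c..d}"] cd by simp
  have "uniform_limit {c..d} (\<lambda>n t. pr (h x t) (S n t y)) (\<lambda>t. pr (h x t) (resolvent t y)) sequentially"
    by (rule bounded_uniform_limit[OF uniform_limit_const u1])
      (use b continuous_section1[OF resolvent_cont y] continuous_section2[OF h_cont x] in auto)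
  then have 1: "(\<lambda>n. vstar h (S n) x y) \<longlonglongrightarrow> vstar h resolvent x y"
    unfolding vstar_def
    by (rule sint_uniform_limit) (use cd continuous_integrand h_cont Sc resolvent_cont x y in auto)
  have "uniform_limit {c..d} (\<lambda>n t. pr (S n x t) (h t y)) (\<lambda>t. pr (resolvent x t) (h t y)) sequentially"
    by (rule bounded_uniform_limit[OF u2 uniform_limit_const])
      (use b continuous_section2[OF resolvent_cont x] continuous_section1[OF h_cont y] in auto)
  then have 2: "(\<lambda>n. vstar (S n) h x y) \<longlonglongrightarrow> vstar resolvent h x y"
    unfolding vstar_def
    by (rule sint_uniform_limit) (use cd continuous_integrand h_cont Sc resolvent_cont x y in auto)
  have "(\<lambda>n. S (Suc n) x y) \<longlonglongrightarrow> h x y + vstar h resolvent x y"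
    "(\<lambda>n. S (Suc n) x y) \<longlonglongrightarrow> h x y + vstar resolvent h x y"
    using tendsto_add[OF tendsto_const 1, of "h x y"] tendsto_add[OF tendsto_const 2, of "h x y"]
    unfolding S_Suc(1)[symmetric] S_Suc(2)[symmetric] by simp_all
  then show "resolvent x y = h x y + vstar h resolvent x y" "resolvent x y = h x y + vstar resolvent h x y"
    by (auto intro: LIMSEQ_unique[OF LIMSEQ_Suc[OF lim]])
qed

text \<open>Substituting one resolvent equation into the other gives \<open>k = h + h * h + h * k * h\<close>, and the
  last term has one more derivative than \<open>k\<close>.\<close>

lemma Ck2_resolvent: "Ck2 n resolvent"
proof (induction n)
  case 0
  show ?case by (rule resolvent_cont)
next
  case (Suc n)
  let ?K = resolvent
  have hn: "Ck2 m h" for m using h by (simp only: cinf_def)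
  define G where "G = vstar h (vstar ?K h)"
  \<comment> \<open>Both bracketings are used: one has a smooth \<open>h\<close> outermost on the
    left, for the derivative in \<open>x\<close>, the other has it outermost on the right, for the
    derivative in \<open>y\<close>. The continuous resolvent itself is never differentiated.\<close>
  have G2: "G x y = vstar (vstar h ?K) h x y" if "x \<in> I" "y \<in> I" for x y
    unfolding G_def by (rule vstar_assoc[OF h_cont resolvent_cont h_cont that])
  have "?K x y = h x y + vstar h h x y + G x y" if "x \<in> I" "y \<in> I" for x y
  proof -
    have "vstar h ?K x y = vstar h (\<lambda>x y. h x y + vstar ?K h x y) x y"
      by (rule vstar_cong) (use that resolvent_eq(2) in auto)
    also have "\<dots> = vstar h h x y + G x y"
      unfolding G_def by (rule vstar_add_right[OF h_cont h_cont Ck2_vstar[OF resolvent_cont h_cont] that])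
    finally show ?thesis using resolvent_eq(1)[OF that] by simp
  qed
  moreover have "Ck2 (Suc n) (\<lambda>x y. h x y + vstar h h x y + G x y)"
  proof -
    have "Ck2 (Suc n) G"
    proof (rule Ck_prod_SucI)
      fix x y assume xy: "x \<in> I" "y \<in> I"
      show "((\<lambda>x. G x y) has_vector_derivative pr (h x x) (vstar ?K h x y) + vstar (D1 h) (vstar ?K h) x y) (at x within I)"
        unfolding G_def by (rule vstar_D1[OF h Ck2_vstar[OF resolvent_cont h_cont] xy])
      show "(G x has_vector_derivative vstar (vstar h ?K) (D2 h) x y - pr (vstar h ?K x y) (h y y)) (at y within I)"
        by (rule has_vector_derivative_transform[rotated 2, OF vstar_D2[OF h Ck2_vstar[OF h_cont resolvent_cont] xy]])
          (use xy G2 in auto)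
    next
      have d: "Ck2 n (D1 h)" "Ck2 n (D2 h)" using cinf2_D1[OF h] cinf2_D2[OF h] by (simp_all only: cinf_def)
      note v = Ck2_vstar[OF hn Suc.IH] Ck2_vstar[OF Suc.IH hn]
      have "Ck n (I \<times> I) (\<lambda>p. pr (h (fst p) (fst p)) (vstar ?K h (fst p) (snd p)))"
        "Ck n (I \<times> I) (\<lambda>p. pr (vstar h ?K (fst p) (snd p)) (h (snd p) (snd p)))"
        by (intro Ck_bilinear[OF bounded_bilinear_axioms] Ck2_compose[OF v(1)] Ck2_compose[OF v(2)] Ck2_compose[OF hn] Ck_fst Ck_snd; auto)+
      then show "Ck2 n (\<lambda>x y. pr (h x x) (vstar ?K h x y) + vstar (D1 h) (vstar ?K h) x y)"
        "Ck2 n (\<lambda>x y. vstar (vstar h ?K) (D2 h) x y - pr (vstar h ?K x y) (h y y))"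
        using Ck2_vstar[OF d(1) v(2)] Ck2_vstar[OF v(1) d(2)]
        by (simp_all add: split_beta' Ck_add Ck_diff del: Ck.simps)
    qed (rule convex_I)
    then show ?thesis
      using hn[of "Suc n"] Ck2_vstar[OF hn hn, of "Suc n"]
      by (simp add: split_beta' Ck_add del: Ck.simps)
  qed
  ultimately show ?case
    by (subst Ck_cong[where g = "\<lambda>(x, y). h x y + vstar h h x y + G x y"]) auto
qed

lemma resolvent_exists:
  "\<exists>k. cinf2 k \<and> (\<forall>x\<in>I. \<forall>y\<in>I. k x y = h x y + vstar h k x y \<and> k x y = h x y + vstar k h x y)"
  unfolding cinf_def by (intro exI[of _ resolvent] conjI allI ballI Ck2_resolvent resolvent_eq)

end

end

section \<open>Operators on test functions\<close>

sublocale nondegenerate_interval \<subseteq> cm: volterra_product I "(*) :: complex \<Rightarrow> complex \<Rightarrow> complex"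
  by (intro_locales, rule bounded_bilinear_mult) (unfold_locales, simp add: mult.assoc)

lemma sum_fun_apply: "(\<Sum>i\<in>F. f i) x = (\<Sum>i\<in>F. f i x)"
  by (induction F rule: infinite_finite_induct) auto

context nondegenerate_interval
begin

text \<open>The test functions, made unique by the value \<open>0\<close> outside \<open>I\<close>, so that operators can be
  compared by equality of functions.\<close>

definition TF :: "(real \<Rightarrow> complex) set" where
  "TF = {\<phi>. cinf I \<phi> \<and> (\<exists>a\<in>interior I. \<forall>t\<in>I. t \<le> a \<longrightarrow> \<phi> t = 0) \<and> (\<forall>t. t \<notin> I \<longrightarrow> \<phi> t = 0)}"

definition rs :: "(real \<Rightarrow> complex) \<Rightarrow> real \<Rightarrow> complex" where
  "rs \<phi> t = (if t \<in> I then \<phi> t else 0)"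

lemma TF_cinf: "\<phi> \<in> TF \<Longrightarrow> cinf I \<phi>"
  and TF_outside: "\<phi> \<in> TF \<Longrightarrow> t \<notin> I \<Longrightarrow> \<phi> t = 0"
  by (simp_all add: TF_def)

lemma TF_vanish:
  assumes "\<phi> \<in> TF"
  obtains a where "a \<in> interior I" "a \<in> I" "\<And>t. t \<in> I \<Longrightarrow> t \<le> a \<Longrightarrow> \<phi> t = 0"
  using assms interior_subset[of I] by (auto simp: TF_def)

lemma TF_continuous: "\<phi> \<in> TF \<Longrightarrow> continuous_on I \<phi>"
  by (rule cinf_continuous_on[OF TF_cinf])

lemma TF_I:
  assumes "cinf I \<phi>" "a \<in> interior I" "\<And>t. t \<in> I \<Longrightarrow> t \<le> a \<Longrightarrow> \<phi> t = 0" "\<And>t. t \<notin> I \<Longrightarrow> \<phi> t = 0"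
  shows "\<phi> \<in> TF"
  using assms unfolding TF_def by blast

lemma TF_vanish2:
  assumes "\<phi> \<in> TF" "\<psi> \<in> TF"
  obtains a where "a \<in> interior I" "a \<in> I"
    "\<And>t. t \<in> I \<Longrightarrow> t \<le> a \<Longrightarrow> \<phi> t = 0" "\<And>t. t \<in> I \<Longrightarrow> t \<le> a \<Longrightarrow> \<psi> t = 0"
proof -
  obtain a where a: "a \<in> interior I" "a \<in> I" "\<And>t. t \<in> I \<Longrightarrow> t \<le> a \<Longrightarrow> \<phi> t = 0"
    using TF_vanish[OF assms(1)] by blast
  obtain b where b: "b \<in> interior I" "b \<in> I" "\<And>t. t \<in> I \<Longrightarrow> t \<le> b \<Longrightarrow> \<psi> t = 0"
    using TF_vanish[OF assms(2)] by blast
  show ?thesis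
  proof (rule that[of "min a b"])
    show "min a b \<in> interior I" "min a b \<in> I" using a b by (simp_all add: min_def)
    show "\<phi> t = 0" "\<psi> t = 0" if "t \<in> I" "t \<le> min a b" for t
      using that a(3) b(3) by simp_all
  qed
qed

lemma TF_add:
  assumes "\<phi> \<in> TF" "\<psi> \<in> TF"
  shows "\<phi> + \<psi> \<in> TF"
proof -
  note p = assms
  obtain a where "a \<in> interior I" "a \<in> I"
    "\<And>t. t \<in> I \<Longrightarrow> t \<le> a \<Longrightarrow> \<phi> t = 0" "\<And>t. t \<in> I \<Longrightarrow> t \<le> a \<Longrightarrow> \<psi> t = 0"
    using TF_vanish2[OF p] by blast
  then show ?thesis
    using p by (intro TF_I[of _ a]) (auto simp: plus_fun_def TF_outside intro: cinf_add TF_cinf)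
qed

lemma TF_mult:
  assumes c: "cinf I c" and p: "\<phi> \<in> TF"
  shows "(\<lambda>t. c t * \<phi> t) \<in> TF"
proof -
  obtain a where "a \<in> interior I" "a \<in> I" "\<And>t. t \<in> I \<Longrightarrow> t \<le> a \<Longrightarrow> \<phi> t = 0"
    using TF_vanish[OF p] by blast
  then show ?thesis
    using p by (intro TF_I[of _ a]) (auto simp: TF_outside intro: cinf_mult TF_cinf c)
qed

lemmas TF_cmult = TF_mult[OF cinf_const]

lemma TF_zero: "0 \<in> TF"
proof -
  obtain a where "a \<in> interior I" using int_ne by blast
  then show ?thesis by (rule TF_I[rotated]) (auto simp: zero_fun_def cinf_const)
qed

lemma TF_uminus: "\<phi> \<in> TF \<Longrightarrow> - \<phi> \<in> TF"
  using TF_cmult[of \<phi> "- 1"] by (simp add: fun_Compl_def)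

lemma TF_diff: "\<phi> \<in> TF \<Longrightarrow> \<psi> \<in> TF \<Longrightarrow> \<phi> - \<psi> \<in> TF"
  using TF_add[OF _ TF_uminus, of \<phi> \<psi>] by simp

lemma TF_sum: "(\<And>i. i \<in> F \<Longrightarrow> f i \<in> TF) \<Longrightarrow> (\<Sum>i\<in>F. f i) \<in> TF"
  by (induction F rule: infinite_finite_induct) (auto intro: TF_zero TF_add)

lemma TF_eqI:
  assumes "\<phi> \<in> TF" "\<psi> \<in> TF" "\<And>t. t \<in> I \<Longrightarrow> \<phi> t = \<psi> t"
  shows "\<phi> = \<psi>"
proof
  fix t show "\<phi> t = \<psi> t"
    using assms(3) TF_outside[OF assms(1)] TF_outside[OF assms(2)] by (cases "t \<in> I") auto
qed

section \<open>Linear operators, differentiation and Volterra operators of the first kind\<close>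

definition opr :: "((real \<Rightarrow> complex) \<Rightarrow> real \<Rightarrow> complex) \<Rightarrow> bool" where
  "opr X \<longleftrightarrow> (\<forall>\<phi>\<in>TF. X \<phi> \<in> TF) \<and> (\<forall>\<phi>\<in>TF. \<forall>\<psi>\<in>TF. X (\<phi> + \<psi>) = X \<phi> + X \<psi>) \<and>
     (\<forall>z. \<forall>\<phi>\<in>TF. X (\<lambda>t. z * \<phi> t) = (\<lambda>t. z * X \<phi> t))"

lemma opr_TF: "opr X \<Longrightarrow> \<phi> \<in> TF \<Longrightarrow> X \<phi> \<in> TF"
  and opr_add: "opr X \<Longrightarrow> \<phi> \<in> TF \<Longrightarrow> \<psi> \<in> TF \<Longrightarrow> X (\<phi> + \<psi>) = X \<phi> + X \<psi>"
  and opr_cmult: "opr X \<Longrightarrow> \<phi> \<in> TF \<Longrightarrow> X (\<lambda>t. z * \<phi> t) = (\<lambda>t. z * X \<phi> t)"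
  by (simp_all add: opr_def)

lemma opr_zero: "opr X \<Longrightarrow> X 0 = 0"
  using opr_cmult[of X 0 0] TF_zero by (simp add: zero_fun_def)

lemma opr_uminus: "opr X \<Longrightarrow> \<phi> \<in> TF \<Longrightarrow> X (- \<phi>) = - X \<phi>"
  using opr_cmult[of X \<phi> "- 1"] by (simp add: fun_Compl_def)

lemma opr_diff: "opr X \<Longrightarrow> \<phi> \<in> TF \<Longrightarrow> \<psi> \<in> TF \<Longrightarrow> X (\<phi> - \<psi>) = X \<phi> - X \<psi>"
  using opr_add[OF _ _ TF_uminus, of X \<phi> \<psi>] opr_uminus[of X \<psi>] by simp

lemma opr_sum:
  assumes "opr X" "\<And>i. i \<in> F \<Longrightarrow> f i \<in> TF"
  shows "X (\<Sum>i\<in>F. f i) = (\<Sum>i\<in>F. X (f i))"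
  using assms(2)
  by (induction F rule: infinite_finite_induct) (auto simp: opr_zero[OF assms(1)] opr_add[OF assms(1)] TF_sum)

lemma opr_comp: "opr X \<Longrightarrow> opr Y \<Longrightarrow> opr (\<lambda>\<phi>. X (Y \<phi>))"
  by (simp add: opr_def)

definition dv :: "(real \<Rightarrow> complex) \<Rightarrow> real \<Rightarrow> complex" where
  "dv \<phi> = rs (DI \<phi>)"

definition Vol :: "(real \<Rightarrow> real \<Rightarrow> complex) \<Rightarrow> (real \<Rightarrow> complex) \<Rightarrow> real \<Rightarrow> complex" where
  "Vol h \<phi> = rs (\<lambda>t. fun_kernel I (times_theta h) t \<phi>)"

abbreviation Jop :: "(real \<Rightarrow> complex) \<Rightarrow> real \<Rightarrow> complex" where
  "Jop \<equiv> Vol (\<lambda>_ _. 1)"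

lemma dv_apply: "t \<in> I \<Longrightarrow> dv \<phi> t = DI \<phi> t"
  by (simp add: dv_def rs_def)

lemma dv_TF:
  assumes "\<phi> \<in> TF"
  shows "dv \<phi> \<in> TF"
proof -
  obtain a where a: "a \<in> interior I" "a \<in> I" "\<And>t. t \<in> I \<Longrightarrow> t \<le> a \<Longrightarrow> \<phi> t = 0"
    using TF_vanish[OF assms] by blast
  obtain e where e: "e > 0" "ball a e \<subseteq> interior I"
    using a(1) open_interior openE by blast
  show ?thesis
  \<comment> \<open>Retreating from \<open>a\<close> by \<open>e / 2\<close> gives every remaining
    \<open>t\<close> a neighbourhood in which \<open>\<phi>\<close> vanishes; that \<open>a\<close>
    is an interior point leaves room for this.\<close>
  proof (rule TF_I[where a = "a - e / 2"])
    show "cinf I (dv \<phi>)"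
      using cinf_DI[OF TF_cinf[OF assms]] by (rule cinf_cong[THEN iffD1, rotated]) (simp add: dv_apply)
    show "a - e / 2 \<in> interior I" using e by (auto simp: subset_iff dist_real_def)
    fix t assume t: "t \<in> I" "t \<le> a - e / 2"
    have "((\<lambda>_. 0) has_vector_derivative 0) (at t within I)" by simp
    then have "(\<phi> has_vector_derivative 0) (at t within I)"
    proof (rule has_vector_derivative_transform_within[where d = "e / 2"])
      fix s assume "s \<in> I" "dist s t < e / 2"
      then show "0 = \<phi> s" using a(3)[of s] t abs_ge_self[of "s - t"] by (force simp: dist_real_def)
    qed (use t e in auto)
    then show "dv \<phi> t = 0" using DI_eq[OF t(1)] by (simp add: dv_apply[OF t(1)])
  qed (simp add: dv_def rs_def)
qed

lemma dv_opr: "opr dv"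
  unfolding opr_def
proof (intro conjI ballI allI)
  fix \<phi> \<psi> assume p: "\<phi> \<in> TF" "\<psi> \<in> TF"
  show "dv (\<phi> + \<psi>) = dv \<phi> + dv \<psi>"
  proof (rule TF_eqI)
    fix t assume t: "t \<in> I"
    have "(\<phi> + \<psi> has_vector_derivative DI \<phi> t + DI \<psi> t) (at t within I)"
      unfolding plus_fun_def
      by (intro has_vector_derivative_add DI_has_vector_derivative TF_cinf p t)
    from DI_eq[OF t this] show "dv (\<phi> + \<psi>) t = (dv \<phi> + dv \<psi>) t" by (simp add: dv_apply[OF t])
  qed (intro dv_TF TF_add p)+
next
  fix z \<phi> assume p: "\<phi> \<in> TF"
  show "dv (\<lambda>t. z * \<phi> t) = (\<lambda>t. z * dv \<phi> t)"
  proof (rule TF_eqI)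
    fix t assume t: "t \<in> I"
    have "((\<lambda>t. z * \<phi> t) has_vector_derivative z * DI \<phi> t) (at t within I)"
      by (intro has_vector_derivative_mult_right DI_has_vector_derivative TF_cinf p t)
    from DI_eq[OF t this] show "dv (\<lambda>t. z * \<phi> t) t = z * dv \<phi> t" by (simp add: dv_apply[OF t])
  qed (intro dv_TF TF_cmult p)+
qed (rule dv_TF)

lemma Vol_outside: "t \<notin> I \<Longrightarrow> Vol h \<phi> t = 0"
  by (simp add: Vol_def rs_def)

lemma sint_vanish:
  assumes "a \<in> I" "t \<in> I" "t \<le> a" "\<And>t. t \<in> I \<Longrightarrow> t \<le> a \<Longrightarrow> f t = 0"
  shows "sint a t f = 0"
proof -
  have z: "f (a + u * (t - a)) = 0" if "u \<in> {0..1}" for u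
    using segment_point[OF iv assms(1,2) that] that assms(3)
    by (intro assms(4)) (auto intro: mult_nonneg_nonpos)
  have "integral {0..1} (\<lambda>u. f (a + u * (t - a))) = integral {0..1} (\<lambda>u::real. 0)"
    by (rule Henstock_Kurzweil_Integration.integral_cong) (rule z)
  then show ?thesis by (simp add: sint_def)
qed

text \<open>The test function cuts the integral off below at \<open>a\<close>, the Heaviside factor
  above at \<open>t\<close>; for \<open>t < a\<close> both sides are zero. This replaces a
  discontinuous integrand by an oriented integral of a smooth one.\<close>

lemma Vol_eq_sint:
  assumes p: "\<phi> \<in> TF" and h: "cinf2 h" and a: "a \<in> I" "\<And>t. t \<in> I \<Longrightarrow> t \<le> a \<Longrightarrow> \<phi> t = 0" and t: "t \<in> I"
  shows "Vol h \<phi> t = sint a t (\<lambda>s. h t s * \<phi> s)"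
proof (cases "a \<le> t")
  case True
  have c: "continuous_on I (\<lambda>s. h t s * \<phi> s)"
    by (intro continuous_on_mult TF_continuous[OF p] cinf_continuous_on[OF cinf_section2[OF h t]])
  have "integral I (\<lambda>s. times_theta h t s * \<phi> s) = integral I (\<lambda>s. if s \<in> {a..t} then h t s * \<phi> s else 0)"
    using a by (intro integral_cong) (auto simp: times_theta_def heaviside_def)
  also have "\<dots> = integral {a..t} (\<lambda>s. h t s * \<phi> s)"
    using interval_subset[OF a(1) t] by (simp only: integral_restrict_Int Int_absorb2)
  also have "\<dots> = sint a t (\<lambda>s. h t s * \<phi> s)"
    using sint_eq_integral[OF c a(1) t True] by simp
  finally show ?thesis using t by (simp add: Vol_def rs_def fun_kernel_def)
next
  case False
  have "integral I (\<lambda>s. times_theta h t s * \<phi> s) = integral I (\<lambda>s. 0)"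
    using a False by (intro integral_cong) (auto simp: times_theta_def heaviside_def)
  moreover have "sint a t (\<lambda>s. h t s * \<phi> s) = 0"
    by (rule sint_vanish) (use a t False in auto)
  ultimately show ?thesis using t by (simp add: Vol_def rs_def fun_kernel_def)
qed

lemma cinf2_fun1: "cinf I c \<Longrightarrow> cinf2 (\<lambda>x y. c x)" and cinf2_fun2: "cinf I c \<Longrightarrow> cinf2 (\<lambda>x y. c y)"
  by (rule cinf_curry1 cinf_curry2, assumption)+

lemma cinf2_const: "cinf2 (\<lambda>_ _. c)"
  by (simp add: split_beta' cinf_const)

lemma cinf2_add: "cinf2 f \<Longrightarrow> cinf2 g \<Longrightarrow> cinf2 (\<lambda>x y. f x y + g x y)"
  and cinf2_minus: "cinf2 f \<Longrightarrow> cinf2 (\<lambda>x y. - f x y)"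
  by (simp_all add: split_beta' cinf_add cinf_minus)

lemma cinf2_mult:
  fixes f g :: "real \<Rightarrow> real \<Rightarrow> complex"
  shows "cinf2 f \<Longrightarrow> cinf2 g \<Longrightarrow> cinf2 (\<lambda>x y. f x y * g x y)"
  by (simp add: split_beta' cinf_mult)

lemma cinf2_sum: "(\<And>i. i \<in> F \<Longrightarrow> cinf2 (f i)) \<Longrightarrow> cinf2 (\<lambda>x y. \<Sum>i\<in>F. f i x y)"
  by (simp add: split_beta' cinf_sum)

lemma cinf2_vstar: "cinf2 h \<Longrightarrow> cinf2 k \<Longrightarrow> cinf2 (cm.vstar h k)"
  using cm.Ck2_vstar unfolding cinf_def by blast

lemma cinf2_Ck0: "cinf2 h \<Longrightarrow> Ck 0 (I \<times> I) (\<lambda>(x, y). h x y)"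
  by (simp only: cinf_def)

text \<open>Reading \<open>\<phi>\<close> as a kernel that is constant in its right variable turns
  the action on test functions into a \<open>*\<close>-product, so associativity, additivity and the
  derivative rule of \<open>vstar\<close> carry over to operators.\<close>

lemma Vol_eq_vstar:
  assumes "\<phi> \<in> TF" "cinf2 h" "a \<in> I" "\<And>t. t \<in> I \<Longrightarrow> t \<le> a \<Longrightarrow> \<phi> t = 0" "t \<in> I"
  shows "Vol h \<phi> t = cm.vstar h (\<lambda>s _. \<phi> s) t a"
  using Vol_eq_sint[OF assms] by (simp add: cm.vstar_def)

lemma Vol_TF:
  assumes h: "cinf2 h" and p: "\<phi> \<in> TF"
  shows "Vol h \<phi> \<in> TF"
proof -
  obtain a where a: "a \<in> interior I" "a \<in> I" "\<And>t. t \<in> I \<Longrightarrow> t \<le> a \<Longrightarrow> \<phi> t = 0"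
    using TF_vanish[OF p] by blast
  note e = Vol_eq_vstar[OF p h a(2,3)]
  show ?thesis
  proof (rule TF_I[OF _ a(1)])
    have "cinf I (\<lambda>t. cm.vstar h (\<lambda>s _. \<phi> s) t a)"
      by (rule cinf_section1[OF cinf2_vstar[OF h cinf2_fun1[OF TF_cinf[OF p]]] a(2)])
    then show "cinf I (Vol h \<phi>)" by (rule cinf_cong[THEN iffD1, rotated]) (simp add: e)
    show "Vol h \<phi> t = 0" if "t \<in> I" "t \<le> a" for t
      using sint_vanish[OF a(2) that, of "\<lambda>s. h t s * \<phi> s"] a(3) Vol_eq_sint[OF p h a(2,3) that(1)] by simp
  qed (simp add: Vol_outside)
qed

lemma Vol_cong:
  assumes "\<And>x y. x \<in> I \<Longrightarrow> y \<in> I \<Longrightarrow> h x y = k x y"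
  shows "Vol h \<phi> = Vol k \<phi>"
proof -
  have "integral I (\<lambda>s. times_theta h t s * \<phi> s) = integral I (\<lambda>s. times_theta k t s * \<phi> s)" if "t \<in> I" for t
    using assms that by (intro integral_cong) (auto simp: times_theta_def)
  then show ?thesis by (simp add: Vol_def rs_def fun_kernel_def fun_eq_iff)
qed

lemma Vol_add:
  assumes h: "cinf2 h" and k: "cinf2 k" and p: "\<phi> \<in> TF"
  shows "Vol (\<lambda>x y. h x y + k x y) \<phi> = Vol h \<phi> + Vol k \<phi>"
proof (rule TF_eqI)
  obtain a where a: "a \<in> interior I" "a \<in> I" "\<And>t. t \<in> I \<Longrightarrow> t \<le> a \<Longrightarrow> \<phi> t = 0"
    using TF_vanish[OF p] by blast
  fix t assume t: "t \<in> I"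
  show "Vol (\<lambda>x y. h x y + k x y) \<phi> t = (Vol h \<phi> + Vol k \<phi>) t"
    using cm.vstar_add_left[OF _ cinf2_Ck0[OF h] cinf2_Ck0[OF k] t a(2), of "\<lambda>s _. \<phi> s"]
      cinf2_Ck0[OF cinf2_fun1[OF TF_cinf[OF p]]]
    by (simp add: Vol_eq_vstar[OF p _ a(2,3) t] h k cinf2_add del: Ck.simps)
qed (intro Vol_TF TF_add cinf2_add h k p)+

lemma Vol_opr:
  assumes h: "cinf2 h"
  shows "opr (Vol h)"
  unfolding opr_def
proof (intro conjI ballI allI)
  fix \<phi> \<psi> assume p: "\<phi> \<in> TF" "\<psi> \<in> TF"
  obtain a where a: "a \<in> interior I" "a \<in> I"
    "\<And>t. t \<in> I \<Longrightarrow> t \<le> a \<Longrightarrow> \<phi> t = 0" "\<And>t. t \<in> I \<Longrightarrow> t \<le> a \<Longrightarrow> \<psi> t = 0"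
    using TF_vanish2[OF p] by blast
  show "Vol h (\<phi> + \<psi>) = Vol h \<phi> + Vol h \<psi>"
  proof (rule TF_eqI)
    fix t assume t: "t \<in> I"
    show "Vol h (\<phi> + \<psi>) t = (Vol h \<phi> + Vol h \<psi>) t"
      using cm.vstar_add_right[OF cinf2_Ck0[OF h] cinf2_Ck0[OF cinf2_fun1[OF TF_cinf[OF p(1)]]]
          cinf2_Ck0[OF cinf2_fun1[OF TF_cinf[OF p(2)]]] t a(2)]
        Vol_eq_vstar[OF p(1) h a(2,3) t] Vol_eq_vstar[OF p(2) h a(2,4) t]
        Vol_eq_vstar[OF TF_add[OF p] h a(2) _ t] a(3,4)
      by simp
  qed (intro Vol_TF TF_add h p)+
next
  fix z \<phi> assume p: "\<phi> \<in> TF"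
  obtain a where a: "a \<in> interior I" "a \<in> I" "\<And>t. t \<in> I \<Longrightarrow> t \<le> a \<Longrightarrow> \<phi> t = 0"
    using TF_vanish[OF p] by blast
  show "Vol h (\<lambda>t. z * \<phi> t) = (\<lambda>t. z * Vol h \<phi> t)"
  proof (rule TF_eqI)
    fix t assume t: "t \<in> I"
    have c: "continuous_on I (\<lambda>s. h t s * \<phi> s)"
      by (intro continuous_on_mult TF_continuous[OF p] cinf_continuous_on[OF cinf_section2[OF h t]])
    have "sint a t (\<lambda>s. z * (h t s * \<phi> s)) = z * sint a t (\<lambda>s. h t s * \<phi> s)"
      by (rule sint_linear[OF bounded_linear_mult_right c a(2) t])
    then show "Vol h (\<lambda>t. z * \<phi> t) t = z * Vol h \<phi> t"
      using Vol_eq_sint[OF p h a(2,3) t] Vol_eq_sint[OF TF_cmult[OF p] h a(2) _ t, of z] a(3)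
      by (simp add: mult.left_commute)
  qed (intro Vol_TF TF_cmult h p)+
qed (rule Vol_TF[OF h])

lemma Vol_mult_left:
  assumes c: "cinf I c" and h: "cinf2 h" and p: "\<phi> \<in> TF"
  shows "(\<lambda>t. c t * Vol h \<phi> t) = Vol (\<lambda>x y. c x * h x y) \<phi>"
proof (rule TF_eqI)
  obtain a where a: "a \<in> interior I" "a \<in> I" "\<And>t. t \<in> I \<Longrightarrow> t \<le> a \<Longrightarrow> \<phi> t = 0"
    using TF_vanish[OF p] by blast
  have ch: "cinf2 (\<lambda>x y. c x * h x y)" by (intro cinf2_mult cinf2_fun1 c h)
  then show "Vol (\<lambda>x y. c x * h x y) \<phi> \<in> TF" using p by (rule Vol_TF)
  fix t assume t: "t \<in> I"
  have co: "continuous_on I (\<lambda>s. h t s * \<phi> s)"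
    by (intro continuous_on_mult TF_continuous[OF p] cinf_continuous_on[OF cinf_section2[OF h t]])
  show "c t * Vol h \<phi> t = Vol (\<lambda>x y. c x * h x y) \<phi> t"
    using sint_linear[OF bounded_linear_mult_right co a(2) t, of "c t"]
    by (simp add: Vol_eq_sint[OF p h a(2,3) t] Vol_eq_sint[OF p ch a(2,3) t] mult.assoc)
qed (intro TF_mult Vol_TF c h p)

lemma Vol_mult_right:
  assumes c: "cinf I c" and h: "cinf2 h" and p: "\<phi> \<in> TF"
  shows "Vol h (\<lambda>t. c t * \<phi> t) = Vol (\<lambda>x y. h x y * c y) \<phi>"
  by (simp add: Vol_def fun_kernel_def times_theta_def mult_ac)

lemma Vol_comp:
  assumes h: "cinf2 h" and k: "cinf2 k" and p: "\<phi> \<in> TF"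
  shows "Vol h (Vol k \<phi>) = Vol (cm.vstar h k) \<phi>"
proof (rule TF_eqI)
  obtain a where a: "a \<in> interior I" "a \<in> I" "\<And>t. t \<in> I \<Longrightarrow> t \<le> a \<Longrightarrow> \<phi> t = 0"
    using TF_vanish[OF p] by blast
  have va: "Vol k \<phi> t = 0" if "t \<in> I" "t \<le> a" for t
    using sint_vanish[OF a(2) that, of "\<lambda>s. k t s * \<phi> s"] a(3) Vol_eq_sint[OF p k a(2,3) that(1)] by simp
  fix t assume t: "t \<in> I"
  have "Vol h (Vol k \<phi>) t = sint a t (\<lambda>s. h t s * Vol k \<phi> s)"
    by (rule Vol_eq_sint[OF Vol_TF[OF k p] h a(2) va t])
  also have "\<dots> = cm.vstar h (cm.vstar k (\<lambda>s _. \<phi> s)) t a"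
    unfolding cm.vstar_def[of h] by (rule sint_cong) (use a t in \<open>simp_all add: Vol_eq_vstar[OF p k a(2,3)]\<close>)
  also have "\<dots> = cm.vstar (cm.vstar h k) (\<lambda>s _. \<phi> s) t a"
    by (rule cm.vstar_assoc[OF cinf2_Ck0[OF h] cinf2_Ck0[OF k] cinf2_Ck0[OF cinf2_fun1[OF TF_cinf[OF p]]] t a(2)])
  also have "\<dots> = Vol (cm.vstar h k) \<phi> t"
    by (rule Vol_eq_vstar[OF p cinf2_vstar[OF h k] a(2,3) t, symmetric])
  finally show "Vol h (Vol k \<phi>) t = Vol (cm.vstar h k) \<phi> t" .
qed (intro Vol_TF cinf2_vstar h k p)+

lemma dv_Vol:
  assumes h: "cinf2 h" and p: "\<phi> \<in> TF"
  shows "dv (Vol h \<phi>) = (\<lambda>t. h t t * \<phi> t) + Vol (D1 h) \<phi>"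
proof (rule TF_eqI)
  obtain a where a: "a \<in> interior I" "a \<in> I" "\<And>t. t \<in> I \<Longrightarrow> t \<le> a \<Longrightarrow> \<phi> t = 0"
    using TF_vanish[OF p] by blast
  fix t assume t: "t \<in> I"
  have "((\<lambda>t. cm.vstar h (\<lambda>s _. \<phi> s) t a) has_vector_derivative
      h t t * \<phi> t + cm.vstar (D1 h) (\<lambda>s _. \<phi> s) t a) (at t within I)"
    by (rule cm.vstar_D1[OF h cinf2_Ck0[OF cinf2_fun1[OF TF_cinf[OF p]]] t a(2)])
  then have "(Vol h \<phi> has_vector_derivative h t t * \<phi> t + cm.vstar (D1 h) (\<lambda>s _. \<phi> s) t a) (at t within I)"
    by (rule has_vector_derivative_transform[rotated 2]) (use t in \<open>simp_all add: Vol_eq_vstar[OF p h a(2,3)]\<close>)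
  then have e1: "dv (Vol h \<phi>) t = h t t * \<phi> t + cm.vstar (D1 h) (\<lambda>s _. \<phi> s) t a"
    unfolding dv_apply[OF t] by (rule DI_eq[OF t])
  have e2: "Vol (D1 h) \<phi> t = cm.vstar (D1 h) (\<lambda>s _. \<phi> s) t a"
    by (rule Vol_eq_vstar[OF p cinf2_D1[OF h] a(2) _ t]) (rule a(3))
  show "dv (Vol h \<phi>) t = ((\<lambda>t. h t t * \<phi> t) + Vol (D1 h) \<phi>) t"
    unfolding plus_fun_apply e1 e2 ..
qed (intro dv_TF TF_add Vol_TF TF_mult[OF cinf_diag[OF h]] cinf2_D1 h p)+

text \<open>Integration by parts. The boundary term at the lower limit drops out because
  \<open>\<phi>\<close> vanishes there; \<open>a\<close> is chosen to serve both
  \<open>\<phi>\<close> and its derivative.\<close>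

lemma Vol_dv:
  assumes h: "cinf2 h" and p: "\<phi> \<in> TF"
  shows "Vol h (dv \<phi>) = (\<lambda>t. h t t * \<phi> t) - Vol (D2 h) \<phi>"
proof (rule TF_eqI)
  obtain a where a: "a \<in> interior I" "a \<in> I"
    "\<And>t. t \<in> I \<Longrightarrow> t \<le> a \<Longrightarrow> \<phi> t = 0" "\<And>t. t \<in> I \<Longrightarrow> t \<le> a \<Longrightarrow> dv \<phi> t = 0"
    using TF_vanish2[OF p dv_TF[OF p]] by blast
  fix t assume t: "t \<in> I"
  have c1: "continuous_on I (\<lambda>s. h t s * dv \<phi> s)"
    by (intro continuous_on_mult TF_continuous dv_TF p cinf_continuous_on[OF cinf_section2[OF h t]])
  have c2: "continuous_on I (\<lambda>s. D2 h t s * \<phi> s)"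
    by (intro continuous_on_mult TF_continuous p cinf_continuous_on[OF cinf_section2[OF cinf2_D2[OF h] t]])
  have "sint a t (\<lambda>s. h t s * dv \<phi> s + D2 h t s * \<phi> s) = h t t * \<phi> t - h t a * \<phi> a"
  proof (rule sint_FTC[OF a(2) t])
    fix s assume s: "s \<in> I"
    have "((\<lambda>s. h t s * \<phi> s) has_vector_derivative h t s * DI \<phi> s + D2 h t s * \<phi> s) (at s within I)"
      by (intro has_vector_derivative_mult D2_has_vector_derivative[OF h t s] DI_has_vector_derivative[OF TF_cinf[OF p] s])
    then show "((\<lambda>s. h t s * \<phi> s) has_vector_derivative h t s * dv \<phi> s + D2 h t s * \<phi> s) (at s within I)"
      by (simp add: dv_apply[OF s])
  qed
  then show "Vol h (dv \<phi>) t = ((\<lambda>t. h t t * \<phi> t) - Vol (D2 h) \<phi>) t"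
    using a(2,3) sint_add[OF c1 c2 a(2) t]
    by (simp add: Vol_eq_sint[OF dv_TF[OF p] h a(2,4) t] Vol_eq_sint[OF p cinf2_D2[OF h] a(2,3) t] eq_diff_eq)
qed (intro dv_TF TF_diff Vol_TF TF_mult[OF cinf_diag[OF h]] cinf2_D2 h p)+

lemma D1_const: "t \<in> I \<Longrightarrow> D1 (\<lambda>_ _. c) t s = 0" and D2_const: "s \<in> I \<Longrightarrow> D2 (\<lambda>_ _. c) t s = 0"
  by (rule DI_eq; simp)+

lemma Vol_zero: "Vol (\<lambda>_ _. 0) \<phi> = 0"
  by (simp add: Vol_def fun_kernel_def times_theta_def rs_def fun_eq_iff)

lemma dv_J: "\<phi> \<in> TF \<Longrightarrow> dv (Jop \<phi>) = \<phi>"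
proof -
  assume p: "\<phi> \<in> TF"
  have "Vol (D1 (\<lambda>_ _. 1)) \<phi> = Vol (\<lambda>_ _. 0) \<phi>" by (rule Vol_cong) (simp add: D1_const)
  then show "dv (Jop \<phi>) = \<phi>" using dv_Vol[OF cinf2_const p, of 1] by (simp add: Vol_zero fun_eq_iff)
qed

lemma J_dv: "\<phi> \<in> TF \<Longrightarrow> Jop (dv \<phi>) = \<phi>"
proof -
  assume p: "\<phi> \<in> TF"
  have "Vol (D2 (\<lambda>_ _. 1)) \<phi> = Vol (\<lambda>_ _. 0) \<phi>" by (rule Vol_cong) (simp add: D2_const)
  then show "Jop (dv \<phi>) = \<phi>" using Vol_dv[OF cinf2_const p, of 1] by (simp add: Vol_zero fun_eq_iff)
qed

section \<open>Operators of integer order and their symbols\<close>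

lemma opr_cong:
  assumes "opr Y" "\<And>\<phi>. \<phi> \<in> TF \<Longrightarrow> X \<phi> = Y \<phi>"
  shows "opr X"
  using assms by (simp add: opr_def TF_add TF_cmult)

lemma opr_plus: "opr X \<Longrightarrow> opr Y \<Longrightarrow> opr (\<lambda>\<phi>. X \<phi> + Y \<phi>)"
  by (simp add: opr_def TF_add fun_eq_iff algebra_simps)

lemma opr_mult: "cinf I c \<Longrightarrow> opr (\<lambda>\<phi> t. c t * \<phi> t)"
  unfolding opr_def by (simp add: TF_mult fun_eq_iff distrib_left mult.left_commute)

section \<open>Volterra operators of the second kind\<close>

definition volt :: "(real \<Rightarrow> complex) \<Rightarrow> ((real \<Rightarrow> complex) \<Rightarrow> real \<Rightarrow> complex) \<Rightarrow> bool" where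
  "volt c X \<longleftrightarrow> cinf I c \<and> (\<exists>h. cinf2 h \<and> (\<forall>\<phi>\<in>TF. X \<phi> = (\<lambda>t. c t * \<phi> t) + Vol h \<phi>))"

lemma voltI:
  assumes "cinf I c" "cinf2 h" "\<And>\<phi>. \<phi> \<in> TF \<Longrightarrow> X \<phi> = (\<lambda>t. c t * \<phi> t) + Vol h \<phi>"
  shows "volt c X"
  using assms by (auto simp: volt_def)

lemma voltE:
  assumes "volt c X"
  obtains h where "cinf I c" "cinf2 h" "\<And>\<phi>. \<phi> \<in> TF \<Longrightarrow> X \<phi> = (\<lambda>t. c t * \<phi> t) + Vol h \<phi>"
  using assms by (auto simp: volt_def)

lemma volt_opr: "volt c X \<Longrightarrow> opr X"
  by (erule voltE, erule opr_cong[rotated]) (intro opr_plus opr_mult Vol_opr)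

lemma volt_cong:
  assumes "volt d Y" "\<And>\<phi>. \<phi> \<in> TF \<Longrightarrow> X \<phi> = Y \<phi>" "\<And>t. t \<in> I \<Longrightarrow> c t = d t"
  shows "volt c X"
proof -
  obtain h where h: "cinf I d" "cinf2 h" "\<And>\<phi>. \<phi> \<in> TF \<Longrightarrow> Y \<phi> = (\<lambda>t. d t * \<phi> t) + Vol h \<phi>"
    using voltE[OF assms(1)] by blast
  have "(\<lambda>t. d t * \<phi> t) = (\<lambda>t. c t * \<phi> t)" if "\<phi> \<in> TF" for \<phi>
    using TF_outside[OF that] assms(3) by (metis mult_zero_right)
  then show ?thesis
    using h assms(2) cinf_cong[of I c d, OF assms(3)] by (intro voltI[of c h]) auto
qed

lemma volt_mult: "cinf I c \<Longrightarrow> volt c (\<lambda>\<phi> t. c t * \<phi> t)"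
  by (rule voltI[of _ "\<lambda>_ _. 0"]) (auto simp: Vol_zero cinf2_const)

lemma volt_Vol: "cinf2 h \<Longrightarrow> volt (\<lambda>_. 0) (Vol h)"
  by (rule voltI[of _ h]) (auto simp: cinf_const fun_eq_iff)

lemma volt_id: "volt (\<lambda>_. 1) (\<lambda>\<phi>. \<phi>)"
  by (rule voltI[of _ "\<lambda>_ _. 0"]) (auto simp: Vol_zero cinf2_const cinf_const)

lemma volt_add:
  assumes "volt c X" "volt d Y"
  shows "volt (\<lambda>t. c t + d t) (\<lambda>\<phi>. X \<phi> + Y \<phi>)"
proof -
  obtain h where h: "cinf I c" "cinf2 h" "\<And>\<phi>. \<phi> \<in> TF \<Longrightarrow> X \<phi> = (\<lambda>t. c t * \<phi> t) + Vol h \<phi>"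
    using voltE[OF assms(1)] by blast
  obtain k where k: "cinf I d" "cinf2 k" "\<And>\<phi>. \<phi> \<in> TF \<Longrightarrow> Y \<phi> = (\<lambda>t. d t * \<phi> t) + Vol k \<phi>"
    using voltE[OF assms(2)] by blast
  show ?thesis
    by (rule voltI[of _ "\<lambda>x y. h x y + k x y"])
      (auto simp: h k Vol_add cinf_add cinf2_add fun_eq_iff algebra_simps)
qed

lemma volt_comp:
  assumes "volt c X" "volt d Y"
  shows "volt (\<lambda>t. c t * d t) (\<lambda>\<phi>. X (Y \<phi>))"
proof -
  obtain h where h: "cinf I c" "cinf2 h" "\<And>\<phi>. \<phi> \<in> TF \<Longrightarrow> X \<phi> = (\<lambda>t. c t * \<phi> t) + Vol h \<phi>"
    using voltE[OF assms(1)] by blast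
  obtain k where k: "cinf I d" "cinf2 k" "\<And>\<phi>. \<phi> \<in> TF \<Longrightarrow> Y \<phi> = (\<lambda>t. d t * \<phi> t) + Vol k \<phi>"
    using voltE[OF assms(2)] by blast
  have k1: "cinf2 (\<lambda>x y. c x * k x y)" and k2: "cinf2 (\<lambda>x y. h x y * d y)" and k3: "cinf2 (cm.vstar h k)"
    by (intro cinf2_mult cinf2_fun1 cinf2_fun2 cinf2_vstar h k)+
  show ?thesis
  \<comment> \<open>Expansion of the product of \<open>c + h\<close> and \<open>d + k\<close>: the
    cross terms and \<open>h * k\<close> are all given by smooth kernels.\<close>
  proof (rule voltI[of _ "\<lambda>x y. c x * k x y + (h x y * d y + cm.vstar h k x y)"])
    fix \<phi> assume p: "\<phi> \<in> TF"
    have "X (Y \<phi>) = (\<lambda>t. c t * Y \<phi> t) + Vol h (Y \<phi>)"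
      by (rule h(3)[OF opr_TF[OF volt_opr[OF assms(2)] p]])
    also have "Vol h (Y \<phi>) = Vol h (\<lambda>t. d t * \<phi> t) + Vol h (Vol k \<phi>)"
      unfolding k(3)[OF p] by (intro opr_add Vol_opr TF_mult Vol_TF h k p)
    also have "\<dots> = Vol (\<lambda>x y. h x y * d y + cm.vstar h k x y) \<phi>"
      by (simp only: Vol_mult_right[OF k(1) h(2) p] Vol_comp[OF h(2) k(2) p] Vol_add[OF k2 k3 p])
    also have "(\<lambda>t. c t * Y \<phi> t) = (\<lambda>t. c t * d t * \<phi> t) + (\<lambda>t. c t * Vol k \<phi> t)"
      unfolding k(3)[OF p] by (simp add: fun_eq_iff algebra_simps)
    also have "(\<lambda>t. c t * Vol k \<phi> t) = Vol (\<lambda>x y. c x * k x y) \<phi>"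
      by (rule Vol_mult_left[OF h(1) k(2) p])
    finally show "X (Y \<phi>) = (\<lambda>t. c t * d t * \<phi> t) + Vol (\<lambda>x y. c x * k x y + (h x y * d y + cm.vstar h k x y)) \<phi>"
      by (simp only: Vol_add[OF k1 cinf2_add[OF k2 k3] p] add.assoc)
  qed (intro cinf_mult cinf2_add h k k1 k2 k3)+
qed

text \<open>After one integration the multiplication by \<open>c\<close> is given by a kernel too,
  namely \<open>c x\<close>, while \<open>h\<close> contributes an integral from \<open>y\<close> to
  \<open>x\<close> that vanishes for \<open>x = y\<close>. Hence the symbol survives as the diagonal
  value.\<close>

lemma volt_J:
  assumes "volt c X"
  obtains g where "cinf2 g" "\<And>t. t \<in> I \<Longrightarrow> g t t = c t" "\<And>\<phi>. \<phi> \<in> TF \<Longrightarrow> X (Jop \<phi>) = Vol g \<phi>"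
proof -
  obtain h where h: "cinf I c" "cinf2 h" "\<And>\<phi>. \<phi> \<in> TF \<Longrightarrow> X \<phi> = (\<lambda>t. c t * \<phi> t) + Vol h \<phi>"
    using voltE[OF assms(1)] by blast
  have k: "cinf2 (\<lambda>x y. c x * 1)" "cinf2 (cm.vstar h (\<lambda>_ _. 1))"
    by (intro cinf2_mult cinf2_fun1 cinf2_const cinf2_vstar h)+
  show ?thesis
  proof (rule that[of "\<lambda>x y. c x * 1 + cm.vstar h (\<lambda>_ _. 1) x y"])
    fix \<phi> assume p: "\<phi> \<in> TF"
    show "X (Jop \<phi>) = Vol (\<lambda>x y. c x * 1 + cm.vstar h (\<lambda>_ _. 1) x y) \<phi>"
      by (simp only: h(3)[OF Vol_TF[OF cinf2_const p]] Vol_mult_left[OF h(1) cinf2_const p]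
          Vol_comp[OF h(2) cinf2_const p] Vol_add[OF k p])
  qed (use k cinf2_add[OF k] in \<open>simp_all add: cm.vstar_def\<close>)
qed

lemma J_volt:
  assumes "volt c X"
  obtains g where "cinf2 g" "\<And>t. t \<in> I \<Longrightarrow> g t t = c t" "\<And>\<phi>. \<phi> \<in> TF \<Longrightarrow> Jop (X \<phi>) = Vol g \<phi>"
proof -
  obtain h where h: "cinf I c" "cinf2 h" "\<And>\<phi>. \<phi> \<in> TF \<Longrightarrow> X \<phi> = (\<lambda>t. c t * \<phi> t) + Vol h \<phi>"
    using voltE[OF assms(1)] by blast
  have k: "cinf2 (\<lambda>x y. 1 * c y)" "cinf2 (cm.vstar (\<lambda>_ _. 1) h)"
    by (intro cinf2_mult cinf2_fun2 cinf2_const cinf2_vstar h)+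
  show ?thesis
  proof (rule that[of "\<lambda>x y. 1 * c y + cm.vstar (\<lambda>_ _. 1) h x y"])
    fix \<phi> assume p: "\<phi> \<in> TF"
    show "Jop (X \<phi>) = Vol (\<lambda>x y. 1 * c y + cm.vstar (\<lambda>_ _. 1) h x y) \<phi>"
      by (simp only: h(3)[OF p] opr_add[OF Vol_opr[OF cinf2_const] TF_mult[OF h(1) p] Vol_TF[OF h(2) p]]
          Vol_mult_right[OF h(1) cinf2_const p] Vol_comp[OF cinf2_const h(2) p] Vol_add[OF k p])
  qed (use k cinf2_add[OF k] in \<open>simp_all add: cm.vstar_def\<close>)
qed

lemma volt_dv_Vol: "cinf2 g \<Longrightarrow> volt (\<lambda>t. g t t) (\<lambda>\<phi>. dv (Vol g \<phi>))"
  by (rule voltI[OF cinf_diag cinf2_D1 dv_Vol])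

lemma volt_Vol_dv:
  assumes g: "cinf2 g"
  shows "volt (\<lambda>t. g t t) (\<lambda>\<phi>. Vol g (dv \<phi>))"
proof (rule voltI[OF cinf_diag[OF g] cinf2_minus[OF cinf2_D2[OF g]]])
  fix \<phi> assume p: "\<phi> \<in> TF"
  have "Vol (\<lambda>x y. - D2 g x y) \<phi> = - Vol (D2 g) \<phi>"
    using Vol_mult_left[OF cinf_const cinf2_D2[OF g] p, of "- 1"] by (simp add: fun_Compl_def)
  then show "Vol g (dv \<phi>) = (\<lambda>t. g t t * \<phi> t) + Vol (\<lambda>x y. - D2 g x y) \<phi>"
    by (simp only: Vol_dv[OF g p] diff_conv_add_uminus)
qed

text \<open>Integration on one side gives a kernel with diagonal \<open>c\<close>, and
  differentiation on the other side turns the diagonal back into the symbol.\<close>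

lemma volt_conj:
  assumes "volt c X"
  shows "volt c (\<lambda>\<phi>. dv (X (Jop \<phi>)))" and "volt c (\<lambda>\<phi>. Jop (X (dv \<phi>)))"
proof -
  obtain g where g: "cinf2 g" "\<And>t. t \<in> I \<Longrightarrow> g t t = c t" "\<And>\<phi>. \<phi> \<in> TF \<Longrightarrow> X (Jop \<phi>) = Vol g \<phi>"
    using volt_J[OF assms] by blast
  show "volt c (\<lambda>\<phi>. dv (X (Jop \<phi>)))"
    by (rule volt_cong[OF volt_dv_Vol[OF g(1)]]) (simp_all add: g)
  obtain g where g: "cinf2 g" "\<And>t. t \<in> I \<Longrightarrow> g t t = c t" "\<And>\<phi>. \<phi> \<in> TF \<Longrightarrow> Jop (X \<phi>) = Vol g \<phi>"
    using J_volt[OF assms] by blast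
  show "volt c (\<lambda>\<phi>. Jop (X (dv \<phi>)))"
    by (rule volt_cong[OF volt_Vol_dv[OF g(1)]]) (simp_all add: g dv_TF)
qed

text \<open>Factor the operator as multiplication by \<open>c\<close> after \<open>1 - h'\<close>,
  where \<open>h' = - h / c\<close>. The two resolvent equations for \<open>h'\<close> say that
  \<open>1 + k\<close> is a right and a left inverse of the second factor.\<close>

lemma volt_inverse:
  assumes "volt c X" and c: "\<And>t. t \<in> I \<Longrightarrow> c t \<noteq> 0"
  shows "\<exists>Y. volt (\<lambda>t. inverse (c t)) Y \<and> (\<forall>\<phi>\<in>TF. X (Y \<phi>) = \<phi> \<and> Y (X \<phi>) = \<phi>)"
proof -
  obtain h where h: "cinf I c" "cinf2 h" "\<And>\<phi>. \<phi> \<in> TF \<Longrightarrow> X \<phi> = (\<lambda>t. c t * \<phi> t) + Vol h \<phi>"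
    using voltE[OF assms(1)] by blast
  let ?i = "\<lambda>t. inverse (c t)"
  have i: "cinf I ?i" by (rule cinf_inverse[OF h(1) c])
  define h' where "h' x y = - (?i x * h x y)" for x y
  have h': "cinf2 h'" unfolding h'_def by (intro cinf2_minus cinf2_mult cinf2_fun1 i h)
  obtain k where k: "cinf2 k" "\<And>x y. x \<in> I \<Longrightarrow> y \<in> I \<Longrightarrow> k x y = h' x y + cm.vstar h' k x y"
    "\<And>x y. x \<in> I \<Longrightarrow> y \<in> I \<Longrightarrow> k x y = h' x y + cm.vstar k h' x y"
    using cm.resolvent_exists[OF h'] by blast
  have Y: "volt (\<lambda>t. 1 + 0) (\<lambda>\<phi>. \<phi> + Vol k \<phi>)"
    by (intro volt_add volt_id volt_Vol k)
  have Xe: "X \<phi> = (\<lambda>t. c t * (\<phi> - Vol h' \<phi>) t)" if p: "\<phi> \<in> TF" for \<phi>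
  proof (rule TF_eqI)
    fix t assume t: "t \<in> I"
    have "Vol h \<phi> t = Vol (\<lambda>x y. - c x * h' x y) \<phi> t"
      using c by (intro fun_cong[OF Vol_cong]) (simp add: h'_def)
    also have "\<dots> = - c t * Vol h' \<phi> t"
      using Vol_mult_left[OF cinf_minus[OF h(1)] h' p] by (simp add: fun_eq_iff)
    finally show "X \<phi> t = c t * (\<phi> - Vol h' \<phi>) t"
      by (simp add: h(3)[OF p] algebra_simps)
  qed (intro opr_TF[OF volt_opr[OF assms(1)]] TF_mult TF_diff Vol_TF h h' p)+
  have inv1: "(\<phi> + Vol k \<phi>) - Vol h' (\<phi> + Vol k \<phi>) = \<phi>" if p: "\<phi> \<in> TF" for \<phi>
  proof -
    have "Vol k \<phi> = Vol (\<lambda>x y. h' x y + cm.vstar h' k x y) \<phi>" by (rule Vol_cong) (rule k(2))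
    also have "\<dots> = Vol h' \<phi> + Vol h' (Vol k \<phi>)"
      by (simp only: Vol_add[OF h' cinf2_vstar[OF h' k(1)] p] Vol_comp[OF h' k(1) p])
    finally show ?thesis by (simp add: opr_add[OF Vol_opr[OF h'] p Vol_TF[OF k(1) p]])
  qed
  have inv2: "(\<phi> - Vol h' \<phi>) + Vol k (\<phi> - Vol h' \<phi>) = \<phi>" if p: "\<phi> \<in> TF" for \<phi>
  proof -
    have "Vol k \<phi> = Vol (\<lambda>x y. h' x y + cm.vstar k h' x y) \<phi>" by (rule Vol_cong) (rule k(3))
    also have "\<dots> = Vol h' \<phi> + Vol k (Vol h' \<phi>)"
      by (simp only: Vol_add[OF h' cinf2_vstar[OF k(1) h'] p] Vol_comp[OF k(1) h' p])
    finally show ?thesis by (simp add: opr_diff[OF Vol_opr[OF k(1)] p Vol_TF[OF h' p]])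
  qed
  have ci: "(\<lambda>t. c t * (?i t * \<phi> t)) = \<phi>" "(\<lambda>t. ?i t * (c t * \<phi> t)) = \<phi>" if "\<phi> \<in> TF" for \<phi>
  proof -
    have "c t * (?i t * \<phi> t) = \<phi> t \<and> ?i t * (c t * \<phi> t) = \<phi> t" for t
      using c[of t] TF_outside[OF that, of t] by (cases "t \<in> I") (auto simp: field_simps)
    then show "(\<lambda>t. c t * (?i t * \<phi> t)) = \<phi>" "(\<lambda>t. ?i t * (c t * \<phi> t)) = \<phi>" by auto
  qed
  let ?Y = "\<lambda>\<phi>. (\<lambda>t. ?i t * \<phi> t) + Vol k (\<lambda>t. ?i t * \<phi> t)"
  have "volt (\<lambda>t. (1 + 0) * ?i t) ?Y"
    by (rule volt_comp[OF Y volt_mult[OF i]])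
  then have "volt ?i ?Y" by (rule volt_cong) auto
  moreover have "X (?Y \<phi>) = \<phi>" "?Y (X \<phi>) = \<phi>" if p: "\<phi> \<in> TF" for \<phi>
  proof -
    have ip: "(\<lambda>t. ?i t * \<phi> t) \<in> TF" by (rule TF_mult[OF i p])
    have "?Y \<phi> \<in> TF" by (intro TF_add Vol_TF k ip)
    then show "X (?Y \<phi>) = \<phi>" by (simp only: Xe inv1[OF ip] ci[OF p])
    have d: "\<phi> - Vol h' \<phi> \<in> TF" by (intro TF_diff Vol_TF h' p)
    show "?Y (X \<phi>) = \<phi>" by (simp only: Xe[OF p] ci[OF d] inv2[OF p])
  qed
  ultimately show ?thesis by blast
qed

section \<open>Integer powers of differentiation\<close>

definition Dp :: "int \<Rightarrow> (real \<Rightarrow> complex) \<Rightarrow> real \<Rightarrow> complex" where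
  "Dp m = (if 0 \<le> m then dv ^^ nat m else Jop ^^ nat (- m))"

lemma Dp_0 [simp]: "Dp 0 \<phi> = \<phi>"
  by (simp add: Dp_def)

lemma Dp_add_one: "\<phi> \<in> TF \<Longrightarrow> Dp (m + 1) \<phi> = Dp m (dv \<phi>)"
proof -
  assume p: "\<phi> \<in> TF"
  consider "0 \<le> m" | "m = -1" | "m < -1" by linarith
  then show ?thesis
  proof cases
    case 1
    then have "nat (m + 1) = Suc (nat m)" by simp
    then show ?thesis using 1 by (simp add: Dp_def funpow_swap1)
  next
    case 2
    then show ?thesis using p by (simp add: Dp_def J_dv)
  next
    case 3
    then have "nat (- m) = Suc (nat (- (m + 1)))" by simp
    then show ?thesis using 3 p by (simp add: Dp_def funpow_swap1 J_dv)
  qed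
qed

lemma Dp_1: "\<phi> \<in> TF \<Longrightarrow> Dp 1 \<phi> = dv \<phi>"
  using Dp_add_one[of \<phi> 0] by simp

lemma Dp_diff_one: "\<phi> \<in> TF \<Longrightarrow> Dp (m - 1) \<phi> = Dp m (Jop \<phi>)"
  using Dp_add_one[of "Jop \<phi>" "m - 1"] by (simp add: Vol_TF cinf2_const dv_J)

lemma Dp_neg1: "\<phi> \<in> TF \<Longrightarrow> Dp (- 1) \<phi> = Jop \<phi>"
  using Dp_diff_one[of \<phi> 0] by simp

lemma Dp_opr: "opr (Dp m)"
proof (induction m rule: int_induct[of _ 0])
  case base
  show ?case by (rule opr_cong[OF volt_opr[OF volt_id]]) simp
next
  case (step1 i)
  show ?case by (rule opr_cong[OF opr_comp[OF step1(2) dv_opr]]) (simp add: Dp_add_one)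
next
  case (step2 i)
  show ?case by (rule opr_cong[OF opr_comp[OF step2(2) Vol_opr[OF cinf2_const]]]) (simp add: Dp_diff_one)
qed

lemma Dp_add: "\<phi> \<in> TF \<Longrightarrow> Dp (m + n) \<phi> = Dp m (Dp n \<phi>)"
proof (induction n arbitrary: \<phi> rule: int_induct[of _ 0])
  case (step1 i)
  then show ?case using Dp_add_one[of \<phi> "m + i"] Dp_add_one[of \<phi> i] by (simp add: dv_TF add.assoc)
next
  case (step2 i)
  then show ?case using Dp_diff_one[of \<phi> "m + i"] Dp_diff_one[of \<phi> i]
    by (simp add: Vol_TF cinf2_const add_diff_eq)
qed simp

text \<open>Repeated conjugation keeps the symbol, so a power of \<open>\<partial>\<close> moves
  past a Volterra operator of the second kind and leaves one with the same symbol. This is why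
  symbols multiply in \<open>psd_comp\<close>.\<close>

lemma volt_Dp:
  assumes "volt c X"
  shows "\<exists>X'. volt c X' \<and> (\<forall>\<phi>\<in>TF. Dp m (X \<phi>) = X' (Dp m \<phi>))"
proof (induction m rule: int_induct[of _ 0])
  case base
  show ?case using assms by auto
next
  case (step1 i)
  then obtain X' where X': "volt c X'" "\<forall>\<phi>\<in>TF. Dp i (X \<phi>) = X' (Dp i \<phi>)" by blast
  have "Dp (i + 1) (X \<phi>) = dv (X' (Jop (Dp (i + 1) \<phi>)))" if p: "\<phi> \<in> TF" for \<phi>
  proof -
    have *: "Dp (i + 1) \<psi> = dv (Dp i \<psi>)" if "\<psi> \<in> TF" for \<psi>
      using Dp_add[OF that, of 1 i] Dp_1 opr_TF[OF Dp_opr that] by (simp add: add.commute)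
    have "X' (Jop (Dp (i + 1) \<phi>)) = X' (Dp i \<phi>)"
      using *[OF p] J_dv opr_TF[OF Dp_opr p] by simp
    then show ?thesis using *[OF opr_TF[OF volt_opr[OF assms] p]] X'(2) p by simp
  qed
  then show ?case using volt_conj(1)[OF X'(1)] by blast
next
  case (step2 i)
  then obtain X' where X': "volt c X'" "\<forall>\<phi>\<in>TF. Dp i (X \<phi>) = X' (Dp i \<phi>)" by blast
  have "Dp (i - 1) (X \<phi>) = Jop (X' (dv (Dp (i - 1) \<phi>)))" if p: "\<phi> \<in> TF" for \<phi>
  proof -
    have *: "Dp (i - 1) \<psi> = Jop (Dp i \<psi>)" if "\<psi> \<in> TF" for \<psi>
      using Dp_add[OF that, of "- 1" i] Dp_neg1 opr_TF[OF Dp_opr that] by simp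
    have "X' (dv (Dp (i - 1) \<phi>)) = X' (Dp i \<phi>)"
      using *[OF p] dv_J opr_TF[OF Dp_opr p] by simp
    then show ?thesis using *[OF opr_TF[OF volt_opr[OF assms] p]] X'(2) p by simp
  qed
  then show ?case using volt_conj(2)[OF X'(1)] by blast
qed

text \<open>Operators of order at most \<open>m\<close> with principal symbol \<open>c\<close>: a Volterra operator of the second
  kind after \<open>m\<close> differentiations (\<open>- m\<close> integrations from the left if \<open>m < 0\<close>).\<close>

definition psd :: "int \<Rightarrow> (real \<Rightarrow> complex) \<Rightarrow> ((real \<Rightarrow> complex) \<Rightarrow> real \<Rightarrow> complex) \<Rightarrow> bool" where
  "psd m c X \<longleftrightarrow> (\<exists>Y. volt c Y \<and> (\<forall>\<phi>\<in>TF. X \<phi> = Y (Dp m \<phi>)))"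

lemma psd_opr: "psd m c X \<Longrightarrow> opr X"
  unfolding psd_def using opr_cong[OF opr_comp[OF volt_opr Dp_opr]] by blast

lemma psd_cong:
  assumes "psd m d Y" "\<And>\<phi>. \<phi> \<in> TF \<Longrightarrow> X \<phi> = Y \<phi>" "\<And>t. t \<in> I \<Longrightarrow> c t = d t"
  shows "psd m c X"
  using assms volt_cong[where c = c and d = d] unfolding psd_def by (metis (no_types, lifting))

lemma psd_add:
  assumes "psd m c X" "psd m d Y"
  shows "psd m (\<lambda>t. c t + d t) (\<lambda>\<phi>. X \<phi> + Y \<phi>)"
proof -
  obtain X' where X': "volt c X'" "\<forall>\<phi>\<in>TF. X \<phi> = X' (Dp m \<phi>)" using assms(1) unfolding psd_def by blast
  obtain Y' where Y': "volt d Y'" "\<forall>\<phi>\<in>TF. Y \<phi> = Y' (Dp m \<phi>)" using assms(2) unfolding psd_def by blast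
  show ?thesis unfolding psd_def using volt_add[OF X'(1) Y'(1)] X'(2) Y'(2) by fastforce
qed

lemma psd_volt: "volt c X \<Longrightarrow> psd 0 c X"
  unfolding psd_def by auto

lemma psd_comp:
  assumes "psd m c X" "psd n d Y"
  shows "psd (m + n) (\<lambda>t. c t * d t) (\<lambda>\<phi>. X (Y \<phi>))"
proof -
  obtain X' where X': "volt c X'" "\<forall>\<phi>\<in>TF. X \<phi> = X' (Dp m \<phi>)" using assms(1) unfolding psd_def by blast
  obtain Y' where Y': "volt d Y'" "\<forall>\<phi>\<in>TF. Y \<phi> = Y' (Dp n \<phi>)" using assms(2) unfolding psd_def by blast
  obtain Z where Z: "volt d Z" "\<forall>\<phi>\<in>TF. Dp m (Y' \<phi>) = Z (Dp m \<phi>)" using volt_Dp[OF Y'(1)] by blast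
  have "X (Y \<phi>) = X' (Z (Dp (m + n) \<phi>))" if p: "\<phi> \<in> TF" for \<phi>
    using X'(2) Y'(2) Z(2) p opr_TF[OF psd_opr[OF assms(2)] p] opr_TF[OF Dp_opr p] by (simp add: Dp_add)
  then show ?thesis unfolding psd_def using volt_comp[OF X'(1) Z(1)] by blast
qed

lemma psd_Dp: "psd m (\<lambda>_. 1) (Dp m)"
  unfolding psd_def using volt_id by auto

lemma psd_mult: "cinf I c \<Longrightarrow> psd 0 c (\<lambda>\<phi> t. c t * \<phi> t)"
  by (intro psd_volt volt_mult)

lemma psd_uminus:
  assumes "psd m c X"
  shows "psd m (\<lambda>t. - c t) (\<lambda>\<phi>. - X \<phi>)"
  by (rule psd_cong[OF psd_comp[OF psd_mult[OF cinf_const[of I "- 1"]] assms, simplified]])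
    (simp_all add: fun_Compl_def)

lemma psd_diff:
  assumes "psd m c X" "psd m d Y"
  shows "psd m (\<lambda>t. c t - d t) (\<lambda>\<phi>. X \<phi> - Y \<phi>)"
  using psd_add[OF assms(1) psd_uminus[OF assms(2)]] by simp

lemma psd_zero: "psd m (\<lambda>_. 0) (\<lambda>_. 0)"
proof -
  have "psd m (\<lambda>t. 0 * 1) (\<lambda>\<phi> t. 0 * Dp m \<phi> t)"
    using psd_comp[OF psd_mult[OF cinf_const[of I 0]] psd_Dp[of m]] by simp
  then show ?thesis by (simp add: zero_fun_def)
qed

lemma psd_sum:
  assumes "\<And>i. i \<in> F \<Longrightarrow> psd m (c i) (X i)"
  shows "psd m (\<lambda>t. \<Sum>i\<in>F. c i t) (\<lambda>\<phi>. \<Sum>i\<in>F. X i \<phi>)"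
  using assms
  by (induction F rule: infinite_finite_induct) (auto intro: psd_zero psd_add)

lemma psd_inverse:
  assumes "psd m c X" and c: "\<And>t. t \<in> I \<Longrightarrow> c t \<noteq> 0"
  shows "\<exists>Y. psd (- m) (\<lambda>t. inverse (c t)) Y \<and> (\<forall>\<phi>\<in>TF. X (Y \<phi>) = \<phi> \<and> Y (X \<phi>) = \<phi>)"
proof -
  obtain X' where X': "volt c X'" "\<forall>\<phi>\<in>TF. X \<phi> = X' (Dp m \<phi>)" using assms(1) unfolding psd_def by blast
  obtain Y' where Y': "volt (\<lambda>t. inverse (c t)) Y'" "\<forall>\<phi>\<in>TF. X' (Y' \<phi>) = \<phi> \<and> Y' (X' \<phi>) = \<phi>"
    using volt_inverse[OF X'(1) c] by blast
  have "psd (- m) (\<lambda>t. inverse (c t)) (\<lambda>\<phi>. Dp (- m) (Y' \<phi>))"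
    using psd_comp[OF psd_Dp psd_volt[OF Y'(1)], of "- m"] by simp
  moreover have "X (Dp (- m) (Y' \<phi>)) = \<phi> \<and> Dp (- m) (Y' (X \<phi>)) = \<phi>" if p: "\<phi> \<in> TF" for \<phi>
    using p X'(2) Y'(2) opr_TF[OF Dp_opr] opr_TF[OF volt_opr[OF Y'(1)] p]
      Dp_add[of "Y' \<phi>" m "- m"] Dp_add[of \<phi> "- m" m] by simp
  ultimately show ?thesis by blast
qed

lemma psd_Vol:
  assumes "psd (- 1) c X"
  obtains g where "cinf2 g" "\<And>t. t \<in> I \<Longrightarrow> g t t = c t" "\<And>\<phi>. \<phi> \<in> TF \<Longrightarrow> X \<phi> = Vol g \<phi>"
proof -
  obtain X' where X': "volt c X'" "\<forall>\<phi>\<in>TF. X \<phi> = X' (Dp (- 1) \<phi>)" using assms(1) unfolding psd_def by blast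
  obtain g where "cinf2 g" "\<And>t. t \<in> I \<Longrightarrow> g t t = c t" "\<And>\<phi>. \<phi> \<in> TF \<Longrightarrow> X' (Jop \<phi>) = Vol g \<phi>"
    using volt_J[OF X'(1)] by blast
  then show ?thesis by (intro that[of g]) (simp_all add: X'(2) Dp_neg1)
qed

lemma psd_Vol_iff:
  assumes g: "cinf2 g"
  shows "psd (- 1) (\<lambda>t. g t t) (Vol g)"
  unfolding psd_def
  by (rule exI[of _ "\<lambda>\<phi>. Vol g (dv \<phi>)"])
    (simp add: volt_Vol_dv[OF g] Dp_neg1 dv_J)

text \<open>Insert one more derivative together with an integration that cancels it; the integration
  turns the Volterra operator into a pure kernel, whose symbol is zero. Terms of different orders
  can thus be added.\<close>

lemma psd_raise:
  assumes "psd m c X"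
  shows "psd (m + 1) (\<lambda>_. 0) X"
proof -
  obtain X' where X': "volt c X'" "\<forall>\<phi>\<in>TF. X \<phi> = X' (Dp m \<phi>)" using assms(1) unfolding psd_def by blast
  obtain g where g: "cinf2 g" "\<And>t. t \<in> I \<Longrightarrow> g t t = c t" "\<And>\<phi>. \<phi> \<in> TF \<Longrightarrow> X' (Jop \<phi>) = Vol g \<phi>"
    using volt_J[OF X'(1)] by blast
  have "X \<phi> = Vol g (Dp (m + 1) \<phi>)" if p: "\<phi> \<in> TF" for \<phi>
  proof -
    have "Jop (Dp (m + 1) \<phi>) = Dp m \<phi>"
      using Dp_add[OF p, of "- 1" "m + 1"] Dp_neg1 opr_TF[OF Dp_opr p] by simp
    then show ?thesis using g(3)[OF opr_TF[OF Dp_opr p], of "m + 1"] X'(2) p by simp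
  qed
  then show ?thesis unfolding psd_def using volt_Vol[OF g(1)] by blast
qed

lemma psd_le:
  assumes "psd m c X" "m < n"
  shows "psd n (\<lambda>_. 0) X"
proof -
  have "psd (m + 1 + int k) (\<lambda>_. 0) X" for k
    by (induction k) (use psd_raise[OF assms(1)] psd_raise in \<open>force simp: add_ac\<close>)+
  from this[of "nat (n - m - 1)"] show ?thesis using assms(2) by simp
qed

text \<open>One integration is used up to form the kernel \<open>g\<close> with diagonal
  \<open>c\<close>. The other gives \<open>f(x, y)\<close>, the integral of \<open>g(x, .)\<close>
  from \<open>y\<close> to \<open>x\<close>. It vanishes for \<open>x = y\<close>, where its
  derivatives come from the moving limits alone and are \<open>c\<close> and
  \<open>- c\<close>.\<close>

lemma psd_minus2:
  assumes "psd (- 2) c X"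
  obtains f where "cinf2 f" "\<And>\<phi>. \<phi> \<in> TF \<Longrightarrow> X \<phi> = Vol f \<phi>" "\<And>t. t \<in> I \<Longrightarrow> f t t = 0"
    "\<And>t. t \<in> I \<Longrightarrow> D1 f t t = c t" "\<And>t. t \<in> I \<Longrightarrow> D2 f t t = - c t"
proof -
  obtain X' where X': "volt c X'" "\<forall>\<phi>\<in>TF. X \<phi> = X' (Dp (- 2) \<phi>)" using assms(1) unfolding psd_def by blast
  obtain g where g: "cinf2 g" "\<And>t. t \<in> I \<Longrightarrow> g t t = c t" "\<And>\<phi>. \<phi> \<in> TF \<Longrightarrow> X' (Jop \<phi>) = Vol g \<phi>"
    using volt_J[OF X'(1)] by blast
  let ?f = "cm.vstar g (\<lambda>_ _. 1)"
  have f: "cinf2 ?f" by (intro cinf2_vstar g cinf2_const)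
  note one = cinf2_Ck0[OF cinf2_const[of 1]]
  show ?thesis
  proof (rule that[OF f])
    fix \<phi> assume p: "\<phi> \<in> TF"
    have J: "Jop \<phi> \<in> TF" by (intro Vol_TF cinf2_const p)
    have "Dp (- 2) \<phi> = Jop (Jop \<phi>)"
      using Dp_diff_one[OF p, of "- 1"] Dp_neg1[OF J] by simp
    then show "X \<phi> = Vol ?f \<phi>" using X'(2) p g(3)[OF J] Vol_comp[OF g(1) cinf2_const p] by simp
  next
    fix t assume t: "t \<in> I"
    show "?f t t = 0" by (simp add: cm.vstar_def)
    show "D1 ?f t t = c t"
      using DI_eq[OF t cm.vstar_D1[OF g(1) one t t]] g(2)[OF t] by (simp add: cm.vstar_def)
    have c: "continuous_on I (g t)" by (rule cinf_continuous_on[OF cinf_section2[OF g(1) t]])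
    have "((\<lambda>s. - sint t s (g t)) has_vector_derivative - g t t) (at t within I)"
      by (intro has_vector_derivative_minus sint_has_vector_derivative c t)
    then have "(?f t has_vector_derivative - g t t) (at t within I)"
      by (rule has_vector_derivative_transform[rotated 2]) (use t sint_swap[OF c t] in \<open>simp_all add: cm.vstar_def\<close>)
    from DI_eq[OF t this] show "D2 ?f t t = - c t" using g(2)[OF t] by simp
  qed
qed

section \<open>Kernels as operators\<close>

lemma test_fun_iff: "test_fun I \<phi> \<longleftrightarrow> rs \<phi> \<in> TF"
proof -
  have "cinf I (rs \<phi>) \<longleftrightarrow> cinf I \<phi>" by (rule cinf_cong) (simp add: rs_def)
  then show ?thesis by (auto simp: test_fun_def TF_def smooth_on_iff_cinf rs_def)
qed

text \<open>A kernel accepts arbitrary functions and is evaluated at single times, an operator lives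
  on \<open>TF\<close>. This relation ties a distribution to its operator: \<open>keq\<close>
  becomes equality on \<open>TF\<close> and \<open>star\<close> becomes composition.\<close>

definition rep :: "kernel \<Rightarrow> ((real \<Rightarrow> complex) \<Rightarrow> real \<Rightarrow> complex) \<Rightarrow> bool" where
  "rep d X \<longleftrightarrow> (\<forall>t\<in>I. \<forall>\<phi>. rs \<phi> \<in> TF \<longrightarrow> d t \<phi> = X (rs \<phi>) t)"

lemma repD: "rep d X \<Longrightarrow> t \<in> I \<Longrightarrow> rs \<phi> \<in> TF \<Longrightarrow> d t \<phi> = X (rs \<phi>) t"
  by (simp add: rep_def)

lemma rep_cong: "rep d X \<Longrightarrow> (\<And>\<phi>. \<phi> \<in> TF \<Longrightarrow> X \<phi> = Y \<phi>) \<Longrightarrow> rep d Y"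
  by (simp add: rep_def)

lemma keq_rep: "rep d X \<Longrightarrow> rep e Y \<Longrightarrow> (\<And>\<phi>. \<phi> \<in> TF \<Longrightarrow> X \<phi> = Y \<phi>) \<Longrightarrow> keq I d e"
  by (simp add: keq_def test_fun_iff rep_def)

lemma rep_canonical: "rep (\<lambda>t \<phi>. X (rs \<phi>) t) X"
  by (simp add: rep_def)

lemma rep_Vol: "rep (fun_kernel I (times_theta f)) (Vol f)"
proof -
  have "integral I (\<lambda>s. times_theta f t s * \<phi> s) = integral I (\<lambda>s. times_theta f t s * rs \<phi> s)" for t \<phi>
    by (rule Henstock_Kurzweil_Integration.integral_cong) (simp add: rs_def)
  then show ?thesis by (simp add: rep_def Vol_def fun_kernel_def rs_def)
qed

lemma rep_star:
  assumes d: "rep d X" and e: "rep e Y" and Y: "opr Y"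
  shows "rep (star d e) (\<lambda>\<phi>. X (Y \<phi>))"
  unfolding rep_def star_def
proof (intro ballI allI impI)
  fix t \<phi> assume t: "t \<in> I" and p: "rs \<phi> \<in> TF"
  have eq: "rs (\<lambda>s. e s \<phi>) = Y (rs \<phi>)"
    using repD[OF e _ p] TF_outside[OF opr_TF[OF Y p]] by (auto simp: rs_def fun_eq_iff)
  show "d t (\<lambda>s. e s \<phi>) = X (Y (rs \<phi>)) t"
    using repD[OF d t, of "\<lambda>s. e s \<phi>"] opr_TF[OF Y p] by (simp add: eq)
qed

lemma rep_sum: "(\<And>i. i \<in> F \<Longrightarrow> rep (d i) (X i)) \<Longrightarrow> rep (\<lambda>t \<phi>. \<Sum>i\<in>F. d i t \<phi>) (\<lambda>\<phi>. \<Sum>i\<in>F. X i \<phi>)"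
  by (simp add: rep_def sum_fun_apply)

lemma rep_diff: "rep d X \<Longrightarrow> rep e Y \<Longrightarrow> rep (\<lambda>t \<phi>. d t \<phi> - e t \<phi>) (\<lambda>\<phi>. X \<phi> - Y \<phi>)"
  and rep_add: "rep d X \<Longrightarrow> rep e Y \<Longrightarrow> rep (\<lambda>t \<phi>. d t \<phi> + e t \<phi>) (\<lambda>\<phi>. X \<phi> + Y \<phi>)"
  and rep_zero: "rep (\<lambda>_ _. 0) (\<lambda>_. 0)"
  by (simp_all add: rep_def)

lemma iter_deriv_rs: "cinf I \<phi> \<Longrightarrow> t \<in> I \<Longrightarrow> iter_deriv I i \<phi> t = (dv ^^ i) (rs \<phi>) t"
proof (induction i arbitrary: \<phi>)
  case 0
  then show ?case by (simp add: rs_def)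
next
  case (Suc i)
  have "DI (rs \<phi>) s = DI \<phi> s" if s: "s \<in> I" for s
  proof (rule DI_eq[OF s])
    show "(rs \<phi> has_vector_derivative DI \<phi> s) (at s within I)"
      by (rule has_vector_derivative_transform[rotated 2, OF DI_has_vector_derivative[OF Suc.prems(1) s]])
        (use s in \<open>simp_all add: rs_def\<close>)
  qed
  then have "dv (rs \<phi>) = rs (DI \<phi>)" by (auto simp: dv_def rs_def fun_eq_iff)
  then show ?case
    using Suc.IH[OF cinf_DI[OF Suc.prems(1)] Suc.prems(2)]
    by (simp add: iter_deriv_Suc' funpow_Suc_right del: funpow.simps(2))
qed

text \<open>A coefficient depending on the left variable alone is a constant for the inner
  differentiation. Such coefficients suffice for \<open>volt_Dp_expansion\<close>.\<close>

lemma rep_delta_kernel: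
  "rep (delta_kernel I i (\<lambda>t _. g t)) (\<lambda>\<phi> t. g t * Dp (int i) \<phi> t)"
  unfolding rep_def delta_kernel_def
proof (intro ballI allI impI)
  fix t \<phi> assume t: "t \<in> I" and p: "rs \<phi> \<in> TF"
  have "cinf I \<phi>" using TF_cinf[OF p] by (rule cinf_cong[THEN iffD1, rotated]) (simp add: rs_def)
  then have "cinf I (\<lambda>s. g t * \<phi> s)" by (intro cinf_mult cinf_const)
  from iter_deriv_rs[OF this t, of i]
  have "iter_deriv I i (\<lambda>s. g t * \<phi> s) t = Dp (int i) (rs (\<lambda>s. g t * \<phi> s)) t"
    by (simp add: Dp_def)
  also have "rs (\<lambda>s. g t * \<phi> s) = (\<lambda>s. g t * rs \<phi> s)" by (simp add: rs_def fun_eq_iff)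
  also have "Dp (int i) \<dots> t = g t * Dp (int i) (rs \<phi>) t"
    by (simp add: opr_cmult[OF Dp_opr p])
  finally show "iter_deriv I i (\<lambda>s. g t * \<phi> s) t = g t * Dp (int i) (rs \<phi>) t" .
qed

lemma rep_delta: "rep (delta I i) (Dp (int i))"
  using rep_delta_kernel[of i "\<lambda>_. 1"] by simp

lemma rep_star_one: "rep (star_one I) (\<lambda>\<phi>. \<phi>)"
  by (rule rep_cong[OF rep_delta]) simp

text \<open>Repeated integration by parts: each derivative applied before \<open>Vol h\<close>
  splits off the diagonal of \<open>h\<close> as a new delta term and leaves the kernel
  \<open>- D2 h\<close>. The result has the shape required by class D.\<close>

lemma volt_Dp_expansion:
  assumes "volt c Y"
  shows "\<exists>h g. cinf2 h \<and> (\<forall>i. cinf I (g i)) \<and>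
    (\<forall>\<phi>\<in>TF. Y (Dp (int n) \<phi>) = Vol h \<phi> + (\<Sum>i\<le>n. (\<lambda>t. g i t * Dp (int i) \<phi> t)))"
proof (induction n)
  case 0
  obtain h where h: "cinf I c" "cinf2 h" "\<And>\<phi>. \<phi> \<in> TF \<Longrightarrow> Y \<phi> = (\<lambda>t. c t * \<phi> t) + Vol h \<phi>"
    using voltE[OF assms] by blast
  then show ?case by (intro exI[of _ h] exI[of _ "\<lambda>_. c"]) (auto simp: add.commute)
next
  case (Suc n)
  then obtain h g where h: "cinf2 h" and g: "\<And>i. cinf I (g i)" and
    e: "\<And>\<phi>. \<phi> \<in> TF \<Longrightarrow> Y (Dp (int n) \<phi>) = Vol h \<phi> + (\<Sum>i\<le>n. (\<lambda>t. g i t * Dp (int i) \<phi> t))" by blast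
  \<comment> \<open>The old coefficients move up by one order, and the diagonal of \<open>h\<close>
    enters at order 0.\<close>
  define g' where "g' i = (case i of 0 \<Rightarrow> (\<lambda>t. h t t) | Suc j \<Rightarrow> g j)" for i
  have "Y (Dp (int (Suc n)) \<phi>) = Vol (\<lambda>x y. - D2 h x y) \<phi> + (\<Sum>i\<le>Suc n. (\<lambda>t. g' i t * Dp (int i) \<phi> t))"
    if p: "\<phi> \<in> TF" for \<phi>
  proof -
    have s: "Dp (int (Suc i)) \<phi> = Dp (int i) (dv \<phi>)" for i
      using Dp_add_one[OF p, of "int i"] by (simp add: add.commute)
    have m: "Vol (\<lambda>x y. - D2 h x y) \<phi> = - Vol (D2 h) \<phi>"
      using Vol_mult_left[OF cinf_const cinf2_D2[OF h] p, of "- 1"] by (simp add: fun_Compl_def)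
    have "(\<Sum>i\<le>Suc n. (\<lambda>t. g' i t * Dp (int i) \<phi> t)) = (\<lambda>t. h t t * \<phi> t) + (\<Sum>i\<le>n. (\<lambda>t. g i t * Dp (int i) (dv \<phi>) t))"
      unfolding sum.atMost_Suc_shift s by (simp add: g'_def)
    then show ?thesis
      unfolding s e[OF dv_TF[OF p]] m Vol_dv[OF h p] by (simp add: fun_eq_iff)
  qed
  moreover have "cinf I (g' i)" for i using g cinf_diag[OF h] by (auto simp: g'_def split: nat.split)
  ultimately show ?case using cinf2_minus[OF cinf2_D2[OF h]] by blast
qed

lemma psd_class_D:
  assumes X: "psd m c X" and d: "rep d X"
  shows "class_D I d"
proof -
  obtain n Y c where Y: "volt c Y" "\<And>\<phi>. \<phi> \<in> TF \<Longrightarrow> X \<phi> = Y (Dp (int n) \<phi>)"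
  \<comment> \<open>Negative orders are raised to order 0, with symbol 0.\<close>
  proof (cases "m < 0")
    case True
    from psd_le[OF X True] that[of _ _ 0] show ?thesis unfolding psd_def by auto
  next
    case False
    then have "m = int (nat m)" by simp
    then show ?thesis using X that[of _ _ "nat m"] unfolding psd_def by metis
  qed
  obtain h g where h: "cinf2 h" and g: "\<And>i. cinf I (g i)" and
    e: "\<And>\<phi>. \<phi> \<in> TF \<Longrightarrow> Y (Dp (int n) \<phi>) = Vol h \<phi> + (\<Sum>i\<le>n. (\<lambda>t. g i t * Dp (int i) \<phi> t))"
    using volt_Dp_expansion[OF Y(1)] by blast
  have "rep (\<lambda>t' \<phi>. fun_kernel I (times_theta h) t' \<phi> + (\<Sum>i\<le>n. delta_kernel I i (\<lambda>t _. g i t) t' \<phi>))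
      (\<lambda>\<phi>. Vol h \<phi> + (\<Sum>i\<le>n. (\<lambda>t. g i t * Dp (int i) \<phi> t)))"
    by (intro rep_add rep_Vol rep_sum rep_delta_kernel)
  then have "keq I d (\<lambda>t' \<phi>. fun_kernel I (times_theta h) t' \<phi> + (\<Sum>i\<le>n. delta_kernel I i (\<lambda>t _. g i t) t' \<phi>))"
    by (rule keq_rep[OF d]) (simp add: Y e)
  then show ?thesis
    unfolding class_D_def using cinf2_imp_smooth2_on[OF h] cinf2_imp_smooth2_on[OF cinf2_fun1[OF g]]
    by (intro exI[of _ h] exI[of _ n] exI[of _ "\<lambda>i t _. g i t"]) auto
qed

lemma class_Sm_theta_Vol: "cinf2 h \<Longrightarrow> rep d (Vol h) \<Longrightarrow> class_Sm_theta I d"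
  unfolding class_Sm_theta_def using cinf2_imp_smooth2_on keq_rep[OF _ rep_Vol] by blast

end

section \<open>Uniqueness for homogeneous Volterra equations\<close>

lemma gronwall_zero:
  fixes g :: "real \<Rightarrow> real"
  assumes g: "continuous_on {a..b} g" and C: "C \<ge> 0" and t: "t \<in> {a..b}"
    and le: "\<And>x. x \<in> {a..b} \<Longrightarrow> g x \<le> C * integral {a..x} g"
  shows "g t \<le> 0"
proof -
  \<comment> \<open>Integrating factor: \<open>G\<close> starts at 0 and its derivative is
    nonpositive by \<open>le\<close>, so the integral of \<open>g\<close> up to \<open>t\<close> is
    not positive.\<close>
  define G where "G x = exp (- C * x) * integral {a..x} g" for x
  have d: "(G has_real_derivative (exp (- C * x) * (g x - C * integral {a..x} g))) (at x within {a..b})"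
    if x: "x \<in> {a..b}" for x
  proof -
    have 1: "((\<lambda>x. integral {a..x} g) has_real_derivative g x) (at x within {a..b})"
      using integral_has_vector_derivative[OF g x] by (simp add: has_real_derivative_iff_has_vector_derivative)
    have 2: "((\<lambda>x. exp (- C * x)) has_real_derivative - C * exp (- C * x)) (at x within {a..b})"
      by (auto intro!: derivative_eq_intros)
    show ?thesis unfolding G_def using DERIV_mult[OF 2 1] by (simp add: algebra_simps)
  qed
  have "G t \<le> G a"
  proof (rule DERIV_nonpos_imp_decreasing_open[where f = G])
    show "a \<le> t" using t by simp
    show "continuous_on {a..t} G"
      using t by (intro continuous_on_subset[OF DERIV_continuous_on[OF d]]) auto
    fix x assume x: "a < x" "x < t"
    then have "at x within {a..b} = at x" using t by (intro at_within_Icc_at) auto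
    then show "\<exists>y. DERIV G x :> y \<and> y \<le> 0"
      using d[of x] le[of x] x t by (intro exI[of _ "exp (- C * x) * (g x - C * integral {a..x} g)"])
        (auto intro: mult_nonneg_nonpos)
  qed
  then have "integral {a..t} g \<le> 0"
    by (simp add: G_def mult_le_0_iff not_le[symmetric])
  then have "C * integral {a..t} g \<le> 0" using C by (simp add: mult_nonneg_nonpos)
  then show ?thesis using le[OF t] by simp
qed

context nondegenerate_interval
begin

text \<open>There are finitely many components, so all of them vanish to the left of one point
  \<open>a\<close>. To the right of it the sum of their moduli is bounded by a constant times its
  own integral from \<open>a\<close>, and the Gronwall inequality makes it zero.\<close>

lemma volterra_fixpoint_zero:
  fixes F :: "'n::finite \<Rightarrow> real \<Rightarrow> complex" and h :: "'n \<Rightarrow> 'n \<Rightarrow> real \<Rightarrow> real \<Rightarrow> complex"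
  assumes F: "\<And>i. F i \<in> TF" and h: "\<And>i j. cinf2 (h i j)"
    and fix_eq: "\<And>i. F i = (\<Sum>j\<in>UNIV. Vol (h i j) (F j))"
  shows "F i = 0"
proof -
  have "\<exists>a. a \<in> I \<and> (\<forall>t\<in>I. t \<le> a \<longrightarrow> F i t = 0)" for i
    using TF_vanish[OF F[of i]] by metis
  then obtain a' where a': "\<And>i. a' i \<in> I" "\<And>i t. t \<in> I \<Longrightarrow> t \<le> a' i \<Longrightarrow> F i t = 0" by metis
  define a where "a = Min (range a')"
  have "a \<in> range a'" unfolding a_def by (rule Min_in) auto
  then have aI: "a \<in> I" using a' by auto
  have av: "F i t = 0" if "t \<in> I" "t \<le> a" for i t
    using that a'(2)[of t i] Min_le[of "range a'" "a' i"] unfolding a_def by auto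
  have "F i t = 0" if t: "t \<in> I" "a < t" for t
  proof -
    define g where "g x = (\<Sum>i\<in>UNIV. cmod (F i x))" for x
    have sub: "{a..t} \<subseteq> I" by (rule interval_subset[OF aI t(1)])
    have cF: "continuous_on {a..t} (F i)" for i
      by (rule continuous_on_subset[OF TF_continuous[OF F] sub])
    have cg: "continuous_on {a..t} g"
      unfolding g_def by (intro continuous_intros cF)
    have "\<exists>C\<ge>0. \<forall>x\<in>{a..t}. \<forall>y\<in>{a..t}. cmod (h i j x y) \<le> C" for i j
    proof -
      have "compact ((\<lambda>(x, y). h i j x y) ` ({a..t} \<times> {a..t}))"
        by (rule compact_continuous_image[OF continuous_on_subset[OF cinf_continuous_on[OF h]]])
          (use sub in \<open>auto simp: compact_Times\<close>)
      then have "bounded ((\<lambda>(x, y). h i j x y) ` ({a..t} \<times> {a..t}))" by (rule compact_imp_bounded)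
      then obtain C where "C > 0" "\<forall>z\<in>(\<lambda>(x, y). h i j x y) ` ({a..t} \<times> {a..t}). norm z \<le> C"
        unfolding bounded_pos by blast
      then show ?thesis by (intro exI[of _ C]) auto
    qed
    then obtain C where C: "\<And>i j. C i j \<ge> 0" "\<And>i j x y. x \<in> {a..t} \<Longrightarrow> y \<in> {a..t} \<Longrightarrow> cmod (h i j x y) \<le> C i j"
      by metis
    define B where "B = (\<Sum>i\<in>UNIV. \<Sum>j\<in>UNIV. C i j)"
    have B: "(\<Sum>i\<in>UNIV. C i j) \<le> B" for j
      unfolding B_def using C(1) by (intro sum_mono member_le_sum) auto
    have "g t \<le> 0"
    proof (rule gronwall_zero[OF cg])
      show "B \<ge> 0" unfolding B_def by (intro sum_nonneg C)
      show "t \<in> {a..t}" using t by simp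
      fix x assume x: "x \<in> {a..t}"
      then have xI: "x \<in> I" using sub by auto
      have sx: "{a..x} \<subseteq> {a..t}" using x by auto
      have ci: "(\<lambda>s. cmod (F j s)) integrable_on {a..x}" for j
        by (intro integrable_continuous_interval continuous_on_norm continuous_on_subset[OF cF sx])
      have V: "cmod (Vol (h i j) (F j) x) \<le> C i j * integral {a..x} (\<lambda>s. cmod (F j s))" for i j
      proof -
        have co: "continuous_on I (\<lambda>s. h i j x s * F j s)"
          by (intro continuous_on_mult TF_continuous F cinf_continuous_on[OF cinf_section2[OF h xI]])
        have "Vol (h i j) (F j) x = sint a x (\<lambda>s. h i j x s * F j s)"
          by (rule Vol_eq_sint[OF F h aI av xI])
        also have "\<dots> = integral {a..x} (\<lambda>s. h i j x s * F j s)"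
          by (rule sint_eq_integral[OF co aI xI]) (use x in simp)
        also have "cmod \<dots> \<le> integral {a..x} (\<lambda>s. C i j * cmod (F j s))"
        proof (rule integral_norm_bound_integral)
          show "(\<lambda>s. h i j x s * F j s) integrable_on {a..x}"
            using sx sub by (intro integrable_continuous_interval continuous_on_subset[OF co]) auto
          show "(\<lambda>s. C i j * cmod (F j s)) integrable_on {a..x}"
            using integrable_on_cmult_left[OF ci] by simp
          show "cmod (h i j x s * F j s) \<le> C i j * cmod (F j s)" if "s \<in> {a..x}" for s
            using C(2)[of x s i j] x that by (auto simp: norm_mult intro: mult_right_mono)
        qed
        finally show ?thesis by simp
      qed
      have "g x \<le> (\<Sum>i\<in>UNIV. \<Sum>j\<in>UNIV. C i j * integral {a..x} (\<lambda>s. cmod (F j s)))"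
        unfolding g_def
      proof (rule sum_mono)
        fix i
        have "cmod (F i x) = cmod (\<Sum>j\<in>UNIV. Vol (h i j) (F j) x)"
          using arg_cong[OF fix_eq[of i], of "\<lambda>f. cmod (f x)"] by (simp only: sum_fun_apply)
        also have "\<dots> \<le> (\<Sum>j\<in>UNIV. C i j * integral {a..x} (\<lambda>s. cmod (F j s)))"
          by (rule order_trans[OF norm_sum sum_mono[OF V]])
        finally show "cmod (F i x) \<le> (\<Sum>j\<in>UNIV. C i j * integral {a..x} (\<lambda>s. cmod (F j s)))" .
      qed
      also have "\<dots> = (\<Sum>j\<in>UNIV. (\<Sum>i\<in>UNIV. C i j) * integral {a..x} (\<lambda>s. cmod (F j s)))"
        by (subst sum.swap) (simp add: sum_distrib_right)
      also have "\<dots> \<le> (\<Sum>j\<in>UNIV. B * integral {a..x} (\<lambda>s. cmod (F j s)))"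
        by (intro sum_mono mult_right_mono B integral_nonneg ci) simp
      also have "\<dots> = B * integral {a..x} g"
        unfolding g_def[abs_def] by (subst integral_sum) (auto simp: sum_distrib_left ci)
      finally show "g x \<le> B * integral {a..x} g" .
    qed
    moreover have "cmod (F i t) \<le> g t" unfolding g_def by (rule member_le_sum) auto
    ultimately have "cmod (F i t) \<le> 0" by linarith
    then show ?thesis by simp
  qed
  then show ?thesis
    using av TF_outside[OF F] by (metis linorder_le_less_linear zero_fun_apply ext)
qed

end

section \<open>The Lanczos recursion in additive groups\<close>

text \<open>The coefficients are maps of \<open>X\<close> into itself, \<open>w k\<close> maps
  \<open>Y\<close> to \<open>X\<close> and \<open>v k\<close> maps \<open>X\<close> to
  \<open>Y\<close>, so products are compositions and need not commute. Both uses are instances: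
  complex numbers and vectors at a fixed time, and test functions with their vectors for the
  operators.\<close>

lemma lanczos_biorthogonal:
  fixes X :: "'x::ab_group_add set" and Y :: "'y::ab_group_add set" and A :: "'y \<Rightarrow> 'y"
    and w :: "nat \<Rightarrow> 'y \<Rightarrow> 'x" and v :: "nat \<Rightarrow> 'x \<Rightarrow> 'y" and \<alpha> \<beta> \<gamma> :: "nat \<Rightarrow> 'x \<Rightarrow> 'x"
  assumes X: "0 \<in> X" and Y: "\<And>y z. y \<in> Y \<Longrightarrow> z \<in> Y \<Longrightarrow> y - z \<in> Y"
    and A: "\<And>y. y \<in> Y \<Longrightarrow> A y \<in> Y" and v: "\<And>k x. x \<in> X \<Longrightarrow> v k x \<in> Y"
    and \<alpha>: "\<And>k x. x \<in> X \<Longrightarrow> \<alpha> k x \<in> X" and \<beta>: "\<And>k x. x \<in> X \<Longrightarrow> \<beta> k x \<in> X"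
    and \<gamma>: "\<And>k x. x \<in> X \<Longrightarrow> \<gamma> k x \<in> X"
    and w_diff: "\<And>k y z. y \<in> Y \<Longrightarrow> z \<in> Y \<Longrightarrow> w k (y - z) = w k y - w k z"
    and \<alpha>0: "\<And>k. \<alpha> k 0 = 0" and \<beta>0: "\<And>k. \<beta> k 0 = 0"
    and start: "\<And>x. x \<in> X \<Longrightarrow> w 0 (v 0 x) = x"
    and w_Suc: "\<And>k y. k < n \<Longrightarrow> y \<in> Y \<Longrightarrow>
      w (Suc k) y = w k (A y) - \<alpha> k (w k y) - (if k = 0 then 0 else \<beta> k (w (k - 1) y))"
    and v_Suc: "\<And>k x. k < n \<Longrightarrow> x \<in> X \<Longrightarrow>
      v (Suc k) (\<beta> (Suc k) x) = A (v k x) - v k (\<alpha> k x) - (if k = 0 then 0 else v (k - 1) x)"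
    and \<alpha>_eq: "\<And>k x. k \<le> n \<Longrightarrow> x \<in> X \<Longrightarrow> \<alpha> k x = w k (A (v k x))"
    and \<beta>_eq: "\<And>k x. k < n \<Longrightarrow> x \<in> X \<Longrightarrow> \<beta> (Suc k) x = w (Suc k) (A (v k x))"
    and \<beta>\<gamma>: "\<And>k x. k < n \<Longrightarrow> x \<in> X \<Longrightarrow> \<beta> (Suc k) (\<gamma> (Suc k) x) = x"
    and "i \<le> n" "j \<le> n" "x \<in> X"
  shows "w i (v j x) = (if i = j then x else 0)"
    and "w i (A (v j x)) = (if j = i then \<alpha> i x else if j = Suc i then x else if i = Suc j then \<beta> i x else 0)"
proof -
  have wA: "w k (A y) = w (Suc k) y + \<alpha> k (w k y) + (if k = 0 then 0 else \<beta> k (w (k - 1) y))"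
    if "k < n" "y \<in> Y" for k y
    using w_Suc[OF that] by simp
  have w0: "w k 0 = 0" for k
    using w_diff[OF v[OF X, of 0] v[OF X, of 0], of k] by simp
  have v'Y: "(if k = 0 then 0 else v (k - 1) x) \<in> Y" if "x \<in> X" for k x
    using v[OF that] Y[OF v[OF X, of 0] v[OF X, of 0]] by simp
  have wAv: "w l (A (v k x)) = w l (v (Suc k) (\<beta> (Suc k) x)) + w l (v k (\<alpha> k x)) + w l (if k = 0 then 0 else v (k - 1) x)"
    if "k < n" "x \<in> X" for k l x
  proof -
    have y: "A (v k x) \<in> Y" "v k (\<alpha> k x) \<in> Y" using A[OF v] v[OF \<alpha>] that by auto
    show ?thesis
      unfolding v_Suc[OF that] w_diff[OF Y[OF y] v'Y[OF that(2)]] w_diff[OF y] by simp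
  qed
  have main: "k \<le> n \<Longrightarrow> (\<forall>i\<le>k. \<forall>j\<le>k. \<forall>x\<in>X. w i (v j x) = (if i = j then x else 0))" for k
  proof (induction k)
    case 0
    then show ?case using start by simp
  next
    case (Suc k)
    then have k: "k < n" "k \<le> n" by auto
    have IH: "w i (v j x) = (if i = j then x else 0)" if "i \<le> k" "j \<le> k" "x \<in> X" for i j x
      using Suc.IH k that by simp
    have IH': "w i (if j = 0 then 0 else v (j - 1) x) = (if j = Suc i then x else 0)" if "i \<le> k" "j \<le> Suc k" "x \<in> X" for i j x
      using IH[of i "j - 1" x] that w0 by (cases j) auto
    \<comment> \<open>New row against old columns. The row recursion reduces this to
      \<open>w k (A (v j x))\<close>, which the column recursion evaluates by the induction
      hypothesis; for \<open>j = k\<close> the definition of \<open>\<alpha>\<close> does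
      it.\<close>
    have 1: "w (Suc k) (v j x) = 0" if j: "j \<le> k" and x: "x \<in> X" for j x
    proof (cases "j = k")
      case True
      then show ?thesis
        using w_Suc[OF k(1) v[OF x], of k] IH[of k k x] IH[of "k - 1" k x] \<alpha>_eq[OF k(2) x] x \<beta>0 by auto
    next
      case False
      then have j: "j < k" "j < n" "Suc j \<le> k" using j k by auto
      have "w k (A (v j x)) = (if k = Suc j then \<beta> k x else 0)"
        using wAv[OF j(2) x, of k] IH[of k "Suc j" "\<beta> (Suc j) x"] IH[of k j "\<alpha> j x"] IH'[of k j x] j x \<alpha> \<beta> by auto
      moreover have "(if k = 0 then 0 else \<beta> k (w (k - 1) (v j x))) = (if k = Suc j then \<beta> k x else 0)"
        using IH[of "k - 1" j x] j x \<beta>0 by (cases k) auto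
      ultimately show ?thesis
        using w_Suc[OF k(1) v[OF x], of j] IH[of k j x] j x \<alpha>0 by simp
    qed
    have eq: "w i (v (Suc k) (\<beta> (Suc k) x)) = w i (A (v k x)) - w i (v k (\<alpha> k x)) - w i (if k = 0 then 0 else v (k - 1) x)"
      if "x \<in> X" for i x
      using wAv[OF k(1) that, of i] by simp
    \<comment> \<open>Old rows against the new column. The recursion yields the new column only
      after \<open>\<beta>\<close>, hence the argument \<open>\<beta> (Suc k) x\<close>.\<close>
    have 2: "w i (v (Suc k) (\<beta> (Suc k) x)) = 0" if i: "i \<le> k" and x: "x \<in> X" for i x
    proof (cases "i = k")
      case True
      then show ?thesis
        using eq[OF x, of k] IH[of k k "\<alpha> k x"] IH'[of k k x] \<alpha>_eq[OF k(2) x, symmetric] \<alpha>[OF x, of k] x by simp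
    next
      case False
      then have i: "i < k" "i < n" "Suc i \<le> k" using i k by auto
      have "w i (A (v k x)) = (if k = Suc i then x else 0)"
        using wA[OF i(2) v[OF x], of k] IH[of "Suc i" k x] IH[of i k x] IH[of "i - 1" k x] i x \<alpha>0 \<beta>0 by auto
      then show ?thesis
        using eq[OF x, of i] IH[of i k "\<alpha> k x"] IH'[of i k x] i x \<alpha>[OF x] by simp
    qed
    have 3: "w (Suc k) (v (Suc k) (\<beta> (Suc k) x)) = \<beta> (Suc k) x" if x: "x \<in> X" for x
    proof -
      have "w (Suc k) (if k = 0 then 0 else v (k - 1) x) = 0" using 1[of "k - 1" x] x w0 by auto
      then show ?thesis using eq[OF x, of "Suc k"] 1[of k "\<alpha> k x"] \<alpha>[OF x] \<beta>_eq[OF k(1) x] by simp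
    qed
    \<comment> \<open>Putting \<open>\<gamma> (Suc k) x\<close> for \<open>x\<close> removes the
      factor \<open>\<beta>\<close> again.\<close>
    have 4: "w i (v (Suc k) x) = (if i = Suc k then x else 0)" if "i \<le> Suc k" "x \<in> X" for i x
      using 2[of i "\<gamma> (Suc k) x"] 3[of "\<gamma> (Suc k) x"] \<beta>\<gamma>[OF k(1) that(2)] \<gamma>[OF that(2)] that by (auto simp: le_Suc_eq)
    show ?case
      using 1 4 IH by (auto simp: le_Suc_eq)
  qed
  have B: "w i (v j x) = (if i = j then x else 0)" if "i \<le> n" "j \<le> n" "x \<in> X" for i j x
    using main[of n] that by simp
  show "w i (v j x) = (if i = j then x else 0)" by (rule B) fact+
  show "w i (A (v j x)) = (if j = i then \<alpha> i x else if j = Suc i then x else if i = Suc j then \<beta> i x else 0)"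
  proof (cases "i < n")
    case True
    then show ?thesis
      using wA[OF True v[OF \<open>x \<in> X\<close>], of j] B[of "Suc i" j x] B[of i j x] B[of "i - 1" j x]
        \<open>j \<le> n\<close> \<open>x \<in> X\<close> \<alpha>0 \<beta>0 by auto
  next
    case False
    then have i: "i = n" using \<open>i \<le> n\<close> by simp
    show ?thesis
    proof (cases "j = n")
      case True
      then show ?thesis using \<alpha>_eq[of i x] i \<open>x \<in> X\<close> by simp
    next
      case False
      then have j: "j < n" using \<open>j \<le> n\<close> by simp
      have "w i (if j = 0 then 0 else v (j - 1) x) = 0"
        using B[of i "j - 1" x] i j \<open>x \<in> X\<close> w0 by auto
      then show ?thesis
        using wAv[OF j \<open>x \<in> X\<close>, of i] B[of i "Suc j" "\<beta> (Suc j) x"] B[of i j "\<alpha> j x"] i j \<alpha> \<beta> \<open>x \<in> X\<close> by auto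
    qed
  qed
qed

section \<open>The Lanczos recursion for operators\<close>

lemma additive_sum:
  fixes f :: "'a::ab_group_add \<Rightarrow> 'b::ab_group_add"
  assumes add: "\<And>y z. y \<in> Y \<Longrightarrow> z \<in> Y \<Longrightarrow> f (y + z) = f y + f z"
    and Y: "0 \<in> Y" "\<And>y z. y \<in> Y \<Longrightarrow> z \<in> Y \<Longrightarrow> y + z \<in> Y" and g: "\<And>i. i \<in> F \<Longrightarrow> g i \<in> Y"
  shows "f (\<Sum>i\<in>F. g i) = (\<Sum>i\<in>F. f (g i))"
proof -
  have f0: "f 0 = 0" using add[OF Y(1) Y(1)] by simp
  have "f (\<Sum>i\<in>F. g i) = (\<Sum>i\<in>F. f (g i)) \<and> (\<Sum>i\<in>F. g i) \<in> Y"
    using g by (induction F rule: infinite_finite_induct) (auto simp: f0 Y add)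
  then show ?thesis ..
qed

context nondegenerate_interval
begin

lemma opr_zero_op: "opr (\<lambda>_. 0)"
  by (simp add: opr_def TF_zero zero_fun_def fun_eq_iff)
    (use TF_zero in \<open>simp add: zero_fun_def\<close>)

lemma opr_id: "opr (\<lambda>\<phi>. \<phi>)"
  by (simp add: opr_def TF_cmult)

lemma opr_sum_op: "(\<And>i. i \<in> F \<Longrightarrow> opr (X i)) \<Longrightarrow> opr (\<lambda>\<phi>. \<Sum>i\<in>F. X i \<phi>)"
  by (induction F rule: infinite_finite_induct) (simp_all add: opr_zero_op opr_plus)

lemma opr_diff_op: "opr X \<Longrightarrow> opr Y \<Longrightarrow> opr (\<lambda>\<phi>. X \<phi> - Y \<phi>)"
  by (simp add: opr_def TF_diff fun_eq_iff algebra_simps)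

lemma Vol_sum:
  assumes "\<And>i. i \<in> F \<Longrightarrow> cinf2 (f i)" and p: "\<phi> \<in> TF"
  shows "Vol (\<lambda>x y. \<Sum>i\<in>F. f i x y) \<phi> = (\<Sum>i\<in>F. Vol (f i) \<phi>)"
  using assms(1)
  by (induction F rule: infinite_finite_induct) (simp_all add: Vol_zero Vol_add[OF _ cinf2_sum p])

lemma sint_sum:
  fixes f :: "'i \<Rightarrow> real \<Rightarrow> 'a::banach"
  assumes "\<And>i. i \<in> F \<Longrightarrow> continuous_on I (f i)" and ab: "a \<in> I" "b \<in> I"
  shows "sint a b (\<lambda>x. \<Sum>i\<in>F. f i x) = (\<Sum>i\<in>F. sint a b (f i))"
  using assms(1)
proof (induction F rule: infinite_finite_induct)
  case (insert i F)
  then show ?case using sint_add[OF _ _ ab, of "f i" "\<lambda>x. \<Sum>i\<in>F. f i x"] by (simp add: continuous_on_sum)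
qed (simp_all add: sint_def)

lemma psd_comp_order:
  assumes "psd m c X" "psd n d Y" "l = m + n"
  shows "psd l (\<lambda>t. c t * d t) (\<lambda>\<phi>. X (Y \<phi>))"
  using psd_comp[OF assms(1,2)] assms(3) by simp

text \<open>The default value 0 makes the result a linear operator for every \<open>X\<close>. The
  Lanczos recursion can therefore be defined for all \<open>k\<close>, also beyond the range where
  \<open>\<beta>\<close> is known to be invertible.\<close>

definition opinv :: "((real \<Rightarrow> complex) \<Rightarrow> real \<Rightarrow> complex) \<Rightarrow> (real \<Rightarrow> complex) \<Rightarrow> real \<Rightarrow> complex" where
  "opinv X = (let P = (\<lambda>Y. opr Y \<and> (\<forall>\<phi>\<in>TF. X (Y \<phi>) = \<phi> \<and> Y (X \<phi>) = \<phi>))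
     in if \<exists>Y. P Y then SOME Y. P Y else (\<lambda>_. 0))"

lemma opinv_opr: "opr (opinv X)"
  using someI_ex[of "\<lambda>Y. opr Y \<and> (\<forall>\<phi>\<in>TF. X (Y \<phi>) = \<phi> \<and> Y (X \<phi>) = \<phi>)"] opr_zero_op
  unfolding opinv_def Let_def by (simp split: if_splits)

text \<open>A two-sided inverse is unique on \<open>TF\<close>, so the chosen one shares its order
  and symbol with the one from \<open>psd_inverse\<close>.\<close>

lemma opinv_psd:
  assumes X: "psd m c X" and c: "\<And>t. t \<in> I \<Longrightarrow> c t \<noteq> 0"
  shows "psd (- m) (\<lambda>t. inverse (c t)) (opinv X)"
    and "\<phi> \<in> TF \<Longrightarrow> X (opinv X \<phi>) = \<phi>" and "\<phi> \<in> TF \<Longrightarrow> opinv X (X \<phi>) = \<phi>"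
proof -
  obtain Y where Y: "psd (- m) (\<lambda>t. inverse (c t)) Y" "\<And>\<phi>. \<phi> \<in> TF \<Longrightarrow> X (Y \<phi>) = \<phi>" "\<And>\<phi>. \<phi> \<in> TF \<Longrightarrow> Y (X \<phi>) = \<phi>"
    using psd_inverse[OF X c] by blast
  then have ex: "\<exists>Y. opr Y \<and> (\<forall>\<phi>\<in>TF. X (Y \<phi>) = \<phi> \<and> Y (X \<phi>) = \<phi>)" using psd_opr by blast
  then have s: "\<forall>\<phi>\<in>TF. X (opinv X \<phi>) = \<phi> \<and> opinv X (X \<phi>) = \<phi>"
    using someI_ex[OF ex] unfolding opinv_def Let_def by simp
  then show "\<phi> \<in> TF \<Longrightarrow> X (opinv X \<phi>) = \<phi>" "\<phi> \<in> TF \<Longrightarrow> opinv X (X \<phi>) = \<phi>" by auto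
  have "opinv X \<phi> = Y \<phi>" if p: "\<phi> \<in> TF" for \<phi>
  proof -
    have "opinv X (X (Y \<phi>)) = Y \<phi>" using s opr_TF[OF psd_opr[OF Y(1)] p] by blast
    then show ?thesis using Y(2)[OF p] by simp
  qed
  then show "psd (- m) (\<lambda>t. inverse (c t)) (opinv X)" by (rule psd_cong[OF Y(1)]) auto
qed

section \<open>Vectors of test functions, rows and matrices of operators\<close>

definition VF :: "('n \<Rightarrow> real \<Rightarrow> complex) set" where
  "VF = {F. \<forall>i. F i \<in> TF}"

lemma VF_I: "(\<And>i. F i \<in> TF) \<Longrightarrow> F \<in> VF" and VF_D: "F \<in> VF \<Longrightarrow> F i \<in> TF"
  by (auto simp: VF_def)

lemma VF_zero: "0 \<in> VF"
  and VF_add: "F \<in> VF \<Longrightarrow> G \<in> VF \<Longrightarrow> F + G \<in> VF"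
  and VF_diff: "F \<in> VF \<Longrightarrow> G \<in> VF \<Longrightarrow> F - G \<in> VF"
  by (simp_all add: VF_def TF_zero TF_add TF_diff)

lemma VF_sum: "(\<And>i. i \<in> S \<Longrightarrow> F i \<in> VF) \<Longrightarrow> (\<Sum>i\<in>S. F i) \<in> VF"
  by (induction S rule: infinite_finite_induct) (auto intro: VF_zero VF_add)

definition rowapp :: "('n::finite \<Rightarrow> (real \<Rightarrow> complex) \<Rightarrow> real \<Rightarrow> complex) \<Rightarrow> ('n \<Rightarrow> real \<Rightarrow> complex) \<Rightarrow> real \<Rightarrow> complex" where
  "rowapp r F = (\<Sum>i\<in>UNIV. r i (F i))"

definition matapp :: "('n::finite \<Rightarrow> 'n \<Rightarrow> real \<Rightarrow> real \<Rightarrow> complex) \<Rightarrow> ('n \<Rightarrow> real \<Rightarrow> complex) \<Rightarrow> 'n \<Rightarrow> real \<Rightarrow> complex" where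
  "matapp h F i = (\<Sum>j\<in>UNIV. Vol (h i j) (F j))"

lemma rowapp_TF: "(\<And>i. opr (r i)) \<Longrightarrow> F \<in> VF \<Longrightarrow> rowapp r F \<in> TF"
  unfolding rowapp_def by (rule TF_sum, rule opr_TF, blast, erule VF_D)

lemma rowapp_add: "(\<And>i. opr (r i)) \<Longrightarrow> F \<in> VF \<Longrightarrow> G \<in> VF \<Longrightarrow> rowapp r (F + G) = rowapp r F + rowapp r G"
  unfolding rowapp_def sum.distrib[symmetric] by (rule sum.cong[OF refl]) (unfold plus_fun_apply[of F G], rule opr_add, auto intro: VF_D)

lemma rowapp_diff: "(\<And>i. opr (r i)) \<Longrightarrow> F \<in> VF \<Longrightarrow> G \<in> VF \<Longrightarrow> rowapp r (F - G) = rowapp r F - rowapp r G"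
  unfolding rowapp_def sum_subtractf[symmetric] by (rule sum.cong[OF refl]) (unfold minus_apply[of F G], rule opr_diff, auto intro: VF_D)

lemma rowapp_sum:
  assumes "\<And>i. opr (r i)" "\<And>k. k \<in> S \<Longrightarrow> G k \<in> VF"
  shows "rowapp r (\<Sum>k\<in>S. G k) = (\<Sum>k\<in>S. rowapp r (G k))"
  by (rule additive_sum[where Y = VF, OF rowapp_add[OF assms(1)] VF_zero VF_add assms(2)])

lemma matapp_VF: "(\<And>i j. cinf2 (h i j)) \<Longrightarrow> F \<in> VF \<Longrightarrow> matapp h F \<in> VF"
  unfolding matapp_def by (rule VF_I, rule TF_sum, rule Vol_TF, blast, erule VF_D)

lemma matapp_add: "(\<And>i j. cinf2 (h i j)) \<Longrightarrow> F \<in> VF \<Longrightarrow> G \<in> VF \<Longrightarrow> matapp h (F + G) = matapp h F + matapp h G"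
  by (simp add: matapp_def fun_eq_iff opr_add[OF Vol_opr] VF_D sum_fun_apply sum.distrib)

lemma matapp_diff: "(\<And>i j. cinf2 (h i j)) \<Longrightarrow> F \<in> VF \<Longrightarrow> G \<in> VF \<Longrightarrow> matapp h (F - G) = matapp h F - matapp h G"
  by (simp add: matapp_def fun_eq_iff opr_diff[OF Vol_opr] VF_D sum_fun_apply sum_subtractf)

end

section \<open>The usual Lanczos algorithm at a fixed time\<close>

locale lanczos_setup = nondegenerate_interval I for I :: "real set" +
  fixes A :: "real \<Rightarrow> complex^'n^'n" and w v :: "complex^'n"
  assumes wv: "row_dot (herm w) v = 1"
    and no_bd: "\<And>t k. t \<in> I \<Longrightarrow> k \<in> {1..CARD('n) - 1} \<Longrightarrow> no_breakdown (A t) w v k"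
    and A_smooth: "\<And>i j. cinf I (\<lambda>t. A t $ i $ j)"
begin

definition lwp where "lwp k t = (case lanczos (A t) w v k of (x, _, _, _, _) \<Rightarrow> x)"
definition lw where "lw k t = (case lanczos (A t) w v k of (_, x, _, _, _) \<Rightarrow> x)"
definition lvp where "lvp k t = (case lanczos (A t) w v k of (_, _, x, _, _) \<Rightarrow> x)"
definition lv where "lv k t = (case lanczos (A t) w v k of (_, _, _, x, _) \<Rightarrow> x)"
definition lb where "lb k t = lanczos_b (A t) w v k"
definition la where "la k t = row_dot (lw k t) (A t *v lv k t)"

lemmas l_defs = lwp_def lw_def lvp_def lv_def lb_def la_def lanczos_b_def

lemma l_0: "lwp 0 t = 0" "lw 0 t = herm w" "lvp 0 t = 0" "lv 0 t = v" "lb 0 t = 0"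
  by (simp_all add: l_defs)

lemma l_Suc:
  "lwp (Suc k) t = lw k t"
  "lw (Suc k) t = lw k t v* A t - la k t *s lw k t - lb k t *s lwp k t"
  "lvp (Suc k) t = lv k t"
  "lb (Suc k) t = row_dot (lw (Suc k) t) (A t *v lv k t)"
  "lv (Suc k) t = inverse (lb (Suc k) t) *s (A t *v lv k t - la k t *s lv k t - lvp k t)"
  by (simp_all add: l_defs Let_def split: prod.split)

lemma lwp_lvp: "k > 0 \<Longrightarrow> lwp k t = lw (k - 1) t" "k > 0 \<Longrightarrow> lvp k t = lv (k - 1) t"
  by (cases k; simp add: l_Suc)+

lemma lb_nz: "t \<in> I \<Longrightarrow> 0 < k \<Longrightarrow> k < CARD('n) \<Longrightarrow> lb k t \<noteq> 0"
  using no_bd[of t k] by (simp add: no_breakdown_def lb_def)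

lemma row_dot_diff_left: "row_dot (x - y) z = row_dot x z - row_dot y z"
  and row_dot_diff_right: "row_dot z (x - y) = row_dot z x - row_dot z y"
  and row_dot_scale_left: "row_dot (c *s x) z = c * row_dot x z"
  and row_dot_scale_right: "row_dot z (c *s x) = c * row_dot z x"
  and row_dot_zero: "row_dot 0 z = 0" "row_dot z 0 = 0"
  for x y z :: "complex^'n"
  by (simp_all add: row_dot_def algebra_simps sum_subtractf sum_distrib_left)

lemma row_dot_vm: "row_dot (x v* M) z = row_dot x (M *v z)" for M :: "complex^'n^'n"
  unfolding row_dot_def vector_matrix_mult_def matrix_vector_mult_def
  by (simp add: sum_distrib_left sum_distrib_right) (subst sum.swap, simp add: mult_ac)

lemma l_biorthogonal:
  assumes t: "t \<in> I" and "i < CARD('n)" "j < CARD('n)"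
  shows "row_dot (lw i t) (lv j t) = (if i = j then 1 else 0)"
proof -
  have sm: "A t *v (x *s y) = x *s (A t *v y)" for x y by (simp add: vec.scale)
  have "row_dot (lw i t) (1 *s lv j t) = (if i = j then 1 else 0)"
  \<comment> \<open>In this instance \<open>v k\<close> sends a number to that multiple of the
    \<open>k\<close>th Lanczos vector, and evaluation at 1 gives the claim.\<close>
  proof (rule lanczos_biorthogonal(1)[where X = UNIV and Y = UNIV and A = "\<lambda>y. A t *v y" and v = "\<lambda>k x. x *s lv k t"
      and w = "\<lambda>k y. row_dot (lw k t) y" and \<alpha> = "\<lambda>k x. la k t * x" and \<beta> = "\<lambda>k x. lb k t * x"
      and \<gamma> = "\<lambda>k x. inverse (lb k t) * x" and n = "CARD('n) - 1"])
    fix k and x :: complex assume k: "k < CARD('n) - 1"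
    then have b: "lb (Suc k) t \<noteq> 0" using lb_nz[OF t, of "Suc k"] by simp
    show "(lb (Suc k) t * x) *s lv (Suc k) t = A t *v (x *s lv k t) - (la k t * x) *s lv k t -
        (if k = 0 then 0 else x *s lv (k - 1) t)"
      using b lwp_lvp(2)[of k t] l_0(3)[of t]
      by (auto simp: l_Suc(5) sm vec_eq_iff algebra_simps)
    show "lb (Suc k) t * (inverse (lb (Suc k) t) * x) = x" using b by simp
  next
    fix k and y :: "complex^'n"
    show "row_dot (lw (Suc k) t) y = row_dot (lw k t) (A t *v y) - la k t * row_dot (lw k t) y -
        (if k = 0 then 0 else lb k t * row_dot (lw (k - 1) t) y)"
      using lwp_lvp(1)[of k t] l_0(1)[of t]
      by (auto simp: l_Suc(2) row_dot_diff_left row_dot_scale_left row_dot_vm row_dot_zero)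
  qed (use assms in \<open>auto simp: row_dot_diff_right row_dot_scale_right l_0 wv la_def l_Suc(4) sm\<close>)
  then show ?thesis by simp
qed

text \<open>As many biorthogonal pairs as the dimension give square matrices, and for these a left
  inverse is a right inverse. In terms of symbols, \<open>V W\<close> agrees with the identity to
  leading order, which starts the proof of \<open>VW\<close>.\<close>

lemma l_completeness:
  assumes t: "t \<in> I"
  shows "(\<Sum>j<CARD('n). lv j t $ k * lw j t $ l) = (if k = l then 1 else 0)"
proof -
  obtain e where e: "bij_betw e (UNIV :: 'n set) {..<CARD('n)}"
    using ex_bij_betw_finite_nat[of "UNIV :: 'n set"] by (auto simp: lessThan_atLeast0)
  then have lt: "e i < CARD('n)" and inj: "e i = e j \<longleftrightarrow> i = j" for i j
    by (auto simp: bij_betw_def inj_on_def)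
  define P :: "complex^'n^'n" where "P = (\<chi> i l. lw (e i) t $ l)"
  define Q :: "complex^'n^'n" where "Q = (\<chi> l j. lv (e j) t $ l)"
  have "P ** Q = mat 1"
    using l_biorthogonal[OF t lt lt] inj
    by (simp add: P_def Q_def matrix_matrix_mult_def mat_def vec_eq_iff row_dot_def)
  then have "Q ** P = mat 1" by (simp add: matrix_left_right_inverse)
  then have "(\<Sum>i\<in>UNIV. lv (e i) t $ k * lw (e i) t $ l) = (if k = l then 1 else 0)"
    by (simp add: P_def Q_def matrix_matrix_mult_def mat_def vec_eq_iff)
  then show ?thesis using sum.reindex_bij_betw[OF e, of "\<lambda>j. lv j t $ k * lw j t $ l"] by simp
qed

section \<open>The Lanczos recursion with operator coefficients\<close>

definition A_entry :: "'n \<Rightarrow> 'n \<Rightarrow> real \<Rightarrow> real \<Rightarrow> complex" where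
  "A_entry i j t s = A t $ i $ j"

lemma A_entry_cinf2: "cinf2 (A_entry i j)"
  unfolding A_entry_def by (rule cinf2_fun1[OF A_smooth])

abbreviation "Aop \<equiv> matapp A_entry"

text \<open>The state \<open>(w\<^sub>k\<^sub>-\<^sub>1, w\<^sub>k, v\<^sub>k\<^sub>-\<^sub>1, v\<^sub>k, \<beta>\<^sub>k)\<close>, parallel to \<open>lanczos\<close>; it is meaningful for
  \<open>k < CARD('n)\<close>.\<close>

primrec ost where
  "ost 0 = (\<lambda>(i::'n) \<phi>. 0, \<lambda>i \<phi> t. cnj (w $ i) * \<phi> t, \<lambda>(i::'n) \<phi>. 0, \<lambda>i \<phi> t. v $ i * \<phi> t, \<lambda>\<phi>. 0)"
| "ost (Suc k) = (let (wp, wc, vp, vc, b) = ost k;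
      al = (\<lambda>\<phi>. rowapp wc (Aop (\<lambda>i. vc i \<phi>)));
      wn = (\<lambda>j \<phi>. (\<Sum>i\<in>UNIV. wc i (Vol (A_entry i j) \<phi>)) - al (wc j \<phi>) - b (wp j \<phi>));
      bn = (\<lambda>\<phi>. rowapp wn (Aop (\<lambda>i. vc i \<phi>)));
      g = opinv bn;
      vn = (\<lambda>i \<phi>. Aop (\<lambda>j. vc j (g \<phi>)) i - vc i (al (g \<phi>)) - vp i (g \<phi>))
    in (wc, wn, vc, vn, bn))"

definition Wp where "Wp k = (case ost k of (x, _, _, _, _) \<Rightarrow> x)"
definition W where "W k = (case ost k of (_, x, _, _, _) \<Rightarrow> x)"
definition Vp where "Vp k = (case ost k of (_, _, x, _, _) \<Rightarrow> x)"
definition V where "V k = (case ost k of (_, _, _, x, _) \<Rightarrow> x)"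
definition B where "B k = (case ost k of (_, _, _, _, x) \<Rightarrow> x)"
definition AL where "AL k \<phi> = rowapp (W k) (Aop (\<lambda>i. V k i \<phi>))"
definition G where "G k = opinv (B k)"

lemmas o_defs = Wp_def W_def Vp_def V_def B_def AL_def G_def

lemma o_0: "Wp 0 = (\<lambda>i \<phi>. 0)" "W 0 = (\<lambda>i \<phi> t. cnj (w $ i) * \<phi> t)" "Vp 0 = (\<lambda>i \<phi>. 0)"
    "V 0 = (\<lambda>i \<phi> t. v $ i * \<phi> t)" "B 0 = (\<lambda>\<phi>. 0)"
  by (simp_all add: o_defs)

lemma o_Suc:
  "Wp (Suc k) = W k"
  "W (Suc k) = (\<lambda>j \<phi>. (\<Sum>i\<in>UNIV. W k i (Vol (A_entry i j) \<phi>)) - AL k (W k j \<phi>) - B k (Wp k j \<phi>))"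
  "Vp (Suc k) = V k"
  "B (Suc k) = (\<lambda>\<phi>. rowapp (W (Suc k)) (Aop (\<lambda>i. V k i \<phi>)))"
  "V (Suc k) = (\<lambda>i \<phi>. Aop (\<lambda>j. V k j (G (Suc k) \<phi>)) i - V k i (AL k (G (Suc k) \<phi>)) - Vp k i (G (Suc k) \<phi>))"
  by (cases "ost k"; simp add: o_defs[abs_def] Let_def)+

lemma Wp_Vp: "k > 0 \<Longrightarrow> Wp k = W (k - 1)" "k > 0 \<Longrightarrow> Vp k = V (k - 1)"
  by (cases k; simp add: o_Suc)+

lemma opr_AL_of:
  assumes "\<And>i. opr (x i)" "\<And>i. opr (y i)"
  shows "opr (\<lambda>\<phi>. rowapp x (Aop (\<lambda>i. y i \<phi>)))"
  unfolding rowapp_def matapp_def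
  by (intro opr_sum_op opr_comp[OF assms(1)] opr_comp[OF Vol_opr[OF A_entry_cinf2]] assms(2))

lemma opr_state: "opr (Wp k i)" "opr (W k i)" "opr (Vp k i)" "opr (V k i)" "opr (B k)"
proof -
  have "(\<forall>i. opr (Wp k i) \<and> opr (W k i) \<and> opr (Vp k i) \<and> opr (V k i)) \<and> opr (B k)"
  proof (induction k)
    case 0
    show ?case unfolding o_0 by (intro conjI allI opr_zero_op opr_mult cinf_const)
  next
    case (Suc k)
    then have IH: "opr (Wp k i)" "opr (W k i)" "opr (Vp k i)" "opr (V k i)" "opr (B k)" for i by auto
    have al: "opr (AL k)" unfolding AL_def[abs_def] by (rule opr_AL_of[OF IH(2,4)])
    have W: "opr (W (Suc k) j)" for j
      unfolding o_Suc(2)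
      by (intro opr_diff_op opr_sum_op opr_comp[OF IH(2)] opr_comp[OF al] opr_comp[OF IH(5)] IH Vol_opr A_entry_cinf2)
    have g: "opr (G (Suc k))" unfolding G_def by (rule opinv_opr)
    have V: "opr (V (Suc k) i)" for i
      unfolding o_Suc(5) matapp_def
      by (intro opr_diff_op opr_sum_op opr_comp[OF Vol_opr[OF A_entry_cinf2]] opr_comp[OF IH(4)] opr_comp[OF IH(3)] opr_comp[OF al] g)
    have B: "opr (B (Suc k))"
      unfolding o_Suc(4) by (rule opr_AL_of[OF W IH(4)])
    show ?case unfolding o_Suc(1,3) by (intro conjI allI W V B IH)
  qed
  then show "opr (Wp k i)" "opr (W k i)" "opr (Vp k i)" "opr (V k i)" "opr (B k)" by auto
qed

lemma opr_AL: "opr (AL k)"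
  unfolding AL_def[abs_def] by (rule opr_AL_of[OF opr_state(2,4)])

lemma opr_G: "opr (G k)"
  unfolding G_def by (rule opinv_opr)

lemma V_VF: "\<phi> \<in> TF \<Longrightarrow> (\<lambda>i. V k i \<phi>) \<in> VF"
  by (rule VF_I, rule opr_TF, rule opr_state)

lemma psd_A_entry: "psd (- 1) (\<lambda>t. A t $ i $ j) (Vol (A_entry i j))"
  by (rule psd_cong[OF psd_Vol_iff[OF A_entry_cinf2[of i j]]], rule refl) (simp add: A_entry_def)

lemma psd_AL_of:
  assumes x: "\<And>i. psd m (\<lambda>t. c t $ i) (x i)" and y: "\<And>i. psd n (\<lambda>t. d t $ i) (y i)"
  shows "psd (m + n - 1) (\<lambda>t. row_dot (c t) (A t *v d t)) (\<lambda>\<phi>. rowapp x (Aop (\<lambda>i. y i \<phi>)))"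
  unfolding rowapp_def matapp_def row_dot_def matrix_vector_mult_def vec_lambda_beta
proof (rule psd_sum)
  fix i
  have "psd (- 1 + n) (\<lambda>t. \<Sum>j\<in>UNIV. A t $ i $ j * d t $ j) (\<lambda>\<phi>. \<Sum>j\<in>UNIV. Vol (A_entry i j) (y j \<phi>))"
    by (intro psd_sum psd_comp[OF psd_A_entry y])
  then show "psd (m + n - 1) (\<lambda>t. c t $ i * (\<Sum>j\<in>UNIV. A t $ i $ j * d t $ j)) (\<lambda>\<phi>. x i (\<Sum>j\<in>UNIV. Vol (A_entry i j) (y j \<phi>)))"
    by (rule psd_comp_order[OF x]) simp
qed

text \<open>In the step to \<open>k + 1\<close> the three terms of \<open>w\<close> have the same
  order, \<open>- k - 1\<close>, the last one as \<open>- 2 + (1 - k)\<close>. The three terms of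
  the numerator of \<open>v\<close> have order \<open>k - 1\<close>, and the inverse of
  \<open>\<beta>\<close> adds 2. No term drops out to lower order, so the symbols obey the recursion
  of the usual algorithm exactly.\<close>

lemma psd_state:
  assumes "k < CARD('n)"
  shows "psd (- int k) (\<lambda>t. lw k t $ i) (W k i)" and "psd (int k) (\<lambda>t. lv k t $ i) (V k i)"
    and "psd (- 2) (lb k) (B k)"
proof -
  have "k < CARD('n) \<Longrightarrow> (\<forall>i. psd (1 - int k) (\<lambda>t. lwp k t $ i) (Wp k i) \<and> psd (- int k) (\<lambda>t. lw k t $ i) (W k i) \<and>
      psd (int k - 1) (\<lambda>t. lvp k t $ i) (Vp k i) \<and> psd (int k) (\<lambda>t. lv k t $ i) (V k i)) \<and> psd (- 2) (lb k) (B k)"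
  proof (induction k)
    case 0
    have "lb 0 = (\<lambda>_. 0)" by (simp add: fun_eq_iff l_0)
    then show ?case using psd_zero[unfolded zero_fun_def]
      by (simp add: o_0 l_0 psd_zero psd_mult cinf_const herm_def)
  next
    case (Suc k)
    then have k: "k < CARD('n)" by simp
    have IH: "psd (1 - int k) (\<lambda>t. lwp k t $ i) (Wp k i)" "psd (- int k) (\<lambda>t. lw k t $ i) (W k i)"
      "psd (int k - 1) (\<lambda>t. lvp k t $ i) (Vp k i)" "psd (int k) (\<lambda>t. lv k t $ i) (V k i)" "psd (- 2) (lb k) (B k)" for i
      using Suc.IH[OF k] by auto
    have al: "psd (- 1) (la k) (AL k)"
      using psd_AL_of[of "- int k" "lw k" "W k" "int k" "lv k" "V k"] IH
      by (simp add: AL_def[abs_def] la_def[abs_def])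
    have W: "psd (- int (Suc k)) (\<lambda>t. lw (Suc k) t $ j) (W (Suc k) j)" for j
    proof -
      have "psd (- int (Suc k)) (\<lambda>t. (\<Sum>i\<in>UNIV. lw k t $ i * A t $ i $ j) - la k t * lw k t $ j - lb k t * lwp k t $ j)
          (\<lambda>\<phi>. (\<Sum>i\<in>UNIV. W k i (Vol (A_entry i j) \<phi>)) - AL k (W k j \<phi>) - B k (Wp k j \<phi>))"
        by (intro psd_diff psd_sum psd_comp_order[OF IH(2) psd_A_entry] psd_comp_order[OF al IH(2)] psd_comp_order[OF IH(5) IH(1)]) auto
      then show ?thesis
        unfolding o_Suc(2) by (rule psd_cong) (auto simp: l_Suc(2) vector_matrix_mult_def mult.commute)
    qed
    have B: "psd (- 2) (lb (Suc k)) (B (Suc k))"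
      using psd_AL_of[of "- int (Suc k)" "lw (Suc k)" "W (Suc k)" "int k" "lv k" "V k"] IH W
      by (simp add: o_Suc(4) l_Suc(4)[abs_def])
    have g: "psd 2 (\<lambda>t. inverse (lb (Suc k) t)) (G (Suc k))"
      using opinv_psd(1)[OF B lb_nz] Suc.prems by (simp add: G_def)
    have V: "psd (int (Suc k)) (\<lambda>t. lv (Suc k) t $ i) (V (Suc k) i)" for i
    proof -
      have "psd (int k - 1) (\<lambda>t. (\<Sum>j\<in>UNIV. A t $ i $ j * lv k t $ j) - lv k t $ i * la k t - lvp k t $ i)
          (\<lambda>\<phi>. (\<Sum>j\<in>UNIV. Vol (A_entry i j) (V k j \<phi>)) - V k i (AL k \<phi>) - Vp k i \<phi>)"
        by (intro psd_diff psd_sum psd_comp_order[OF psd_A_entry IH(4)] psd_comp_order[OF IH(4) al] IH(3)) auto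
      from psd_comp_order[OF this g, of "int (Suc k)"]
      have "psd (int (Suc k)) (\<lambda>t. ((\<Sum>j\<in>UNIV. A t $ i $ j * lv k t $ j) - lv k t $ i * la k t - lvp k t $ i) * inverse (lb (Suc k) t)) (V (Suc k) i)"
        by (simp add: o_Suc(5) matapp_def)
      then show ?thesis
        by (rule psd_cong) (auto simp: l_Suc(5) matrix_vector_mult_def algebra_simps)
    qed
    show ?case using W V B IH by (simp add: l_Suc(1,3) o_Suc(1,3))
  qed
  then show "psd (- int k) (\<lambda>t. lw k t $ i) (W k i)" "psd (int k) (\<lambda>t. lv k t $ i) (V k i)" "psd (- 2) (lb k) (B k)"
    using assms by auto
qed

lemma psd_AL: "k < CARD('n) \<Longrightarrow> psd (- 1) (la k) (AL k)"
  using psd_AL_of[of "- int k" "lw k" "W k" "int k" "lv k" "V k"] psd_state[of k]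
  by (simp add: AL_def[abs_def] la_def[abs_def])

lemma
  assumes ij: "i < CARD('n)" "j < CARD('n)" and p: "\<phi> \<in> TF"
  shows WV: "rowapp (W i) (\<lambda>l. V j l \<phi>) = (if i = j then \<phi> else 0)" (is ?th1)
    and WAV: "rowapp (W i) (Aop (\<lambda>l. V j l \<phi>)) =
      (if j = i then AL i \<phi> else if j = Suc i then \<phi> else if i = Suc j then B i \<phi> else 0)" (is ?th2)
proof -
  \<comment> \<open>The symbol of \<open>B (Suc k)\<close> is the coefficient \<open>b\<close> of
    the usual algorithm, so the absence of breakdown makes \<open>G\<close> a genuine
    inverse.\<close>
  have BG: "B (Suc k) (G (Suc k) \<psi>) = \<psi>" "G (Suc k) (B (Suc k) \<psi>) = \<psi>"
    if "k < CARD('n) - 1" "\<psi> \<in> TF" for k \<psi>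
    using opinv_psd(2,3)[OF psd_state(3) lb_nz, of "Suc k" \<psi>] that by (simp_all add: G_def)
  have start: "rowapp (W 0) (\<lambda>l. V 0 l \<psi>) = \<psi>" for \<psi>
  proof -
    have "(\<Sum>i\<in>UNIV. cnj (w $ i) * (v $ i * x)) = x" for x
      using wv by (simp add: row_dot_def herm_def mult.assoc[symmetric] sum_distrib_right[symmetric])
    then show ?thesis by (simp add: rowapp_def o_0 fun_eq_iff sum_fun_apply)
  qed
  have w_Suc: "rowapp (W (Suc k)) F = rowapp (W k) (Aop F) - AL k (rowapp (W k) F) -
      (if k = 0 then 0 else B k (rowapp (W (k - 1)) F))" if F: "F \<in> VF" for k F
  proof -
    have 1: "(\<Sum>j\<in>UNIV. \<Sum>i\<in>UNIV. W k i (Vol (A_entry i j) (F j))) = rowapp (W k) (Aop F)"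
      unfolding rowapp_def matapp_def
      by (subst sum.swap) (simp add: opr_sum[OF opr_state(2)] Vol_TF A_entry_cinf2 VF_D[OF F])
    have 2: "(\<Sum>j\<in>UNIV. AL k (W k j (F j))) = AL k (rowapp (W k) F)"
      unfolding rowapp_def using opr_TF[OF opr_state(2) VF_D[OF F]] by (simp add: opr_sum[OF opr_AL])
    have 3: "(\<Sum>j\<in>UNIV. B k (Wp k j (F j))) = (if k = 0 then 0 else B k (rowapp (W (k - 1)) F))"
      using opr_TF[OF opr_state(2) VF_D[OF F], of "k - 1"] Wp_Vp(1)[of k]
      by (auto simp: rowapp_def opr_sum[OF opr_state(5)] o_0)
    have "rowapp (W (Suc k)) F = (\<Sum>j\<in>UNIV. W (Suc k) j (F j))" by (rule rowapp_def)
    then show ?thesis unfolding o_Suc(2) sum_subtractf 1 2 3 .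
  qed
  \<comment> \<open>\<open>V (Suc k)\<close> divides by \<open>\<beta>\<close> on the right, so
    applying it after \<open>B\<close> cancels the division; the side matters because operators do
    not commute.\<close>
  have v_Suc: "(\<lambda>l. V (Suc k) l (B (Suc k) \<psi>)) = Aop (\<lambda>l. V k l \<psi>) - (\<lambda>l. V k l (AL k \<psi>)) - (if k = 0 then 0 else (\<lambda>l. V (k - 1) l \<psi>))"
    if "k < CARD('n) - 1" "\<psi> \<in> TF" for k \<psi>
    unfolding o_Suc(5) BG(2)[OF that] by (cases "k = 0") (simp_all add: fun_eq_iff Wp_Vp(2) o_0(3))
  note L = lanczos_biorthogonal[where X = TF and Y = VF and A = Aop and v = "\<lambda>k \<phi> l. V k l \<phi>"
      and w = "\<lambda>k. rowapp (W k)" and \<alpha> = AL and \<beta> = B and \<gamma> = G and n = "CARD('n) - 1" and i = i and j = j and x = \<phi>]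
  note facts = TF_zero VF_diff matapp_VF[OF A_entry_cinf2] V_VF opr_TF[OF opr_AL] opr_TF[OF opr_state(5)] opr_TF[OF opr_G]
    rowapp_diff[OF opr_state(2)] opr_zero[OF opr_AL] opr_zero[OF opr_state(5)] start w_Suc v_Suc BG(1) ij p AL_def o_Suc(4)
  show ?th1 by (rule L(1)) (use facts in auto)
  show ?th2 by (rule L(2)) (use facts in auto)
qed

lemma AopV_VF: "\<phi> \<in> TF \<Longrightarrow> Aop (\<lambda>i. V k i \<phi>) \<in> VF"
  by (rule matapp_VF[OF A_entry_cinf2 V_VF])

lemma W_additive: "rowapp (W k) (\<Sum>m\<in>S. F m) = (\<Sum>m\<in>S. rowapp (W k) (F m))" if "\<And>m. m \<in> S \<Longrightarrow> F m \<in> VF"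
  by (rule rowapp_sum[OF opr_state(2) that])

text \<open>\<open>1 - V W\<close> is an idempotent of order \<open>-1\<close>, hence a Volterra operator equal to its own
  square, and such an operator has no nonzero fixed points.\<close>

lemma VW:
  assumes F: "F \<in> VF"
  shows "(\<Sum>j<CARD('n). (\<lambda>l. V j l (rowapp (W j) F))) = F"
proof -
  define P where "P F = (\<Sum>j<CARD('n). (\<lambda>l. V j l (rowapp (W j) F)))" for F
  have r: "rowapp (W j) F \<in> TF" if "F \<in> VF" for F j by (rule rowapp_TF[OF opr_state(2) that])
  have P_VF: "P F \<in> VF" if "F \<in> VF" for F
    unfolding P_def by (rule VF_sum, rule V_VF, rule r[OF that])
  have WP: "rowapp (W i) (P F) = rowapp (W i) F" if i: "i < CARD('n)" and F: "F \<in> VF" for i F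
  proof -
    have "rowapp (W i) (P F) = (\<Sum>j<CARD('n). rowapp (W i) (\<lambda>l. V j l (rowapp (W j) F)))"
      unfolding P_def by (rule W_additive) (rule V_VF[OF r[OF F]])
    also have "\<dots> = (\<Sum>j<CARD('n). if i = j then rowapp (W j) F else 0)"
      by (rule sum.cong) (use WV[OF i _ r[OF F]] in auto)
    finally show ?thesis using i by simp
  qed
  \<comment> \<open>The matrix entries of the complementary projection \<open>1 - V W\<close>. By
    \<open>l_completeness\<close> their symbols vanish, which leaves a smooth kernel
    \<open>h k l\<close> for each.\<close>
  define D where "D k l \<phi> = (if k = l then \<phi> else 0) - (\<Sum>j<CARD('n). V j k (W j l \<phi>))" for k l \<phi>
  have "\<exists>h. cinf2 h \<and> (\<forall>\<phi>\<in>TF. D k l \<phi> = Vol h \<phi>)" for k l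
  proof -
    have 1: "psd 0 (\<lambda>t. if k = l then 1 else 0) (\<lambda>\<phi>. if k = l then \<phi> else 0)"
      using psd_volt[OF volt_id] psd_zero[of 0] by (cases "k = l") auto
    have "psd 0 (\<lambda>t. (if k = l then 1 else 0) - (\<Sum>j<CARD('n). lv j t $ k * lw j t $ l)) (D k l)"
      unfolding D_def[abs_def]
      by (rule psd_diff[OF 1 psd_sum], rule psd_comp_order[OF psd_state(2) psd_state(1)]) auto
    then have "psd 0 (\<lambda>_. 0) (D k l)"
      by (rule psd_cong) (simp_all add: l_completeness)
    then obtain Y where Y: "volt (\<lambda>_. 0) Y" "\<forall>\<phi>\<in>TF. D k l \<phi> = Y \<phi>" unfolding psd_def by auto
    obtain h where h: "cinf I (\<lambda>_. 0 :: complex)" "cinf2 h" "\<And>\<phi>. \<phi> \<in> TF \<Longrightarrow> Y \<phi> = (\<lambda>t. 0 * \<phi> t) + Vol h \<phi>"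
      using voltE[OF Y(1)] by blast
    then show ?thesis using Y(2) by (intro exI[of _ h]) (simp add: fun_eq_iff)
  qed
  then obtain h where h: "\<And>k l. cinf2 (h k l)" "\<And>k l \<phi>. \<phi> \<in> TF \<Longrightarrow> D k l \<phi> = Vol (h k l) \<phi>" by metis
  have D: "(F - P F) k = (\<Sum>l\<in>UNIV. D k l (F l))" if F: "F \<in> VF" for F k
  proof -
    have "V j k (rowapp (W j) F) = (\<Sum>l\<in>UNIV. V j k (W j l (F l)))" for j
      unfolding rowapp_def by (rule opr_sum[OF opr_state(4) opr_TF[OF opr_state(2) VF_D[OF F]]])
    then have "(\<Sum>l\<in>UNIV. \<Sum>j<CARD('n). V j k (W j l (F l))) = P F k"
      unfolding P_def sum_fun_apply[of _ _ k] by (subst sum.swap) (simp only:)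
    then show ?thesis by (simp add: D_def sum_subtractf)
  qed
  \<comment> \<open>The defect lies in the range of the projection. It is annihilated by every
    \<open>W j\<close> because of \<open>W V = 1\<close>, so it is a fixed point of the matrix of
    Volterra operators \<open>h\<close>.\<close>
  define X where "X = F - P F"
  have X: "X \<in> VF" unfolding X_def by (intro VF_diff P_VF F)
  have W0: "rowapp (W j) X = 0" if "j < CARD('n)" for j
    unfolding X_def using WP[OF that F] rowapp_diff[OF opr_state(2) F P_VF[OF F]] by simp
  have "P X = 0"
    unfolding P_def
  proof (rule sum.neutral, rule ballI)
    fix j assume "j \<in> {..<CARD('n)}"
    then have "rowapp (W j) X = 0" using W0 by simp
    then show "(\<lambda>l. V j l (rowapp (W j) X)) = 0"
      by (intro ext) (simp only: opr_zero[OF opr_state(4)] zero_fun_apply)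
  qed
  then have "X k = (\<Sum>l\<in>UNIV. Vol (h k l) (X l))" for k
    using D[OF X, of k] h(2)[OF VF_D[OF X]] by simp
  then have "X k = 0" for k by (rule volterra_fixpoint_zero[OF VF_D[OF X] h(1)])
  then show ?thesis unfolding X_def P_def by (simp add: fun_eq_iff)
qed

end

section \<open>The resolvent of the time-dependent matrix\<close>

lemma bounded_bilinear_matrix_mult:
  "bounded_bilinear ((**) :: complex^'n^'n \<Rightarrow> complex^'n^'n \<Rightarrow> complex^'n^'n)"
proof -
  have "bilinear ((**) :: complex^'n^'n \<Rightarrow> complex^'n^'n \<Rightarrow> complex^'n^'n)"
    unfolding bilinear_def
    by (auto intro!: linearI simp: matrix_matrix_mult_def vec_eq_iff algebra_simps sum.distrib scaleR_sum_right)
  then show ?thesis by (simp add: bilinear_conv_bounded_bilinear)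
qed

sublocale nondegenerate_interval \<subseteq> mm: volterra_product I "(**) :: complex^'n^'n \<Rightarrow> complex^'n^'n \<Rightarrow> complex^'n^'n"
  by (intro_locales, rule bounded_bilinear_matrix_mult) (unfold_locales, simp add: matrix_mul_assoc)

context lanczos_setup
begin

lemma A_cinf: "cinf I A"
proof -
  have l: "bounded_linear (\<lambda>z::complex. axis i (axis j z) :: complex^'n^'n)" for i j
    by (rule linear_conv_bounded_linear[THEN iffD1], rule linearI) (auto simp: axis_def vec_eq_iff)
  have "cinf I (\<lambda>t. \<Sum>i\<in>UNIV. \<Sum>j\<in>UNIV. axis i (axis j (A t $ i $ j)) :: complex^'n^'n)"
    by (intro cinf_sum cinf_linear[OF l] A_smooth)
  moreover have "(\<Sum>i\<in>UNIV. \<Sum>j\<in>UNIV. axis i (axis j (A t $ i $ j))) = A t" for t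
  proof -
    have "(\<Sum>i\<in>UNIV. \<Sum>j\<in>UNIV. axis i (axis j (A t $ i $ j))) $ k $ l = A t $ k $ l" for k l
    proof -
      have "(\<Sum>j\<in>UNIV. axis i (axis j (A t $ i $ j)) $ k $ l) = (\<Sum>j\<in>UNIV. if l = j then if k = i then A t $ i $ j else 0 else 0)" for i
        by (rule sum.cong) (auto simp: axis_def)
      then show ?thesis by simp
    qed
    then show ?thesis by (simp add: vec_eq_iff)
  qed
  ultimately show ?thesis by simp
qed

text \<open>Stands for the sum of the \<open>*\<close>-powers of \<open>A\<close> from the first on.
  Both resolvent equations are kept: one makes \<open>1 + K\<close> a right inverse of
  \<open>1 - A\<close>, the other a left inverse.\<close>

definition K where
  "K = (SOME K. cinf2 K \<and> (\<forall>x\<in>I. \<forall>y\<in>I. K x y = A x + mm.vstar (\<lambda>x y. A x) K x y \<and> K x y = A x + mm.vstar K (\<lambda>x y. A x) x y))"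

lemma K_facts: "cinf2 K"
  "x \<in> I \<Longrightarrow> y \<in> I \<Longrightarrow> K x y = A x + mm.vstar (\<lambda>x y. A x) K x y"
  "x \<in> I \<Longrightarrow> y \<in> I \<Longrightarrow> K x y = A x + mm.vstar K (\<lambda>x y. A x) x y"
  using someI_ex[OF mm.resolvent_exists[OF cinf2_fun1[OF A_cinf]]] unfolding K_def[symmetric] by blast+

definition K_entry :: "'n \<Rightarrow> 'n \<Rightarrow> real \<Rightarrow> real \<Rightarrow> complex" where
  "K_entry i j x y = K x y $ i $ j"

lemma bounded_linear_entry: "bounded_linear (\<lambda>M::complex^'n^'n. M $ i $ j)"
  by (intro bounded_linear_compose[OF bounded_linear_vec_nth bounded_linear_vec_nth, unfolded o_def])

lemma K_entry_cinf2: "cinf2 (K_entry i j)"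
  unfolding K_entry_def using cinf_linear[OF bounded_linear_entry K_facts(1)] by (simp add: split_beta')

lemma vstar_entry:
  fixes P Q :: "real \<Rightarrow> real \<Rightarrow> complex^'n^'n"
  assumes "cinf2 P" "cinf2 Q" "x \<in> I" "y \<in> I"
  shows "mm.vstar P Q x y $ i $ j = (\<Sum>l\<in>UNIV. cm.vstar (\<lambda>x y. P x y $ i $ l) (\<lambda>x y. Q x y $ l $ j) x y)"
proof -
  have e: "cinf2 (\<lambda>x y. P x y $ i $ l)" "cinf2 (\<lambda>x y. Q x y $ l $ j)" for l
    using cinf_linear[OF bounded_linear_entry assms(1)] cinf_linear[OF bounded_linear_entry assms(2)]
    by (simp_all add: split_beta')
  have "mm.vstar P Q x y $ i $ j = sint y x (\<lambda>t. (P x t ** Q t y) $ i $ j)"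
    unfolding mm.vstar_def
    by (rule sint_linear[OF bounded_linear_entry, symmetric])
      (intro mm.continuous_integrand cinf2_Ck0 assms)+
  also have "\<dots> = sint y x (\<lambda>t. \<Sum>l\<in>UNIV. P x t $ i $ l * Q t y $ l $ j)"
    by (simp add: matrix_matrix_mult_def)
  also have "\<dots> = (\<Sum>l\<in>UNIV. cm.vstar (\<lambda>x y. P x y $ i $ l) (\<lambda>x y. Q x y $ l $ j) x y)"
    unfolding cm.vstar_def
    by (rule sint_sum) (intro cm.continuous_integrand cinf2_Ck0 e assms)+
  finally show ?thesis .
qed

lemma matapp_matapp:
  assumes f: "\<And>i j. cinf2 (f i j)" and g: "\<And>i j. cinf2 (g i j)" and F: "F \<in> VF"
  shows "matapp f (matapp g F) = matapp (\<lambda>i j x y. \<Sum>l\<in>UNIV. cm.vstar (f i l) (g l j) x y) F"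
proof
  fix i
  have "matapp f (matapp g F) i = (\<Sum>l\<in>UNIV. \<Sum>j\<in>UNIV. Vol (f i l) (Vol (g l j) (F j)))"
    unfolding matapp_def by (simp add: opr_sum[OF Vol_opr[OF f]] Vol_TF[OF g VF_D[OF F]])
  also have "\<dots> = (\<Sum>j\<in>UNIV. \<Sum>l\<in>UNIV. Vol (cm.vstar (f i l) (g l j)) (F j))"
    by (subst sum.swap) (simp add: Vol_comp[OF f g VF_D[OF F]])
  also have "\<dots> = matapp (\<lambda>i j x y. \<Sum>l\<in>UNIV. cm.vstar (f i l) (g l j) x y) F i"
    unfolding matapp_def by (simp add: Vol_sum[OF cinf2_vstar[OF f g] VF_D[OF F]])
  finally show "matapp f (matapp g F) i = matapp (\<lambda>i j x y. \<Sum>l\<in>UNIV. cm.vstar (f i l) (g l j) x y) F i" .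
qed

lemma matapp_plus:
  assumes f: "\<And>i j. cinf2 (f i j)" and g: "\<And>i j. cinf2 (g i j)" and F: "F \<in> VF"
  shows "matapp (\<lambda>i j x y. f i j x y + g i j x y) F = matapp f F + matapp g F"
  unfolding matapp_def by (simp add: fun_eq_iff Vol_add[OF f g VF_D[OF F]] sum_fun_apply sum.distrib)

lemma matapp_cong:
  assumes "\<And>i j x y. x \<in> I \<Longrightarrow> y \<in> I \<Longrightarrow> f i j x y = g i j x y"
  shows "matapp f F = matapp g F"
  unfolding matapp_def using Vol_cong[OF assms] by (simp only:)

abbreviation "Kop \<equiv> matapp K_entry"

lemma Kop_eq:
  assumes F: "F \<in> VF"
  shows "Kop F = Aop F + Aop (Kop F)" and "Kop F = Aop F + Kop (Aop F)"
proof -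
  have v: "cinf2 (\<lambda>x y. \<Sum>l\<in>UNIV. cm.vstar (A_entry i l) (K_entry l j) x y)" "cinf2 (\<lambda>x y. \<Sum>l\<in>UNIV. cm.vstar (K_entry i l) (A_entry l j) x y)" for i j
    by (intro cinf2_sum cinf2_vstar A_entry_cinf2 K_entry_cinf2)+
  have A2: "cinf2 (\<lambda>x y. A x)" by (rule cinf2_fun1[OF A_cinf])
  have "Kop F = matapp (\<lambda>i j x y. A_entry i j x y + (\<Sum>l\<in>UNIV. cm.vstar (A_entry i l) (K_entry l j) x y)) F"
  proof (rule matapp_cong)
    fix i j x y assume xy: "x \<in> I" "y \<in> I"
    show "K_entry i j x y = A_entry i j x y + (\<Sum>l\<in>UNIV. cm.vstar (A_entry i l) (K_entry l j) x y)"
      using arg_cong[OF K_facts(2)[OF xy], of "\<lambda>M. M $ i $ j"] vstar_entry[OF A2 K_facts(1) xy, of i j]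
      by (simp add: K_entry_def[abs_def] A_entry_def[abs_def])
  qed
  then show "Kop F = Aop F + Aop (Kop F)"
    unfolding matapp_plus[OF A_entry_cinf2 v(1) F] matapp_matapp[OF A_entry_cinf2 K_entry_cinf2 F] .
  have "Kop F = matapp (\<lambda>i j x y. A_entry i j x y + (\<Sum>l\<in>UNIV. cm.vstar (K_entry i l) (A_entry l j) x y)) F"
  proof (rule matapp_cong)
    fix i j x y assume xy: "x \<in> I" "y \<in> I"
    show "K_entry i j x y = A_entry i j x y + (\<Sum>l\<in>UNIV. cm.vstar (K_entry i l) (A_entry l j) x y)"
      using arg_cong[OF K_facts(3)[OF xy], of "\<lambda>M. M $ i $ j"] vstar_entry[OF K_facts(1) A2 xy, of i j]
      by (simp add: K_entry_def[abs_def] A_entry_def[abs_def])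
  qed
  then show "Kop F = Aop F + Kop (Aop F)"
    unfolding matapp_plus[OF A_entry_cinf2 v(2) F] matapp_matapp[OF K_entry_cinf2 A_entry_cinf2 F] .
qed

end

section \<open>The tridiagonal matrix\<close>

lemma kmat_star_eq: "kmat_star S P Q i j = (\<lambda>t \<phi>. \<Sum>k\<in>S. star (P i k) (Q k j) t \<phi>)"
  by (simp add: fun_eq_iff kmat_star_def)

context nondegenerate_interval
begin

lemma rep_kmat_star:
  assumes "\<And>k. k \<in> S \<Longrightarrow> rep (P i k) (X k)" "\<And>k. k \<in> S \<Longrightarrow> rep (Q k j) (Y k)" "\<And>k. k \<in> S \<Longrightarrow> opr (Y k)"
  shows "rep (kmat_star S P Q i j) (\<lambda>\<phi>. \<Sum>k\<in>S. X k (Y k \<phi>))"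
  unfolding kmat_star_eq by (rule rep_sum) (rule rep_star[OF assms])

lemma rep_kmat_one: "rep (kmat_one I i j) (\<lambda>\<phi>. if i = j then \<phi> else 0)"
  using rep_star_one rep_zero by (auto simp: kmat_one_def)

end

context lanczos_setup
begin

definition PK :: "('n \<Rightarrow> real \<Rightarrow> complex) \<Rightarrow> 'n \<Rightarrow> real \<Rightarrow> complex" where "PK F = F + Kop F"
definition PA :: "('n \<Rightarrow> real \<Rightarrow> complex) \<Rightarrow> 'n \<Rightarrow> real \<Rightarrow> complex" where "PA F = F - Aop F"

lemma Kop_VF: "F \<in> VF \<Longrightarrow> Kop F \<in> VF" and Aop_VF: "F \<in> VF \<Longrightarrow> Aop F \<in> VF"
  by (auto intro: matapp_VF K_entry_cinf2 A_entry_cinf2)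

lemma PK_VF: "F \<in> VF \<Longrightarrow> PK F \<in> VF" and PA_VF: "F \<in> VF \<Longrightarrow> PA F \<in> VF"
  unfolding PK_def PA_def by (auto intro: VF_add VF_diff Kop_VF Aop_VF)

lemma Aop_add: "F \<in> VF \<Longrightarrow> H \<in> VF \<Longrightarrow> Aop (F + H) = Aop F + Aop H"
  by (rule matapp_add[OF A_entry_cinf2])

lemma PK_add: "F \<in> VF \<Longrightarrow> H \<in> VF \<Longrightarrow> PK (F + H) = PK F + PK H"
  unfolding PK_def by (subst matapp_add[OF K_entry_cinf2]) auto

lemma PA_add: "F \<in> VF \<Longrightarrow> H \<in> VF \<Longrightarrow> PA (F + H) = PA F + PA H"
  unfolding PA_def by (subst matapp_add[OF A_entry_cinf2]) auto

lemma PA_PK: "F \<in> VF \<Longrightarrow> PA (PK F) = F"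
  using Kop_eq(1)[of F] Aop_add[OF _ Kop_VF, of F F] by (simp add: PA_def PK_def algebra_simps)

lemma PK_PA: "F \<in> VF \<Longrightarrow> PK (PA F) = F"
proof -
  assume F: "F \<in> VF"
  have "Kop (F - Aop F) = Kop F - Kop (Aop F)" by (rule matapp_diff[OF K_entry_cinf2 F Aop_VF[OF F]])
  then show ?thesis using Kop_eq(2)[OF F] by (simp add: PA_def PK_def)
qed

text \<open>Insertion of \<open>V W = 1\<close>. It makes the passage from \<open>Q\<close> to
  \<open>W Q V\<close> multiplicative, which gives both the powers of \<open>T\<close> and the two
  sides of its resolvent identity.\<close>

lemma sandwich:
  assumes Q: "\<And>F H. F \<in> VF \<Longrightarrow> H \<in> VF \<Longrightarrow> Q (F + H) = Q F + Q H" "\<And>F. F \<in> VF \<Longrightarrow> Q F \<in> VF" and Z: "Z \<in> VF"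
  shows "(\<Sum>k<CARD('n). rowapp (W i) (Q (\<lambda>l. V k l (rowapp (W k) Z)))) = rowapp (W i) (Q Z)"
proof -
  have VW_VF: "(\<lambda>l. V k l (rowapp (W k) Z)) \<in> VF" for k
    by (rule V_VF[OF rowapp_TF[OF opr_state(2) Z]])
  have "(\<Sum>k<CARD('n). rowapp (W i) (Q (\<lambda>l. V k l (rowapp (W k) Z))))
      = rowapp (W i) (\<Sum>k<CARD('n). Q (\<lambda>l. V k l (rowapp (W k) Z)))"
    by (rule W_additive[symmetric]) (rule Q(2)[OF VW_VF])
  also have "(\<Sum>k<CARD('n). Q (\<lambda>l. V k l (rowapp (W k) Z))) = Q (\<Sum>k<CARD('n). (\<lambda>l. V k l (rowapp (W k) Z)))"
    by (rule additive_sum[where Y = VF, OF Q(1) VF_zero VF_add VW_VF, symmetric])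
  finally show ?thesis by (simp only: VW[OF Z])
qed

lemma opr_rowapp: "(\<And>i. opr (\<lambda>\<phi>. \<Phi> \<phi> i)) \<Longrightarrow> opr (\<lambda>\<phi>. rowapp (W m) (\<Phi> \<phi>))"
  unfolding rowapp_def by (rule opr_sum_op) (rule opr_comp[OF opr_state(2)], blast)

lemma opr_matapp: "(\<And>i j. cinf2 (h i j)) \<Longrightarrow> (\<And>i. opr (\<lambda>\<phi>. \<Phi> \<phi> i)) \<Longrightarrow> opr (\<lambda>\<phi>. matapp h (\<Phi> \<phi>) i)"
  unfolding matapp_def by (rule opr_sum_op) (rule opr_comp[OF Vol_opr], blast+)

lemma opr_PK: "(\<And>i. opr (\<lambda>\<phi>. \<Phi> \<phi> i)) \<Longrightarrow> opr (\<lambda>\<phi>. PK (\<Phi> \<phi>) i)"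
  unfolding PK_def plus_fun_apply[of _ "Kop _"] by (rule opr_plus) (auto intro: opr_matapp K_entry_cinf2)

lemma opr_PA: "(\<And>i. opr (\<lambda>\<phi>. \<Phi> \<phi> i)) \<Longrightarrow> opr (\<lambda>\<phi>. PA (\<Phi> \<phi>) i)"
  unfolding PA_def minus_apply[of _ "Aop _"] by (rule opr_diff_op) (auto intro: opr_matapp A_entry_cinf2)

lemma opr_Aop_power: "(\<And>i. opr (\<lambda>\<phi>. \<Phi> \<phi> i)) \<Longrightarrow> opr (\<lambda>\<phi>. (Aop ^^ n) (\<Phi> \<phi>) i)"
  by (induction n arbitrary: i) (auto intro: opr_matapp A_entry_cinf2)

lemma Aop_power_VF: "F \<in> VF \<Longrightarrow> (Aop ^^ n) F \<in> VF"
  by (induction n) (auto intro: Aop_VF)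

lemma Aop_power_add: "F \<in> VF \<Longrightarrow> H \<in> VF \<Longrightarrow> (Aop ^^ n) (F + H) = (Aop ^^ n) F + (Aop ^^ n) H"
  by (induction n) (simp_all only: funpow.simps o_apply id_apply Aop_add Aop_power_VF)

definition R :: "nat \<Rightarrow> nat \<Rightarrow> (real \<Rightarrow> complex) \<Rightarrow> real \<Rightarrow> complex" where
  "R i j \<phi> = rowapp (W i) (PK (\<lambda>l. V j l \<phi>))"

definition Rk :: "nat kmat" where
  "Rk i j t \<phi> = R i j (rs \<phi>) t"

lemma rep_Rk: "rep (Rk i j) (R i j)"
  by (simp add: rep_def Rk_def)

lemma opr_V': "opr (\<lambda>\<phi>. V m i \<phi>)"
  using opr_state(4) .

lemma opr_R: "opr (R i j)"
  unfolding R_def[abs_def] by (rule opr_rowapp[OF opr_PK[OF opr_V']])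

lemma class_D_Rk:
  assumes "i < CARD('n)" "j < CARD('n)"
  shows "class_D I (Rk i j)"
proof -
  \<comment> \<open>The contribution of \<open>K\<close> has order \<open>j - 1\<close>; it is
    raised to order \<open>j\<close> with symbol 0 so that it can be added to
    \<open>V j\<close>.\<close>
  have "psd (int j) (\<lambda>_. 0) (\<lambda>\<phi>. \<Sum>m\<in>UNIV. Vol (K_entry l m) (V j m \<phi>))" for l
  proof (rule psd_le)
    show "psd (int j - 1) (\<lambda>t. \<Sum>m\<in>UNIV. K_entry l m t t * lv j t $ m) (\<lambda>\<phi>. \<Sum>m\<in>UNIV. Vol (K_entry l m) (V j m \<phi>))"
      by (rule psd_sum, rule psd_comp_order[OF psd_Vol_iff[OF K_entry_cinf2] psd_state(2)[OF assms(2)]]) simp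
  qed simp
  then have P: "psd (int j) (\<lambda>t. lv j t $ l + 0) (\<lambda>\<phi>. V j l \<phi> + (\<Sum>m\<in>UNIV. Vol (K_entry l m) (V j m \<phi>)))" for l
    by (rule psd_add[OF psd_state(2)[OF assms(2)]])
  have 1: "psd (- int i + int j) (\<lambda>t. \<Sum>l\<in>UNIV. lw i t $ l * (lv j t $ l + 0))
      (\<lambda>\<phi>. \<Sum>l\<in>UNIV. W i l (V j l \<phi> + (\<Sum>m\<in>UNIV. Vol (K_entry l m) (V j m \<phi>))))"
    by (rule psd_sum, rule psd_comp[OF psd_state(1)[OF assms(1)] P])
  have 2: "(\<lambda>\<phi>. \<Sum>l\<in>UNIV. W i l (V j l \<phi> + (\<Sum>m\<in>UNIV. Vol (K_entry l m) (V j m \<phi>)))) = R i j"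
    by (rule ext) (simp only: R_def rowapp_def PK_def plus_fun_apply[of _ "Kop _"] matapp_def)
  show ?thesis by (rule psd_class_D[OF 1[unfolded 2] rep_Rk])
qed

text \<open>\<open>T\<close> enters as the compression \<open>W A V\<close> of \<open>A\<close>; its
  tridiagonal shape is the content of \<open>WAV\<close> and is matched in the final proof.\<close>

context
  fixes T :: "nat kmat"
  assumes rep_T: "\<And>i j. i < CARD('n) \<Longrightarrow> j < CARD('n) \<Longrightarrow> rep (T i j) (\<lambda>\<phi>. rowapp (W i) (Aop (\<lambda>l. V j l \<phi>)))"
begin

lemma rep_one_minus_T:
  assumes "i < CARD('n)" "j < CARD('n)"
  shows "rep (kmat_minus (kmat_one I) T i j) (\<lambda>\<phi>. rowapp (W i) (PA (\<lambda>l. V j l \<phi>)))"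
proof -
  have "kmat_minus (kmat_one I) T i j = (\<lambda>t \<phi>. kmat_one I i j t \<phi> - T i j t \<phi>)"
    by (simp add: fun_eq_iff kmat_minus_def)
  then have "rep (kmat_minus (kmat_one I) T i j) (\<lambda>\<phi>. (if i = j then \<phi> else 0) - rowapp (W i) (Aop (\<lambda>l. V j l \<phi>)))"
    using rep_diff[OF rep_kmat_one rep_T[OF assms]] by simp
  then show ?thesis
  proof (rule rep_cong)
    fix \<phi> assume p: "\<phi> \<in> TF"
    show "(if i = j then \<phi> else 0) - rowapp (W i) (Aop (\<lambda>l. V j l \<phi>)) = rowapp (W i) (PA (\<lambda>l. V j l \<phi>))"
      unfolding PA_def rowapp_diff[OF opr_state(2) V_VF[OF p] AopV_VF[OF p]] WV[OF assms p] ..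
  qed
qed

lemma resolvent_T: "is_star_resolvent I {..<CARD('n)} T Rk"
  unfolding is_star_resolvent_def is_kmat_inverse_def kmat_eq_def
proof (intro conjI ballI)
  fix i j assume ij: "i \<in> {..<CARD('n)}" "j \<in> {..<CARD('n)}"
  then have i: "i < CARD('n)" and j: "j < CARD('n)" by auto
  show "class_D I (Rk i j)" by (rule class_D_Rk[OF i j])
  have o1: "opr (\<lambda>\<phi>. rowapp (W l) (PA (\<lambda>m. V j m \<phi>)))" for l
    by (rule opr_rowapp[OF opr_PA[OF opr_V']])
  have "rep (kmat_star {..<CARD('n)} Rk (kmat_minus (kmat_one I) T) i j)
      (\<lambda>\<phi>. \<Sum>k<CARD('n). R i k (rowapp (W k) (PA (\<lambda>m. V j m \<phi>))))"
    by (rule rep_kmat_star[where X = "R i" and Y = "\<lambda>l \<phi>. rowapp (W l) (PA (\<lambda>m. V j m \<phi>))"])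
      (use j in \<open>simp_all add: rep_Rk rep_one_minus_T o1\<close>)
  then show "keq I (kmat_star {..<CARD('n)} Rk (kmat_minus (kmat_one I) T) i j) (kmat_one I i j)"
  proof (rule keq_rep[OF _ rep_kmat_one])
    fix \<phi> assume p: "\<phi> \<in> TF"
    have "(\<Sum>k<CARD('n). R i k (rowapp (W k) (PA (\<lambda>m. V j m \<phi>)))) = rowapp (W i) (PK (PA (\<lambda>m. V j m \<phi>)))"
      unfolding R_def by (rule sandwich[OF PK_add PK_VF PA_VF[OF V_VF[OF p]]])
    then show "(\<Sum>k<CARD('n). R i k (rowapp (W k) (PA (\<lambda>m. V j m \<phi>)))) = (if i = j then \<phi> else 0)"
      by (simp only: PK_PA[OF V_VF[OF p]] WV[OF i j p])
  qed
  have "rep (kmat_star {..<CARD('n)} (kmat_minus (kmat_one I) T) Rk i j)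
      (\<lambda>\<phi>. \<Sum>k<CARD('n). rowapp (W i) (PA (\<lambda>l. V k l (R k j \<phi>))))"
    by (rule rep_kmat_star[where X = "\<lambda>k \<phi>. rowapp (W i) (PA (\<lambda>l. V k l \<phi>))" and Y = "\<lambda>k. R k j"])
      (use i in \<open>simp_all add: rep_Rk rep_one_minus_T opr_R\<close>)
  then show "keq I (kmat_star {..<CARD('n)} (kmat_minus (kmat_one I) T) Rk i j) (kmat_one I i j)"
  proof (rule keq_rep[OF _ rep_kmat_one])
    fix \<phi> assume p: "\<phi> \<in> TF"
    have "(\<Sum>k<CARD('n). rowapp (W i) (PA (\<lambda>l. V k l (R k j \<phi>)))) = rowapp (W i) (PA (PK (\<lambda>m. V j m \<phi>)))"
      unfolding R_def by (rule sandwich[OF PA_add PA_VF PK_VF[OF V_VF[OF p]]])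
    then show "(\<Sum>k<CARD('n). rowapp (W i) (PA (\<lambda>l. V k l (R k j \<phi>)))) = (if i = j then \<phi> else 0)"
      by (simp only: PA_PK[OF V_VF[OF p]] WV[OF i j p])
  qed
qed

lemma rep_T_power:
  assumes "i < CARD('n)" "j < CARD('n)"
  shows "rep (kmat_power I {..<CARD('n)} T n i j) (\<lambda>\<phi>. rowapp (W i) ((Aop ^^ n) (\<lambda>l. V j l \<phi>)))"
  using assms(1)
proof (induction n arbitrary: i)
  case 0
  show ?case
    unfolding kmat_power.simps by (rule rep_cong[OF rep_kmat_one]) (simp add: WV[OF 0 assms(2)])
next
  case (Suc n)
  have o1: "opr (\<lambda>\<phi>. rowapp (W l) ((Aop ^^ n) (\<lambda>m. V j m \<phi>)))" for l
    by (rule opr_rowapp[OF opr_Aop_power[OF opr_V']])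
  have "rep (kmat_star {..<CARD('n)} T (kmat_power I {..<CARD('n)} T n) i j)
      (\<lambda>\<phi>. \<Sum>k<CARD('n). rowapp (W i) (Aop (\<lambda>l. V k l (rowapp (W k) ((Aop ^^ n) (\<lambda>m. V j m \<phi>))))))"
    by (rule rep_kmat_star[where X = "\<lambda>k \<phi>. rowapp (W i) (Aop (\<lambda>l. V k l \<phi>))"
          and Y = "\<lambda>k \<phi>. rowapp (W k) ((Aop ^^ n) (\<lambda>m. V j m \<phi>))"])
      (use Suc.prems in \<open>simp_all add: rep_T Suc.IH o1\<close>)
  then show ?case
    unfolding kmat_power.simps
    by (rule rep_cong) (simp add: sandwich[OF Aop_add Aop_VF Aop_power_VF[OF V_VF]])
qed

end

section \<open>Powers of the time-dependent matrix between constant vectors\<close>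

definition unit_vec :: "'n \<Rightarrow> (real \<Rightarrow> complex) \<Rightarrow> 'n \<Rightarrow> real \<Rightarrow> complex" where
  "unit_vec j \<phi> l = (if l = j then \<phi> else 0)"

lemma opr_unit_vec: "opr (\<lambda>\<phi>. unit_vec j \<phi> l)"
proof (cases "l = j")
  case True
  then have "(\<lambda>\<phi>. unit_vec j \<phi> l) = (\<lambda>\<phi>. \<phi>)" by (simp add: unit_vec_def fun_eq_iff)
  then show ?thesis using opr_id by (simp only:)
next
  case False
  then have "(\<lambda>\<phi>. unit_vec j \<phi> l) = (\<lambda>\<phi>. 0)" by (simp add: unit_vec_def fun_eq_iff)
  then show ?thesis using opr_zero_op by (simp only:)
qed

lemma rep_A_power:
  "rep (kmat_power I UNIV (matrix_kernel I A) n i j) (\<lambda>\<phi>. (Aop ^^ n) (unit_vec j \<phi>) i)"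
proof (induction n arbitrary: i)
  case 0
  show ?case
    unfolding kmat_power.simps by (rule rep_cong[OF rep_kmat_one]) (simp add: unit_vec_def)
next
  case (Suc n)
  have m: "rep (matrix_kernel I A i l) (Vol (A_entry i l))" for i l
    using rep_Vol[of "A_entry i l"] by (simp add: matrix_kernel_def A_entry_def[abs_def])
  have "rep (kmat_star UNIV (matrix_kernel I A) (kmat_power I UNIV (matrix_kernel I A) n) i j)
      (\<lambda>\<phi>. \<Sum>l\<in>UNIV. Vol (A_entry i l) ((Aop ^^ n) (unit_vec j \<phi>) l))"
    by (rule rep_kmat_star[where X = "\<lambda>l. Vol (A_entry i l)" and Y = "\<lambda>l \<phi>. (Aop ^^ n) (unit_vec j \<phi>) l"])
      (rule m Suc.IH opr_Aop_power opr_unit_vec)+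
  then show ?case
    unfolding kmat_power.simps funpow.simps o_apply by (rule rep_cong) (rule matapp_def[symmetric])
qed

lemma rep_form_A_power:
  "rep (kmat_form w (kmat_power I UNIV (matrix_kernel I A) n) v) (\<lambda>\<phi>. rowapp (W 0) ((Aop ^^ n) (\<lambda>l. V 0 l \<phi>)))"
  unfolding rep_def
proof (intro ballI allI impI)
  fix t \<phi> assume t: "t \<in> I" and p: "rs \<phi> \<in> TF"
  let ?\<phi> = "rs \<phi>"
  have uv: "unit_vec j \<psi> \<in> VF" if "\<psi> \<in> TF" for j \<psi>
    by (rule VF_I) (use that TF_zero in \<open>simp add: unit_vec_def\<close>)
  have c: "(\<lambda>t. v $ j * ?\<phi> t) \<in> TF" for j by (rule TF_cmult[OF p])
  \<comment> \<open>The powers of the kernel matrix are known entry by entry, that is, on unit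
    vectors, so the constant vector \<open>v\<close> is split into these.\<close>
  have "(\<lambda>l. V 0 l ?\<phi>) = (\<Sum>j\<in>UNIV. unit_vec j (\<lambda>t. v $ j * ?\<phi> t))"
  proof (intro ext)
    fix l t
    have "(\<Sum>j\<in>UNIV. unit_vec j (\<lambda>t. v $ j * ?\<phi> t)) l t = (\<Sum>j\<in>UNIV. if l = j then v $ j * ?\<phi> t else 0)"
      unfolding sum_fun_apply by (rule sum.cong) (auto simp: unit_vec_def)
    then show "V 0 l ?\<phi> t = (\<Sum>j\<in>UNIV. unit_vec j (\<lambda>t. v $ j * ?\<phi> t)) l t" by (simp add: o_0)
  qed
  then have "(Aop ^^ n) (\<lambda>l. V 0 l ?\<phi>) = (\<Sum>j\<in>UNIV. (Aop ^^ n) (unit_vec j (\<lambda>t. v $ j * ?\<phi> t)))"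
    using additive_sum[where Y = VF and f = "Aop ^^ n" and F = UNIV, OF Aop_power_add VF_zero VF_add uv[OF c]] by simp
  then have e: "(Aop ^^ n) (\<lambda>l. V 0 l ?\<phi>) i t = (\<Sum>j\<in>UNIV. v $ j * (Aop ^^ n) (unit_vec j ?\<phi>) i t)" for i
    using opr_cmult[OF opr_Aop_power[OF opr_unit_vec] p] by (simp add: sum_fun_apply)
  have W0: "rowapp (W 0) F t = (\<Sum>i\<in>UNIV. cnj (w $ i) * F i t)" for F
    by (simp add: rowapp_def sum_fun_apply o_0)
  show "kmat_form w (kmat_power I UNIV (matrix_kernel I A) n) v t \<phi> = rowapp (W 0) ((Aop ^^ n) (\<lambda>l. V 0 l ?\<phi>)) t"
    unfolding W0 e by (simp add: kmat_form_def repD[OF rep_A_power t p] sum_distrib_left mult_ac)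
qed

section \<open>The time-ordered exponential\<close>

definition L :: "complex^'n^'n \<Rightarrow> complex" where
  "L M = row_dot (herm w) (M *v v)"

lemma bounded_linear_L: "bounded_linear L"
  unfolding L_def row_dot_def matrix_vector_mult_def vec_lambda_beta
  by (intro bounded_linear_sum bounded_linear_const_mult bounded_linear_mult_const bounded_linear_entry)

definition \<kappa> :: "real \<Rightarrow> real \<Rightarrow> complex" where
  "\<kappa> x y = L (K x y)"

lemma kappa_cinf2: "cinf2 \<kappa>"
  unfolding \<kappa>_def using cinf_linear[OF bounded_linear_L K_facts(1)] by (simp add: split_beta')

text \<open>The first Lanczos vectors are the constants \<open>w\<close> and \<open>v\<close>, so
  this entry is \<open>1 + K\<close> between them, and the identity contributes \<open>w\<close>
  against \<open>v\<close>, which is 1.\<close>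

lemma R_00: "\<phi> \<in> TF \<Longrightarrow> R 0 0 \<phi> = \<phi> + Vol \<kappa> \<phi>"
proof -
  assume p: "\<phi> \<in> TF"
  have 1: "cinf2 (\<lambda>x y. cnj (w $ l) * (K_entry l m x y * v $ m))" for l m
    by (intro cinf2_mult cinf2_const K_entry_cinf2)
  have t: "Vol (\<lambda>x y. cnj (w $ l) * (K_entry l m x y * v $ m)) \<phi> = (\<lambda>t. cnj (w $ l) * Vol (K_entry l m) (\<lambda>t. v $ m * \<phi> t) t)" for l m
    unfolding Vol_mult_right[OF cinf_const K_entry_cinf2 p]
    by (rule Vol_mult_left[OF cinf_const cinf2_mult[OF K_entry_cinf2 cinf2_const] p, symmetric])
  have "\<kappa> = (\<lambda>x y. \<Sum>l\<in>UNIV. \<Sum>m\<in>UNIV. cnj (w $ l) * (K_entry l m x y * v $ m))"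
    by (simp add: \<kappa>_def L_def row_dot_def herm_def matrix_vector_mult_def K_entry_def sum_distrib_left fun_eq_iff)
  then have "Vol \<kappa> \<phi> = (\<Sum>l\<in>UNIV. \<Sum>m\<in>UNIV. (\<lambda>t. cnj (w $ l) * Vol (K_entry l m) (\<lambda>t. v $ m * \<phi> t) t))"
    by (simp only: Vol_sum[OF cinf2_sum[OF 1] p] Vol_sum[OF 1 p] t)
  also have "\<dots> = rowapp (W 0) (Kop (\<lambda>l. V 0 l \<phi>))"
    by (simp add: rowapp_def matapp_def o_0 fun_eq_iff sum_fun_apply sum_distrib_left)
  finally show ?thesis
    unfolding R_def PK_def rowapp_add[OF opr_state(2) V_VF[OF p] Kop_VF[OF V_VF[OF p]]]
    using WV[of 0 0, OF _ _ p] by simp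
qed

text \<open>The smooth part of Theta \<open>*\<close> \<open>(1 + K)\<close>. It is the expected
  time-ordered exponential, extended to all pairs of times.\<close>

definition E :: "real \<Rightarrow> real \<Rightarrow> complex^'n^'n" where
  "E t s = mat 1 + sint s t (\<lambda>\<tau>. K \<tau> s)"

text \<open>By construction the derivative of \<open>E\<close> is \<open>K\<close>, and the
  resolvent equation \<open>K = A + A * K\<close> says precisely that \<open>K\<close> is
  \<open>A\<close> times \<open>E\<close>.\<close>

lemma E_deriv:
  assumes "s \<in> I" "t \<in> I"
  shows "((\<lambda>t. E t s) has_vector_derivative A t ** E t s) (at t within I)"
proof -
  have c: "continuous_on I (\<lambda>\<tau>. K \<tau> s)"
    by (rule cinf_continuous_on[OF cinf_section1[OF K_facts(1) assms(1)]])
  have "((\<lambda>t. E t s) has_vector_derivative K t s) (at t within I)"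
    unfolding E_def using has_vector_derivative_add[OF has_vector_derivative_const sint_has_vector_derivative[OF c assms]] by simp
  moreover have "K t s = A t ** E t s"
  proof -
    have "mm.vstar (\<lambda>x y. A x) K t s = A t ** sint s t (\<lambda>\<tau>. K \<tau> s)"
      unfolding mm.vstar_def by (rule sint_linear[OF mm.bounded_linear_right c assms])
    then show ?thesis using K_facts(2)[OF assms(2,1)] by (simp add: E_def matrix_add_ldistrib)
  qed
  ultimately show ?thesis by simp
qed

text \<open>The difference solves the homogeneous linear equation with initial value 0, and its norm
  satisfies the hypothesis of \<open>gronwall_zero\<close>.\<close>

lemma time_ordered_exp_eq:
  assumes U: "is_time_ordered_exp I A U" and s: "s \<in> I" and t: "t \<in> I" and st: "s \<le> t"
  shows "U t s = E t s"
proof -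
  define D where "D r = U r s - E r s" for r
  have sub: "{s..t} \<subseteq> I" by (rule interval_subset[OF s t])
  have D': "(D has_vector_derivative A r ** D r) (at r within {s..t})" if r: "r \<in> {s..t}" for r
  proof -
    have "((\<lambda>r. U r s) has_vector_derivative A r ** U r s) (at r within (I \<inter> {s..}))"
      using U s r sub unfolding is_time_ordered_exp_def by auto
    then have "((\<lambda>r. U r s) has_vector_derivative A r ** U r s) (at r within {s..t})"
      by (rule has_vector_derivative_within_subset) (use sub in auto)
    moreover have "((\<lambda>r. E r s) has_vector_derivative A r ** E r s) (at r within {s..t})"
      by (rule has_vector_derivative_within_subset[OF E_deriv[OF s]]) (use sub r in auto)
    ultimately show ?thesis
      unfolding D_def[abs_def] by (auto dest: has_vector_derivative_diff simp: mm.diff_right)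
  qed
  have D0: "D s = 0" using U s by (simp add: D_def E_def is_time_ordered_exp_def)
  have cD: "continuous_on {s..t} D"
    by (rule continuous_on_vector_derivative[OF D'])
  have "\<exists>C>0. \<forall>(a :: complex^'n^'n) (b :: complex^'n^'n). norm (a ** b) \<le> norm a * norm b * C"
    by (rule mm.pos_bounded)
  then obtain C where C: "C > 0" "\<forall>(a :: complex^'n^'n) (b :: complex^'n^'n). norm (a ** b) \<le> norm a * norm b * C"
    by (elim exE conjE)
  have cA: "continuous_on {s..t} A" by (rule continuous_on_subset[OF cinf_continuous_on[OF A_cinf] sub])
  then have "bounded (A ` {s..t})" by (intro compact_imp_bounded compact_continuous_image) auto
  then obtain M where M: "M > 0" "\<And>r. r \<in> {s..t} \<Longrightarrow> norm (A r) \<le> M" unfolding bounded_pos by auto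
  have "norm (D t) \<le> 0"
  proof (rule gronwall_zero[where g = "\<lambda>r. norm (D r)" and a = s and b = t and C = "M * C"])
    show "continuous_on {s..t} (\<lambda>r. norm (D r))" by (intro continuous_on_norm cD)
    show "0 \<le> M * C" using M(1) C(1) by simp
    show "t \<in> {s..t}" using st by simp
    fix x assume x: "x \<in> {s..t}"
    have sx: "{s..x} \<subseteq> {s..t}" using x by auto
    have i: "((\<lambda>r. A r ** D r) has_integral D x - D s) {s..x}"
      by (rule fundamental_theorem_of_calculus)
        (use x sx in \<open>auto intro: has_vector_derivative_within_subset[OF D']\<close>)
    have nD: "(\<lambda>r. norm (D r)) integrable_on {s..x}"
      by (intro integrable_continuous_interval continuous_on_norm continuous_on_subset[OF cD sx])
    have "norm (integral {s..x} (\<lambda>r. A r ** D r)) \<le> integral {s..x} (\<lambda>r. M * C * norm (D r))"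
    proof (rule integral_norm_bound_integral)
      show "(\<lambda>r. A r ** D r) integrable_on {s..x}" using i by blast
      show "(\<lambda>r. M * C * norm (D r)) integrable_on {s..x}" using integrable_on_cmult_left[OF nD] by simp
      fix r assume r: "r \<in> {s..x}"
      have "norm (A r ** D r) \<le> norm (A r) * norm (D r) * C" using C(2) by blast
      also have "\<dots> \<le> M * norm (D r) * C"
        using M(2)[of r] r sx C(1) by (intro mult_right_mono) auto
      finally show "norm (A r ** D r) \<le> M * C * norm (D r)" by (simp add: mult_ac)
    qed
    then show "norm (D x) \<le> M * C * integral {s..x} (\<lambda>r. norm (D r))"
      using i D0 by (simp add: integral_unique)
  qed
  then show ?thesis by (simp add: D_def)
qed

text \<open>Pairing \<open>E\<close> with \<open>w\<close> and \<open>v\<close> gives 1 plus an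
  integral of \<open>\<kappa>\<close>, and this is the smooth part of Theta \<open>*\<close>
  \<open>(1 + \<kappa>)\<close>. For \<open>t' < t\<close> the convention that \<open>U\<close> is 0
  matches the Heaviside factor.\<close>

lemma resolvent_representation:
  assumes U: "is_time_ordered_exp I A U"
  shows "keq I (fun_kernel I (\<lambda>t' t. row_dot (herm w) (U t' t *v v)))
    (star (fun_kernel I (times_theta (\<lambda>_ _. 1))) (Rk 0 0))"
proof -
  define e where "e t s = 1 + cm.vstar (\<lambda>_ _. 1) \<kappa> t s" for t s
  have v2: "cinf2 (cm.vstar (\<lambda>_ _. 1) \<kappa>)" by (intro cinf2_vstar cinf2_const kappa_cinf2)
  have eL: "e t s = L (E t s)" if "s \<in> I" "t \<in> I" for t s
  proof -
    have c: "continuous_on I (\<lambda>\<tau>. K \<tau> s)"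
      by (rule cinf_continuous_on[OF cinf_section1[OF K_facts(1) that(1)]])
    have "L (mat 1) = 1" using wv by (simp add: L_def)
    then show ?thesis
      using sint_linear[OF bounded_linear_L c that] linear_add[OF bounded_linear.linear[OF bounded_linear_L]]
      by (simp add: E_def e_def cm.vstar_def \<kappa>_def)
  qed
  have "rep (fun_kernel I (\<lambda>t' t. row_dot (herm w) (U t' t *v v))) (Vol e)"
    unfolding rep_def
  proof (intro ballI allI impI)
    fix t \<phi> assume t: "t \<in> I" and p: "rs \<phi> \<in> TF"
    have "row_dot (herm w) (U t s *v v) = times_theta e t s" if s: "s \<in> I" for s
    proof (cases "s \<le> t")
      case True
      then show ?thesis using time_ordered_exp_eq[OF U s t] eL[OF s t] by (simp add: times_theta_def heaviside_def L_def)
    next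
      case False
      then have "U t s = 0" using U s t unfolding is_time_ordered_exp_def by auto
      then show ?thesis using False by (simp add: times_theta_def heaviside_def row_dot_zero)
    qed
    then have "fun_kernel I (\<lambda>t' t. row_dot (herm w) (U t' t *v v)) t \<phi> = fun_kernel I (times_theta e) t \<phi>"
      unfolding fun_kernel_def by (intro Henstock_Kurzweil_Integration.integral_cong) simp
    then show "fun_kernel I (\<lambda>t' t. row_dot (herm w) (U t' t *v v)) t \<phi> = Vol e (rs \<phi>) t"
      using repD[OF rep_Vol t p] by simp
  qed
  moreover have "rep (star (fun_kernel I (times_theta (\<lambda>_ _. 1))) (Rk 0 0)) (\<lambda>\<phi>. Jop (R 0 0 \<phi>))"
    by (rule rep_star[OF rep_Vol rep_Rk opr_R])
  ultimately show ?thesis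
  proof (rule keq_rep)
    fix \<phi> assume p: "\<phi> \<in> TF"
    have "Vol e \<phi> = Jop \<phi> + Vol (cm.vstar (\<lambda>_ _. 1) \<kappa>) \<phi>"
      unfolding e_def[abs_def] by (rule Vol_add[OF cinf2_const v2 p])
    also have "\<dots> = Jop (R 0 0 \<phi>)"
      unfolding R_00[OF p] Vol_comp[OF cinf2_const kappa_cinf2 p, symmetric]
      by (rule opr_add[OF Vol_opr[OF cinf2_const] p Vol_TF[OF kappa_cinf2 p], symmetric])
    finally show "Vol e \<phi> = Jop (R 0 0 \<phi>)" .
  qed
qed

text \<open>\<open>Dp (- 3)\<close> after the inverse has order \<open>- 3 + 2 = - 1\<close>, so it
  is given by a smooth kernel \<open>b\<close>, and applying \<open>Dp 3\<close> recovers the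
  inverse.\<close>

lemma star_inverse_B:
  assumes i: "0 < i" "i < CARD('n)" and d: "rep d (B i)"
  shows "\<exists>dinv b. is_star_inverse I d dinv \<and> class_Sm_theta I b \<and> keq I dinv (star (delta I 3) b)"
proof -
  obtain Y where Y: "psd 2 (\<lambda>t. inverse (lb i t)) Y" "\<And>\<phi>. \<phi> \<in> TF \<Longrightarrow> B i (Y \<phi>) = \<phi>" "\<And>\<phi>. \<phi> \<in> TF \<Longrightarrow> Y (B i \<phi>) = \<phi>"
    using psd_inverse[OF psd_state(3)[OF i(2)] lb_nz[OF _ i]] by auto
  have rY: "rep (\<lambda>t \<phi>. Y (rs \<phi>) t) Y" by (rule rep_canonical)
  have "is_star_inverse I d (\<lambda>t \<phi>. Y (rs \<phi>) t)"
    unfolding is_star_inverse_def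
    by (intro conjI psd_class_D[OF Y(1) rY] keq_rep[OF rep_star[OF rY d opr_state(5)] rep_star_one]
        keq_rep[OF rep_star[OF d rY psd_opr[OF Y(1)]] rep_star_one] Y)
  moreover have "psd (- 1) (\<lambda>t. 1 * inverse (lb i t)) (\<lambda>\<phi>. Dp (- 3) (Y \<phi>))"
    by (rule psd_comp_order[OF psd_Dp Y(1)]) simp
  then obtain g where g: "cinf2 g" "\<And>t. t \<in> I \<Longrightarrow> g t t = 1 * inverse (lb i t)" "\<And>\<phi>. \<phi> \<in> TF \<Longrightarrow> Dp (- 3) (Y \<phi>) = Vol g \<phi>"
    using psd_Vol by blast
  have "keq I (\<lambda>t \<phi>. Y (rs \<phi>) t) (star (delta I 3) (fun_kernel I (times_theta g)))"
  proof (rule keq_rep[OF rY rep_star[OF rep_delta rep_Vol Vol_opr[OF g(1)]]])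
    fix \<phi> assume p: "\<phi> \<in> TF"
    show "Y \<phi> = Dp (int 3) (Vol g \<phi>)"
      using Dp_add[OF opr_TF[OF psd_opr[OF Y(1)] p], of 3 "- 3"] by (simp add: g(3)[OF p, symmetric])
  qed
  ultimately show ?thesis using class_Sm_theta_Vol[OF g(1) rep_Vol] by blast
qed

end

theorem theorem2p1:
  fixes I :: "real set"
    and A :: "real \<Rightarrow> complex^'n^'n"
    and U :: "real \<Rightarrow> real \<Rightarrow> complex^'n^'n"
    and w v :: "complex^'n"
  assumes "is_interval I" and "interior I \<noteq> {}"
    and "is_time_ordered_exp I A U"
    and "row_dot (herm w) v = 1"
    and "\<forall>t'\<in>I. \<forall>k\<in>{1..CARD('n) - 1}. no_breakdown (A t') w v k"
    and "\<forall>i j. smooth_on I (\<lambda>t'. A t' $ i $ j)"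
  shows "\<exists>(\<alpha>t :: nat \<Rightarrow> real \<Rightarrow> real \<Rightarrow> complex) (\<beta>t :: nat \<Rightarrow> real \<Rightarrow> real \<Rightarrow> complex).
    (\<forall>j\<in>{0..CARD('n) - 1}. smooth2_on I (\<alpha>t j)) \<and>
    (\<forall>i\<in>{1..CARD('n) - 1}. smooth2_on I (\<beta>t i)) \<and>
    (\<forall>i\<in>{1..CARD('n) - 1}.
       (\<forall>t\<in>I. times_theta (\<beta>t i) t t = 0) \<and>
       \<not> (\<forall>t\<in>I. partial_deriv I 1 0 (\<beta>t i) t t = 0) \<and>
       \<not> (\<forall>t\<in>I. partial_deriv I 0 1 (\<beta>t i) t t = 0)) \<and>
    (let \<alpha> = (\<lambda>j. fun_kernel I (times_theta (\<alpha>t j)));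
         \<beta> = (\<lambda>i. fun_kernel I (times_theta (\<beta>t i)));
         T = tridiag I \<alpha> \<beta>;
         S = {0..CARD('n) - 1}
     in (\<forall>n. keq I (kmat_form w (kmat_power I UNIV (matrix_kernel I A) n) v)
                   (kmat_power I S T n 0 0)) \<and>
        (\<exists>R. is_star_resolvent I S T R \<and>
             keq I (fun_kernel I (\<lambda>t' t. row_dot (herm w) (U t' t *v v)))
                   (star (fun_kernel I (times_theta (\<lambda>_ _. 1))) (R 0 0))) \<and>
        (\<forall>i\<in>{1..CARD('n) - 1}.
           \<exists>\<beta>inv b. is_star_inverse I (\<beta> i) \<beta>inv \<and> class_Sm_theta I b \<and>
                   keq I \<beta>inv (star (delta I 3) b)))"
proof -
  interpret nondegenerate_interval I by standard fact+
  interpret lanczos_setup I A w v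
    by standard (use assms smooth_on_iff_cinf in auto)
  \<comment> \<open>The bound on the index stays inside the existential so that one function can be
    chosen for all indices at once.\<close>
  have "\<forall>j. \<exists>g. j < CARD('n) \<longrightarrow> cinf2 g \<and> (\<forall>\<phi>\<in>TF. AL j \<phi> = Vol g \<phi>)"
    using psd_Vol[OF psd_AL] by metis
  then obtain \<alpha>t where \<alpha>t: "\<And>j. j < CARD('n) \<Longrightarrow> cinf2 (\<alpha>t j)"
    "\<And>j \<phi>. j < CARD('n) \<Longrightarrow> \<phi> \<in> TF \<Longrightarrow> AL j \<phi> = Vol (\<alpha>t j) \<phi>" by metis
  have "\<exists>g. i < CARD('n) \<longrightarrow> cinf2 g \<and> (\<forall>\<phi>\<in>TF. B i \<phi> = Vol g \<phi>) \<and>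
      (\<forall>t\<in>I. g t t = 0 \<and> D1 g t t = lb i t \<and> D2 g t t = - lb i t)" for i
  proof (cases "i < CARD('n)")
    case True
    obtain f where "cinf2 f" "\<And>\<phi>. \<phi> \<in> TF \<Longrightarrow> B i \<phi> = Vol f \<phi>" "\<And>t. t \<in> I \<Longrightarrow> f t t = 0"
      "\<And>t. t \<in> I \<Longrightarrow> D1 f t t = lb i t" "\<And>t. t \<in> I \<Longrightarrow> D2 f t t = - lb i t"
      using psd_minus2[OF psd_state(3)[OF True]] by blast
    then show ?thesis by (intro exI[of _ f]) simp
  qed simp
  then obtain \<beta>t where \<beta>t': "\<forall>i. i < CARD('n) \<longrightarrow> cinf2 (\<beta>t i) \<and> (\<forall>\<phi>\<in>TF. B i \<phi> = Vol (\<beta>t i) \<phi>) \<and>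
      (\<forall>t\<in>I. \<beta>t i t t = 0 \<and> D1 (\<beta>t i) t t = lb i t \<and> D2 (\<beta>t i) t t = - lb i t)" by metis
  have \<beta>t: "cinf2 (\<beta>t i)" "\<And>\<phi>. \<phi> \<in> TF \<Longrightarrow> B i \<phi> = Vol (\<beta>t i) \<phi>"
    "\<And>t. t \<in> I \<Longrightarrow> \<beta>t i t t = 0" "\<And>t. t \<in> I \<Longrightarrow> partial_deriv I 1 0 (\<beta>t i) t t = lb i t"
    "\<And>t. t \<in> I \<Longrightarrow> partial_deriv I 0 1 (\<beta>t i) t t = - lb i t" if "i < CARD('n)" for i
    using \<beta>t' that unfolding partial_deriv_10 partial_deriv_01 by blast+
  define T where "T = tridiag I (\<lambda>j. fun_kernel I (times_theta (\<alpha>t j))) (\<lambda>i. fun_kernel I (times_theta (\<beta>t i)))"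
  have rep_B: "rep (fun_kernel I (times_theta (\<beta>t i))) (B i)" if "i < CARD('n)" for i
    by (rule rep_cong[OF rep_Vol]) (simp add: \<beta>t(2)[OF that])
  have rep_AL: "rep (fun_kernel I (times_theta (\<alpha>t i))) (AL i)" if "i < CARD('n)" for i
    by (rule rep_cong[OF rep_Vol]) (simp add: \<alpha>t(2)[OF that])
  \<comment> \<open>By \<open>WAV\<close> the tridiagonal matrix of kernels represents
    \<open>W A V\<close>, the form in which powers and resolvent are known.\<close>
  have rep_T: "rep (T i j) (\<lambda>\<phi>. rowapp (W i) (Aop (\<lambda>l. V j l \<phi>)))" if ij: "i < CARD('n)" "j < CARD('n)" for i j
  proof -
    have "rep (T i j) (\<lambda>\<phi>. if j = i then AL i \<phi> else if j = Suc i then \<phi> else if i = Suc j then B i \<phi> else 0)"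
      using rep_B rep_AL ij rep_star_one rep_zero by (simp add: T_def tridiag_def)
    then show ?thesis by (rule rep_cong) (simp only: WAV[OF ij])
  qed
  have "CARD('n) = Suc (CARD('n) - 1)" by simp
  then have S: "{0..CARD('n) - 1} = {..<CARD('n)}" by (metis atLeast0AtMost lessThan_Suc_atMost)
  \<comment> \<open>One time suffices to refute that the diagonal derivatives are identically null;
    they are the coefficient \<open>b\<close> of the usual algorithm and its negative.\<close>
  obtain t0 where t0: "t0 \<in> I" using int_ne interior_subset by blast
  show ?thesis
    unfolding Let_def S T_def[symmetric]
  proof (rule exI[of _ \<alpha>t], rule exI[of _ \<beta>t], unfold T_def[symmetric], intro conjI ballI allI)
    fix j assume "j \<in> {..<CARD('n)}"
    then show "smooth2_on I (\<alpha>t j)" using cinf2_imp_smooth2_on[OF \<alpha>t(1)] by simp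
  next
    fix i assume "i \<in> {1..CARD('n) - 1}"
    then have i: "0 < i" "i < CARD('n)" by auto
    show "smooth2_on I (\<beta>t i)" using cinf2_imp_smooth2_on[OF \<beta>t(1)] i by simp
    show "times_theta (\<beta>t i) t t = 0" if "t \<in> I" for t using \<beta>t(3)[OF i(2) that] by (simp add: times_theta_def)
    show "\<not> (\<forall>t\<in>I. partial_deriv I 1 0 (\<beta>t i) t t = 0)"
      using \<beta>t(4)[OF i(2) t0] lb_nz[OF t0 i] t0 by metis
    show "\<not> (\<forall>t\<in>I. partial_deriv I 0 1 (\<beta>t i) t t = 0)"
      using \<beta>t(5)[OF i(2) t0] lb_nz[OF t0 i] t0 by (metis neg_equal_0_iff_equal)
    show "\<exists>\<beta>inv b. is_star_inverse I (fun_kernel I (times_theta (\<beta>t i))) \<beta>inv \<and> class_Sm_theta I b \<and>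
        keq I \<beta>inv (star (delta I 3) b)"
      by (rule star_inverse_B[OF i rep_B[OF i(2)]])
  next
    fix n
    show "keq I (kmat_form w (kmat_power I UNIV (matrix_kernel I A) n) v) (kmat_power I {..<CARD('n)} T n 0 0)"
      by (rule keq_rep[OF rep_form_A_power rep_T_power[OF rep_T]]) auto
  next
    show "\<exists>R. is_star_resolvent I {..<CARD('n)} T R \<and>
        keq I (fun_kernel I (\<lambda>t' t. row_dot (herm w) (U t' t *v v)))
          (star (fun_kernel I (times_theta (\<lambda>_ _. 1))) (R 0 0))"
      using resolvent_T[OF rep_T] resolvent_representation[OF assms(3)] by blast
  qed
qed

end
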